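(* Let $M=M_1\times_fM_2$ be a warped product mixed totally geodesic proper pointwise bi-slant submanifold of a Kenmotsu manifold $(\bar M,\phi,\xi,\eta,g)$ such that $\xi\in\Gamma(TM_1)$, with slant functions $\theta_1$ of $M_1$ and $\theta_2$ of $M_2$, where $\dim M_1=2p+1$ and $\dim M_2=2q$. Let $\{e_1,\dots,e_p,\ e_{p+1}=\sec\theta_1P_1e_1,\dots,e_{2p}=\sec\theta_1P_1e_p,\ e_{2p+1}=\xi\}$ be a local orthonormal frame of $TM_1$. Then: (i) The squared norm of the second fundamental form $h$ of $M$ satisfies $$\|h\|^2\ \ge\ 2q\csc^2\theta_1\,(\cos^2\theta_1+\cos^2\theta_2)\Big\{\|\boldsymbol{\nabla}^{\theta_1}\ln f\|^2-1-\sum_{r=1}^{p}(e_r\ln f)^2\Big\},$$ where $\boldsymbol{\nabla}^{\theta_1}\ln f$ is the gradient of $\ln f$ along $M_1$. (ii) If equality holds in the inequality of (i), then $M_1$ is totally geodesic in $\bar M$ and $M_2$ is totally umbilical in $\bar M$.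
   Context: Kenmotsu manifold: a smooth manifold $\bar M^{2m+1}$ with a $(1,1)$-tensor $\phi$, vector field $\xi$, 1-form $\eta$ and Riemannian metric $g$ such that $\phi\xi=0$, $\eta\circ\phi=0$, $\phi^2X=-X+\eta(X)\xi$, $\eta(X)=g(X,\xi)$, $\eta(\xi)=1$, $g(\phi X,\phi Y)=g(X,Y)-\eta(X)\eta(Y)$, and, for the Levi-Civita connection $\bar\nabla$, $\bar\nabla_X\xi=X-\eta(X)\xi$ and $(\bar\nabla_X\phi)Y=g(\phi X,Y)\xi-\eta(Y)\phi X$. Submanifold notation: $M$ is a submanifold of $\bar M$ tangent to $\xi$, with induced metric $g$ and induced connection $\nabla$; $h$ is its second fundamental form ($\bar\nabla_XY=\nabla_XY+h(X,Y)$), and $\|h\|^2=\sum_{i,j}g(h(e_i,e_j),h(e_i,e_j))$ over an orthonormal frame $\{e_i\}$ of $TM$. For $X$ tangent to $M$ write $\phi X=PX+QX$ with $PX$ tangent and $QX$ normal. A submanifold with second fundamental form $h$ and mean curvature vector $H$ is totally geodesic if $h=0$ and totally umbilical if $h(X,Y)=g(X,Y)H$. Pointwise bi-slant submanifold: $TM=\mathcal D_1\oplus\mathcal D_2\oplus\{\xi\}$ is an orthogonal decomposition into distributions, $\phi(\mathcal D_1)\perp\mathcal D_2\oplus\{\xi\}$, and each $\mathcal D_i$ is pointwise slant with slant function $\theta_i$: at each $p\in M$, for every nonzero $X\in(\mathcal D_i)_p$ the angle between $\phi X$ and $(\mathcal D_i)_p$ equals $\theta_i(p)\in[0,\pi/2]$.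 With $T_i$ the projection onto $\mathcal D_i$, $P_i=T_i\circ P$. $M$ is proper if $\theta_1,\theta_2\neq0,\frac{\pi}{2}$ and both are non-constant on $M$. Warped product: for Riemannian manifolds $(N_1,g_1),(N_2,g_2)$ and a positive smooth function $f$ on $N_1$, $N_1\times_fN_2$ is $N_1\times N_2$ with the metric $g_1+f^2g_2$. A warped product pointwise bi-slant submanifold $M=M_1\times_fM_2$ with $\xi\in\Gamma(TM_1)$ is a pointwise bi-slant submanifold which is such a warped product (with the induced metric) with $TM_1=\mathcal D_1\oplus\{\xi\}$ and $TM_2=\mathcal D_2$. It is mixed totally geodesic if $h(X,Z)=0$ for all $X\in\Gamma(TM_1)$, $Z\in\Gamma(TM_2)$. *)

theory Defs
  imports "HOL-Analysis.Analysis"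
begin

section \<open>Smooth maps between open subsets of Euclidean spaces\<close>

text \<open>Class \<open>C\<^sup>k\<close> and class \<open>C\<^sup>\<infinity>\<close>; only used on open sets.\<close>

primrec Ck_on :: "nat \<Rightarrow> ('d::euclidean_space \<Rightarrow> 'e::euclidean_space) \<Rightarrow> 'd set \<Rightarrow> bool" where
  "Ck_on 0 f S \<longleftrightarrow> continuous_on S f"
| "Ck_on (Suc k) f S \<longleftrightarrow>
     (\<forall>x\<in>S. f differentiable (at x)) \<and> (\<forall>v. Ck_on k (\<lambda>x. frechet_derivative f (at x) v) S)"

definition smooth_on :: "'d::euclidean_space set \<Rightarrow> ('d \<Rightarrow> 'e::euclidean_space) \<Rightarrow> bool" where
  "smooth_on S f \<longleftrightarrow> (\<forall>k. Ck_on k f S)"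


section \<open>Smooth manifolds\<close>

text \<open>A chart is a pair of its domain and its coordinate map. The points of a manifold form a
  whole (topological) type; its smooth structure is given by an atlas, not necessarily maximal.\<close>

type_synonym ('a, 'd) chart = "'a set \<times> ('a \<Rightarrow> 'd)"

definition chart_inv :: "('a, 'd) chart \<Rightarrow> 'd \<Rightarrow> 'a" where
  "chart_inv c = inv_into (fst c) (snd c)"

definition smooth_atlas ::
    "('a::{t2_space,second_countable_topology}, 'd::euclidean_space) chart set \<Rightarrow> bool" where
  "smooth_atlas A \<longleftrightarrow>
     (\<Union>c\<in>A. fst c) = UNIV \<and>
     (\<forall>c\<in>A. open (fst c) \<and> open (snd c ` fst c) \<and>
        homeomorphism (fst c) (snd c ` fst c) (snd c) (chart_inv c)) \<and>
     (\<forall>c\<in>A. \<forall>d\<in>A. smooth_on (snd c ` (fst c \<inter> fst d)) (snd d \<circ> chart_inv c))"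

definition prod_atlas :: "('a, 'd) chart set \<Rightarrow> ('b, 'e) chart set \<Rightarrow> ('a \<times> 'b, 'd \<times> 'e) chart set" where
  "prod_atlas A B = {(fst c \<times> fst d, map_prod (snd c) (snd d)) | c d. c \<in> A \<and> d \<in> B}"

text \<open>Tangent vectors at \<open>p\<close> are represented by their components in one chosen chart
  \<open>chart_at A p\<close> around \<open>p\<close>, so that every tangent space is the model space \<open>'d\<close>.
  \<open>to_chart A c p v\<close> are the components in the chart \<open>c\<close> of the tangent vector \<open>v\<close> at \<open>p\<close>, and
  \<open>from_chart A c p\<close> is the inverse of \<open>to_chart A c p\<close>.\<close>

definition chart_at :: "('a, 'd) chart set \<Rightarrow> 'a \<Rightarrow> ('a, 'd) chart" where
  "chart_at A p = (SOME c. c \<in> A \<and> p \<in> fst c)"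

definition to_chart ::
    "('a, 'd::euclidean_space) chart set \<Rightarrow> ('a, 'd) chart \<Rightarrow> 'a \<Rightarrow> 'd \<Rightarrow> 'd" where
  "to_chart A c p v =
     frechet_derivative (snd c \<circ> chart_inv (chart_at A p)) (at (snd (chart_at A p) p)) v"

definition from_chart ::
    "('a, 'd::euclidean_space) chart set \<Rightarrow> ('a, 'd) chart \<Rightarrow> 'a \<Rightarrow> 'd \<Rightarrow> 'd" where
  "from_chart A c p v = frechet_derivative (snd (chart_at A p) \<circ> chart_inv c) (at (snd c p)) v"

definition smooth_fun_on ::
    "('a, 'd::euclidean_space) chart set \<Rightarrow> 'a set \<Rightarrow> ('a \<Rightarrow> real) \<Rightarrow> bool" where
  "smooth_fun_on A U f \<longleftrightarrow> (\<forall>c\<in>A. smooth_on (snd c ` (U \<inter> fst c)) (f \<circ> chart_inv c))"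

definition smooth_field_on ::
    "('a, 'd::euclidean_space) chart set \<Rightarrow> 'a set \<Rightarrow> ('a \<Rightarrow> 'd) \<Rightarrow> bool" where
  "smooth_field_on A U X \<longleftrightarrow>
     (\<forall>c\<in>A. smooth_on (snd c ` (U \<inter> fst c)) (\<lambda>x. to_chart A c (chart_inv c x) (X (chart_inv c x))))"

definition smooth_map ::
    "('a::topological_space, 'd::euclidean_space) chart set \<Rightarrow>
     ('m::topological_space, 'e::euclidean_space) chart set \<Rightarrow> ('a \<Rightarrow> 'm) \<Rightarrow> bool" where
  "smooth_map A B F \<longleftrightarrow> continuous_on UNIV F \<and>
     (\<forall>c\<in>A. \<forall>d\<in>B. smooth_on (snd c ` (fst c \<inter> F -` fst d)) (snd d \<circ> F \<circ> chart_inv c))"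

definition tangent_map ::
    "('a, 'd::euclidean_space) chart set \<Rightarrow> ('m, 'e::euclidean_space) chart set \<Rightarrow>
     ('a \<Rightarrow> 'm) \<Rightarrow> 'a \<Rightarrow> 'd \<Rightarrow> 'e" where
  "tangent_map A B F p v =
     frechet_derivative (snd (chart_at B (F p)) \<circ> F \<circ> chart_inv (chart_at A p))
       (at (snd (chart_at A p) p)) v"

text \<open>\<open>v f\<close>, for a tangent vector \<open>v\<close> at \<open>p\<close>\<close>
definition dir_deriv ::
    "('a, 'd::euclidean_space) chart set \<Rightarrow> ('a \<Rightarrow> real) \<Rightarrow> 'a \<Rightarrow> 'd \<Rightarrow> real" where
  "dir_deriv A f p v = frechet_derivative (f \<circ> chart_inv (chart_at A p)) (at (snd (chart_at A p) p)) v"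

definition smooth_distribution ::
    "('a::topological_space, 'd::euclidean_space) chart set \<Rightarrow> ('a \<Rightarrow> 'd set) \<Rightarrow> bool" where
  "smooth_distribution A D \<longleftrightarrow>
     (\<exists>k. \<forall>p. dim (D p) = k \<and>
        (\<exists>U X. open U \<and> p \<in> U \<and> (\<forall>i<k. smooth_field_on A U (X i)) \<and>
           (\<forall>q\<in>U. D q = span ((\<lambda>i::nat. X i q) ` {..<k}))))"


section \<open>Inner products on a tangent space\<close>

definition inner_product :: "('d::euclidean_space \<Rightarrow> 'd \<Rightarrow> real) \<Rightarrow> bool" where
  "inner_product G \<longleftrightarrow> bilinear G \<and> (\<forall>u v. G u v = G v u) \<and> (\<forall>u. u \<noteq> 0 \<longrightarrow> G u u > 0)"

definition orth_proj :: "('d::euclidean_space \<Rightarrow> 'd \<Rightarrow> real) \<Rightarrow> 'd set \<Rightarrow> 'd \<Rightarrow> 'd" where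
  "orth_proj G S w = (THE s. s \<in> S \<and> (\<forall>t\<in>S. G (w - s) t = 0))"

definition orthonormal_basis :: "('d::euclidean_space \<Rightarrow> 'd \<Rightarrow> real) \<Rightarrow> 'd set \<Rightarrow> bool" where
  "orthonormal_basis G E \<longleftrightarrow> finite E \<and> span E = UNIV \<and>
     (\<forall>u\<in>E. \<forall>v\<in>E. G u v = (if u = v then 1 else 0))"

definition angle :: "('d::euclidean_space \<Rightarrow> 'd \<Rightarrow> real) \<Rightarrow> 'd \<Rightarrow> 'd \<Rightarrow> real" where
  "angle G u v = arccos (G u v / (sqrt (G u u) * sqrt (G v v)))"

text \<open>The angle between a vector and a subspace is the angle between the vector and its orthogonal
  projection. If the projection vanishes, then division by zero yields \<open>arccos 0 = pi / 2\<close>,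
  as it should be.\<close>
definition angle_subspace :: "('d::euclidean_space \<Rightarrow> 'd \<Rightarrow> real) \<Rightarrow> 'd \<Rightarrow> 'd set \<Rightarrow> real" where
  "angle_subspace G w S = angle G w (orth_proj G S w)"


section \<open>Riemannian metrics and the Levi-Civita connection\<close>

definition riemannian_metric ::
    "('a::topological_space, 'd::euclidean_space) chart set \<Rightarrow> ('a \<Rightarrow> 'd \<Rightarrow> 'd \<Rightarrow> real) \<Rightarrow> bool" where
  "riemannian_metric A g \<longleftrightarrow> (\<forall>p. inner_product (g p)) \<and>
     (\<forall>U X Y. open U \<and> smooth_field_on A U X \<and> smooth_field_on A U Y \<longrightarrow>
        smooth_fun_on A U (\<lambda>p. g p (X p) (Y p)))"

definition metric_in_chart ::
    "('a, 'd::euclidean_space) chart set \<Rightarrow> ('a \<Rightarrow> 'd \<Rightarrow> 'd \<Rightarrow> real) \<Rightarrow> ('a, 'd) chart \<Rightarrow>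
     'd \<Rightarrow> 'd \<Rightarrow> 'd \<Rightarrow> real" where
  "metric_in_chart A g c x u v =
     (let q = chart_inv c x in g q (from_chart A c q u) (from_chart A c q v))"

text \<open>The Christoffel symbols of the Levi-Civita connection at \<open>p\<close> in the chart \<open>chart_at A p\<close>,
  as a bilinear map: \<open>\<Gamma> u v\<close> is the derivative at \<open>p\<close>, in direction \<open>u\<close>, of the coordinate vector
  field with constant components \<open>v\<close>. Symmetry is the vanishing of the torsion, and the last
  condition is the compatibility with the metric; they determine \<open>\<Gamma>\<close> uniquely.\<close>
definition christoffel ::
    "('a, 'd::euclidean_space) chart set \<Rightarrow> ('a \<Rightarrow> 'd \<Rightarrow> 'd \<Rightarrow> real) \<Rightarrow> 'a \<Rightarrow> 'd \<Rightarrow> 'd \<Rightarrow> 'd" where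
  "christoffel A g p =
     (THE \<Gamma>. bilinear \<Gamma> \<and> (\<forall>u v. \<Gamma> u v = \<Gamma> v u) \<and>
        (\<forall>u v w. frechet_derivative (\<lambda>x. metric_in_chart A g (chart_at A p) x v w)
                   (at (snd (chart_at A p) p)) u
                 = g p (\<Gamma> u v) w + g p v (\<Gamma> u w)))"

text \<open>Covariant derivative, with respect to the Levi-Civita connection of \<open>(B, g)\<close>, of a vector
  field \<open>V\<close> along \<open>F\<close> (so \<open>V q\<close> is tangent at \<open>F q\<close>) in the direction of a tangent vector \<open>u\<close>
  at \<open>p\<close>.\<close>
definition cov_deriv_along ::
    "('a, 'd::euclidean_space) chart set \<Rightarrow> ('m, 'e::euclidean_space) chart set \<Rightarrow>
     ('m \<Rightarrow> 'e \<Rightarrow> 'e \<Rightarrow> real) \<Rightarrow> ('a \<Rightarrow> 'm) \<Rightarrow> ('a \<Rightarrow> 'e) \<Rightarrow> 'a \<Rightarrow> 'd \<Rightarrow> 'e" where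
  "cov_deriv_along A B g F V p u =
     frechet_derivative
       (\<lambda>x. let q = chart_inv (chart_at A p) x in to_chart B (chart_at B (F p)) (F q) (V q))
       (at (snd (chart_at A p) p)) u
     + christoffel B g (F p) (tangent_map A B F p u) (V p)"

definition cov_deriv ::
    "('m, 'e::euclidean_space) chart set \<Rightarrow> ('m \<Rightarrow> 'e \<Rightarrow> 'e \<Rightarrow> real) \<Rightarrow> ('m \<Rightarrow> 'e) \<Rightarrow> 'm \<Rightarrow> 'e \<Rightarrow> 'e" where
  "cov_deriv B g Y p u = cov_deriv_along B B g (\<lambda>q. q) Y p u"

definition gradient ::
    "('a, 'd::euclidean_space) chart set \<Rightarrow> ('a \<Rightarrow> 'd \<Rightarrow> 'd \<Rightarrow> real) \<Rightarrow> ('a \<Rightarrow> real) \<Rightarrow> 'a \<Rightarrow> 'd" where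
  "gradient A g f p = (THE v. \<forall>u. g p v u = dir_deriv A f p u)"


section \<open>Kenmotsu manifolds\<close>

definition kenmotsu_manifold ::
    "('m::{t2_space,second_countable_topology}, 'e::euclidean_space) chart set \<Rightarrow>
     ('m \<Rightarrow> 'e \<Rightarrow> 'e) \<Rightarrow> ('m \<Rightarrow> 'e) \<Rightarrow> ('m \<Rightarrow> 'e \<Rightarrow> real) \<Rightarrow> ('m \<Rightarrow> 'e \<Rightarrow> 'e \<Rightarrow> real) \<Rightarrow> bool" where
  "kenmotsu_manifold B \<phi> \<xi> \<eta> g \<longleftrightarrow>
     smooth_atlas B \<and> odd (DIM('e)) \<and> riemannian_metric B g \<and>
     (\<forall>p. linear (\<phi> p)) \<and>
     (\<forall>U X. open U \<and> smooth_field_on B U X \<longrightarrow> smooth_field_on B U (\<lambda>p. \<phi> p (X p))) \<and>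
     smooth_field_on B UNIV \<xi> \<and>
     (\<forall>p. linear (\<eta> p)) \<and>
     (\<forall>U X. open U \<and> smooth_field_on B U X \<longrightarrow> smooth_fun_on B U (\<lambda>p. \<eta> p (X p))) \<and>
     (\<forall>p. \<phi> p (\<xi> p) = 0) \<and>
     (\<forall>p X. \<eta> p (\<phi> p X) = 0) \<and>
     (\<forall>p X. \<phi> p (\<phi> p X) = - X + \<eta> p X *\<^sub>R \<xi> p) \<and>
     (\<forall>p X. \<eta> p X = g p X (\<xi> p)) \<and>
     (\<forall>p. \<eta> p (\<xi> p) = 1) \<and>
     (\<forall>p X Y. g p (\<phi> p X) (\<phi> p Y) = g p X Y - \<eta> p X * \<eta> p Y) \<and>
     (\<forall>p X. cov_deriv B g \<xi> p X = X - \<eta> p X *\<^sub>R \<xi> p) \<and>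
     (\<forall>U Y. open U \<and> smooth_field_on B U Y \<longrightarrow>
        (\<forall>p\<in>U. \<forall>X. cov_deriv B g (\<lambda>q. \<phi> q (Y q)) p X - \<phi> p (cov_deriv B g Y p X)
                    = g p (\<phi> p X) (Y p) *\<^sub>R \<xi> p - \<eta> p (Y p) *\<^sub>R \<phi> p X))"


section \<open>Submanifolds\<close>

text \<open>A submanifold is given by an immersion \<open>F\<close> from a manifold with atlas \<open>A\<close> into the
  manifold with atlas \<open>B\<close> and metric \<open>g\<close>; a tangent vector \<open>u\<close> of the submanifold at \<open>p\<close> is
  identified with the vector \<open>tangent_map A B F p u\<close> at \<open>F p\<close>. The points of \<open>S\<close> in the
  predicates \<open>_on A B g F S\<close> below are points of the submanifold; \<open>S = UNIV\<close> is the global notion.\<close>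

definition immersion ::
    "('a::topological_space, 'd::euclidean_space) chart set \<Rightarrow>
     ('m::topological_space, 'e::euclidean_space) chart set \<Rightarrow> ('a \<Rightarrow> 'm) \<Rightarrow> bool" where
  "immersion A B F \<longleftrightarrow> smooth_map A B F \<and> (\<forall>p. inj (tangent_map A B F p))"

definition induced_metric ::
    "('a, 'd::euclidean_space) chart set \<Rightarrow> ('m, 'e::euclidean_space) chart set \<Rightarrow>
     ('m \<Rightarrow> 'e \<Rightarrow> 'e \<Rightarrow> real) \<Rightarrow> ('a \<Rightarrow> 'm) \<Rightarrow> 'a \<Rightarrow> 'd \<Rightarrow> 'd \<Rightarrow> real" where
  "induced_metric A B g F p u v = g (F p) (tangent_map A B F p u) (tangent_map A B F p v)"

text \<open>The tangential part is a vector of the tangent space of the submanifold, the normal part a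
  vector of the tangent space of the ambient manifold.\<close>

definition tangential_part ::
    "('a, 'd::euclidean_space) chart set \<Rightarrow> ('m, 'e::euclidean_space) chart set \<Rightarrow>
     ('m \<Rightarrow> 'e \<Rightarrow> 'e \<Rightarrow> real) \<Rightarrow> ('a \<Rightarrow> 'm) \<Rightarrow> 'a \<Rightarrow> 'e \<Rightarrow> 'd" where
  "tangential_part A B g F p w =
     (THE u. \<forall>v. g (F p) (w - tangent_map A B F p u) (tangent_map A B F p v) = 0)"

definition normal_part ::
    "('a, 'd::euclidean_space) chart set \<Rightarrow> ('m, 'e::euclidean_space) chart set \<Rightarrow>
     ('m \<Rightarrow> 'e \<Rightarrow> 'e \<Rightarrow> real) \<Rightarrow> ('a \<Rightarrow> 'm) \<Rightarrow> 'a \<Rightarrow> 'e \<Rightarrow> 'e" where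
  "normal_part A B g F p w = w - tangent_map A B F p (tangential_part A B g F p w)"

text \<open>Gauss formula: \<open>h(u, v)\<close> is the normal part of the ambient covariant derivative, in direction
  \<open>u\<close>, of a tangent vector field extending \<open>v\<close>. As \<open>h\<close> is a tensor, the choice of the extension is
  irrelevant; we take the one with constant components in the chart \<open>chart_at A p\<close>.\<close>
definition second_ff ::
    "('a, 'd::euclidean_space) chart set \<Rightarrow> ('m, 'e::euclidean_space) chart set \<Rightarrow>
     ('m \<Rightarrow> 'e \<Rightarrow> 'e \<Rightarrow> real) \<Rightarrow> ('a \<Rightarrow> 'm) \<Rightarrow> 'a \<Rightarrow> 'd \<Rightarrow> 'd \<Rightarrow> 'e" where
  "second_ff A B g F p u v =
     normal_part A B g F p
       (cov_deriv_along A B g F (\<lambda>q. tangent_map A B F q (from_chart A (chart_at A p) q v)) p u)"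

text \<open>The value does not depend on the choice of the orthonormal basis; likewise for the mean
  curvature vector.\<close>
definition second_ff_norm_sq ::
    "('a, 'd::euclidean_space) chart set \<Rightarrow> ('m, 'e::euclidean_space) chart set \<Rightarrow>
     ('m \<Rightarrow> 'e \<Rightarrow> 'e \<Rightarrow> real) \<Rightarrow> ('a \<Rightarrow> 'm) \<Rightarrow> 'a \<Rightarrow> real" where
  "second_ff_norm_sq A B g F p =
     (let E = (SOME E. orthonormal_basis (induced_metric A B g F p) E)
      in \<Sum>u\<in>E. \<Sum>v\<in>E. g (F p) (second_ff A B g F p u v) (second_ff A B g F p u v))"

definition mean_curvature ::
    "('a, 'd::euclidean_space) chart set \<Rightarrow> ('m, 'e::euclidean_space) chart set \<Rightarrow>
     ('m \<Rightarrow> 'e \<Rightarrow> 'e \<Rightarrow> real) \<Rightarrow> ('a \<Rightarrow> 'm) \<Rightarrow> 'a \<Rightarrow> 'e" where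
  "mean_curvature A B g F p =
     (let E = (SOME E. orthonormal_basis (induced_metric A B g F p) E)
      in (1 / real (DIM('d))) *\<^sub>R (\<Sum>u\<in>E. second_ff A B g F p u u))"

definition totally_geodesic_on ::
    "('a, 'd::euclidean_space) chart set \<Rightarrow> ('m, 'e::euclidean_space) chart set \<Rightarrow>
     ('m \<Rightarrow> 'e \<Rightarrow> 'e \<Rightarrow> real) \<Rightarrow> ('a \<Rightarrow> 'm) \<Rightarrow> 'a set \<Rightarrow> bool" where
  "totally_geodesic_on A B g F S \<longleftrightarrow> (\<forall>p\<in>S. \<forall>u v. second_ff A B g F p u v = 0)"

definition totally_umbilical_on ::
    "('a, 'd::euclidean_space) chart set \<Rightarrow> ('m, 'e::euclidean_space) chart set \<Rightarrow>
     ('m \<Rightarrow> 'e \<Rightarrow> 'e \<Rightarrow> real) \<Rightarrow> ('a \<Rightarrow> 'm) \<Rightarrow> 'a set \<Rightarrow> bool" where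
  "totally_umbilical_on A B g F S \<longleftrightarrow>
     (\<forall>p\<in>S. \<forall>u v. second_ff A B g F p u v
                   = induced_metric A B g F p u v *\<^sub>R mean_curvature A B g F p)"


section \<open>Pointwise bi-slant submanifolds\<close>

text \<open>The tangential component \<open>P\<close> of \<open>\<phi>\<close>, and \<open>P\<^sub>i = T\<^sub>i \<circ> P\<close>, where \<open>T\<^sub>i\<close> is the orthogonal
  projection onto the distribution \<open>D\<close>.\<close>

definition tan_phi ::
    "('a, 'd::euclidean_space) chart set \<Rightarrow> ('m, 'e::euclidean_space) chart set \<Rightarrow>
     ('m \<Rightarrow> 'e \<Rightarrow> 'e) \<Rightarrow> ('m \<Rightarrow> 'e \<Rightarrow> 'e \<Rightarrow> real) \<Rightarrow> ('a \<Rightarrow> 'm) \<Rightarrow> 'a \<Rightarrow> 'd \<Rightarrow> 'd" where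
  "tan_phi A B \<phi> g F p X = tangential_part A B g F p (\<phi> (F p) (tangent_map A B F p X))"

definition tan_phi_proj ::
    "('a, 'd::euclidean_space) chart set \<Rightarrow> ('m, 'e::euclidean_space) chart set \<Rightarrow>
     ('m \<Rightarrow> 'e \<Rightarrow> 'e) \<Rightarrow> ('m \<Rightarrow> 'e \<Rightarrow> 'e \<Rightarrow> real) \<Rightarrow> ('a \<Rightarrow> 'm) \<Rightarrow> ('a \<Rightarrow> 'd set) \<Rightarrow> 'a \<Rightarrow> 'd \<Rightarrow> 'd" where
  "tan_phi_proj A B \<phi> g F D p X = orth_proj (induced_metric A B g F p) (D p) (tan_phi A B \<phi> g F p X)"

text \<open>The structure vector field, as a vector field of a submanifold tangent to it\<close>
definition tan_xi ::
    "('a, 'd::euclidean_space) chart set \<Rightarrow> ('m, 'e::euclidean_space) chart set \<Rightarrow>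
     ('m \<Rightarrow> 'e) \<Rightarrow> ('m \<Rightarrow> 'e \<Rightarrow> 'e \<Rightarrow> real) \<Rightarrow> ('a \<Rightarrow> 'm) \<Rightarrow> 'a \<Rightarrow> 'd" where
  "tan_xi A B \<xi> g F p = tangential_part A B g F p (\<xi> (F p))"

definition pointwise_slant ::
    "('a, 'd::euclidean_space) chart set \<Rightarrow> ('m, 'e::euclidean_space) chart set \<Rightarrow>
     ('m \<Rightarrow> 'e \<Rightarrow> 'e) \<Rightarrow> ('m \<Rightarrow> 'e \<Rightarrow> 'e \<Rightarrow> real) \<Rightarrow> ('a \<Rightarrow> 'm) \<Rightarrow>
     ('a \<Rightarrow> 'd set) \<Rightarrow> ('a \<Rightarrow> real) \<Rightarrow> bool" where
  "pointwise_slant A B \<phi> g F D \<theta> \<longleftrightarrow>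
     (\<forall>p. \<theta> p \<in> {0..pi/2} \<and>
        (\<forall>X\<in>D p. X \<noteq> 0 \<longrightarrow>
           angle_subspace (g (F p)) (\<phi> (F p) (tangent_map A B F p X)) (tangent_map A B F p ` D p) = \<theta> p))"

definition pointwise_bi_slant ::
    "('a::topological_space, 'd::euclidean_space) chart set \<Rightarrow>
     ('m::topological_space, 'e::euclidean_space) chart set \<Rightarrow>
     ('m \<Rightarrow> 'e \<Rightarrow> 'e) \<Rightarrow> ('m \<Rightarrow> 'e) \<Rightarrow> ('m \<Rightarrow> 'e \<Rightarrow> 'e \<Rightarrow> real) \<Rightarrow> ('a \<Rightarrow> 'm) \<Rightarrow>
     ('a \<Rightarrow> 'd set) \<Rightarrow> ('a \<Rightarrow> 'd set) \<Rightarrow> ('a \<Rightarrow> real) \<Rightarrow> ('a \<Rightarrow> real) \<Rightarrow> bool" where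
  "pointwise_bi_slant A B \<phi> \<xi> g F D1 D2 \<theta>1 \<theta>2 \<longleftrightarrow>
     immersion A B F \<and>
     (\<forall>p. \<xi> (F p) \<in> range (tangent_map A B F p)) \<and>
     smooth_distribution A D1 \<and> smooth_distribution A D2 \<and>
     (\<forall>p v. \<exists>X\<in>D1 p. \<exists>Y\<in>D2 p. \<exists>t. v = X + Y + t *\<^sub>R tan_xi A B \<xi> g F p) \<and>
     (\<forall>p. \<forall>X\<in>D1 p. \<forall>Y\<in>D2 p.
        induced_metric A B g F p X Y = 0 \<and>
        induced_metric A B g F p X (tan_xi A B \<xi> g F p) = 0 \<and>
        induced_metric A B g F p Y (tan_xi A B \<xi> g F p) = 0) \<and>
     (\<forall>p. \<forall>X\<in>D1 p. \<forall>Y\<in>D2 p. \<forall>t.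
        g (F p) (\<phi> (F p) (tangent_map A B F p X))
                (tangent_map A B F p (Y + t *\<^sub>R tan_xi A B \<xi> g F p)) = 0) \<and>
     pointwise_slant A B \<phi> g F D1 \<theta>1 \<and>
     pointwise_slant A B \<phi> g F D2 \<theta>2"

definition proper_bi_slant :: "('a \<Rightarrow> real) \<Rightarrow> ('a \<Rightarrow> real) \<Rightarrow> bool" where
  "proper_bi_slant \<theta>1 \<theta>2 \<longleftrightarrow>
     (\<forall>p. \<theta>1 p \<noteq> 0 \<and> \<theta>1 p \<noteq> pi/2 \<and> \<theta>2 p \<noteq> 0 \<and> \<theta>2 p \<noteq> pi/2) \<and>
     \<not> \<theta>1 constant_on UNIV \<and> \<not> \<theta>2 constant_on UNIV"


section \<open>Warped products\<close>

definition warped_metric ::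
    "('a, 'd1::euclidean_space) chart set \<Rightarrow> ('b, 'd2::euclidean_space) chart set \<Rightarrow>
     ('a \<Rightarrow> 'd1 \<Rightarrow> 'd1 \<Rightarrow> real) \<Rightarrow> ('b \<Rightarrow> 'd2 \<Rightarrow> 'd2 \<Rightarrow> real) \<Rightarrow> ('a \<Rightarrow> real) \<Rightarrow>
     'a \<times> 'b \<Rightarrow> 'd1 \<times> 'd2 \<Rightarrow> 'd1 \<times> 'd2 \<Rightarrow> real" where
  "warped_metric A1 A2 g1 g2 f p u v =
     g1 (fst p) (tangent_map (prod_atlas A1 A2) A1 fst p u) (tangent_map (prod_atlas A1 A2) A1 fst p v)
     + (f (fst p))\<^sup>2 *
       g2 (snd p) (tangent_map (prod_atlas A1 A2) A2 snd p u) (tangent_map (prod_atlas A1 A2) A2 snd p v)"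

text \<open>The subbundles \<open>TM\<^sub>1\<close> and \<open>TM\<^sub>2\<close> of the tangent bundle of the product: the tangent spaces of
  the slices through a point\<close>

definition factor1 ::
    "('a, 'd1::euclidean_space) chart set \<Rightarrow> ('b, 'd2::euclidean_space) chart set \<Rightarrow>
     'a \<times> 'b \<Rightarrow> ('d1 \<times> 'd2) set" where
  "factor1 A1 A2 p = range (tangent_map A1 (prod_atlas A1 A2) (\<lambda>a. (a, snd p)) (fst p))"

definition factor2 ::
    "('a, 'd1::euclidean_space) chart set \<Rightarrow> ('b, 'd2::euclidean_space) chart set \<Rightarrow>
     'a \<times> 'b \<Rightarrow> ('d1 \<times> 'd2) set" where
  "factor2 A1 A2 p = range (tangent_map A2 (prod_atlas A1 A2) (\<lambda>b. (fst p, b)) (snd p))"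

definition warped_product_bi_slant ::
    "('a::{t2_space,second_countable_topology}, 'd1::euclidean_space) chart set \<Rightarrow>
     ('b::{t2_space,second_countable_topology}, 'd2::euclidean_space) chart set \<Rightarrow>
     ('m::{t2_space,second_countable_topology}, 'e::euclidean_space) chart set \<Rightarrow>
     ('m \<Rightarrow> 'e \<Rightarrow> 'e) \<Rightarrow> ('m \<Rightarrow> 'e) \<Rightarrow> ('m \<Rightarrow> 'e \<Rightarrow> 'e \<Rightarrow> real) \<Rightarrow> ('a \<times> 'b \<Rightarrow> 'm) \<Rightarrow>
     ('a \<Rightarrow> 'd1 \<Rightarrow> 'd1 \<Rightarrow> real) \<Rightarrow> ('b \<Rightarrow> 'd2 \<Rightarrow> 'd2 \<Rightarrow> real) \<Rightarrow> ('a \<Rightarrow> real) \<Rightarrow>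
     ('a \<times> 'b \<Rightarrow> ('d1 \<times> 'd2) set) \<Rightarrow> ('a \<times> 'b \<Rightarrow> ('d1 \<times> 'd2) set) \<Rightarrow>
     ('a \<times> 'b \<Rightarrow> real) \<Rightarrow> ('a \<times> 'b \<Rightarrow> real) \<Rightarrow> bool" where
  "warped_product_bi_slant A1 A2 B \<phi> \<xi> g F g1 g2 f D1 D2 \<theta>1 \<theta>2 \<longleftrightarrow>
     smooth_atlas A1 \<and> riemannian_metric A1 g1 \<and>
     smooth_atlas A2 \<and> riemannian_metric A2 g2 \<and>
     smooth_fun_on A1 UNIV f \<and> (\<forall>a. f a > 0) \<and>
     pointwise_bi_slant (prod_atlas A1 A2) B \<phi> \<xi> g F D1 D2 \<theta>1 \<theta>2 \<and>
     induced_metric (prod_atlas A1 A2) B g F = warped_metric A1 A2 g1 g2 f \<and>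
     (\<forall>p. factor1 A1 A2 p = {X + t *\<^sub>R tan_xi (prod_atlas A1 A2) B \<xi> g F p | X t. X \<in> D1 p}) \<and>
     (\<forall>p. factor2 A1 A2 p = D2 p)"

definition mixed_totally_geodesic ::
    "('a, 'd1::euclidean_space) chart set \<Rightarrow> ('b, 'd2::euclidean_space) chart set \<Rightarrow>
     ('m, 'e::euclidean_space) chart set \<Rightarrow> ('m \<Rightarrow> 'e \<Rightarrow> 'e \<Rightarrow> real) \<Rightarrow> ('a \<times> 'b \<Rightarrow> 'm) \<Rightarrow> bool" where
  "mixed_totally_geodesic A1 A2 B g F \<longleftrightarrow>
     (\<forall>p. \<forall>X\<in>factor1 A1 A2 p. \<forall>Z\<in>factor2 A1 A2 p. second_ff (prod_atlas A1 A2) B g F p X Z = 0)"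

text \<open>\<open>e 1, \<dots>, e (2 * p + 1)\<close> is an orthonormal frame over the open set \<open>U\<close> of the subbundle \<open>TM\<^sub>1\<close>,
  with \<open>e (p + i) = sec \<theta>1 P\<^sub>1 (e i)\<close> for \<open>1 \<le> i \<le> p\<close> and \<open>e (2 * p + 1) = \<xi>\<close>.\<close>
definition adapted_frame ::
    "('a::topological_space, 'd1::euclidean_space) chart set \<Rightarrow>
     ('b::topological_space, 'd2::euclidean_space) chart set \<Rightarrow>
     ('m, 'e::euclidean_space) chart set \<Rightarrow>
     ('m \<Rightarrow> 'e \<Rightarrow> 'e) \<Rightarrow> ('m \<Rightarrow> 'e) \<Rightarrow> ('m \<Rightarrow> 'e \<Rightarrow> 'e \<Rightarrow> real) \<Rightarrow> ('a \<times> 'b \<Rightarrow> 'm) \<Rightarrow>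
     ('a \<times> 'b \<Rightarrow> ('d1 \<times> 'd2) set) \<Rightarrow> ('a \<times> 'b \<Rightarrow> real) \<Rightarrow>
     nat \<Rightarrow> ('a \<times> 'b) set \<Rightarrow> (nat \<Rightarrow> 'a \<times> 'b \<Rightarrow> 'd1 \<times> 'd2) \<Rightarrow> bool" where
  "adapted_frame A1 A2 B \<phi> \<xi> g F D1 \<theta>1 p U e \<longleftrightarrow>
     open U \<and>
     (\<forall>i\<in>{1..2*p+1}. smooth_field_on (prod_atlas A1 A2) U (e i)) \<and>
     (\<forall>x\<in>U.
        span ((\<lambda>i. e i x) ` {1..2*p+1}) = factor1 A1 A2 x \<and>
        (\<forall>i\<in>{1..2*p+1}. \<forall>j\<in>{1..2*p+1}.
           induced_metric (prod_atlas A1 A2) B g F x (e i x) (e j x) = (if i = j then 1 else 0)) \<and>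
        (\<forall>i\<in>{1..p}. e (p + i) x =
           (1 / cos (\<theta>1 x)) *\<^sub>R tan_phi_proj (prod_atlas A1 A2) B \<phi> g F D1 x (e i x)) \<and>
        e (2*p+1) x = tan_xi (prod_atlas A1 A2) B \<xi> g F x)"

end

theory Submission
  imports Defs
begin

text \<open>
  Write \<open>\<omega>(X, Y) = g(\<phi> X, Y)\<close>. On the submanifold \<open>\<omega>\<close> vanishes on \<open>TM\<^sub>1 \<times> TM\<^sub>2\<close>. Differentiate
  \<open>\<omega>(X, Z) = 0\<close> in a direction \<open>W\<close>, where \<open>X\<close> is a coordinate field of \<open>M\<^sub>1\<close> and \<open>Z\<close>, \<open>W\<close> are
  coordinate fields of \<open>M\<^sub>2\<close>: as \<open>h(X, W) = 0\<close>, the ambient derivative of \<open>X\<close> along \<open>W\<close> is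
  \<open>(X ln f) W\<close>, and the formula for the covariant derivative of \<open>\<phi>\<close> gives
  \<open>(X ln f - \<eta>(X)) \<omega>(W, Z) = - \<omega>(X, D\<^sub>W Z)\<close> with the ambient connection \<open>D\<close>.
  The left-hand side is skew and the right-hand side symmetric in \<open>W\<close>, \<open>Z\<close>, so both vanish; since
  \<open>\<theta>\<^sub>2 \<noteq> \<pi>/2\<close>, the form \<open>\<omega>\<close> is not zero on \<open>TM\<^sub>2\<close>, whence \<open>d ln f = \<eta>\<close> on \<open>TM\<^sub>1\<close>.

  So the gradient of \<open>ln f\<close> is \<open>\<xi>\<close>, the lower bound is \<open>0\<close> for every adapted frame, and equality
  means \<open>h = 0\<close> at the point. Then the second fundamental forms of the two leaves in the ambient
  manifold are their second fundamental forms in the warped product: \<open>0\<close> for \<open>M\<^sub>1\<close>, and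
  \<open>- g(Z, W) \<xi>\<close> for \<open>M\<^sub>2\<close>.
\<close>

section \<open>Smooth maps between Euclidean spaces\<close>

text \<open>The calculation is done entirely with coordinate fields of one chart; no calculus of
  general vector fields and no induced connection is set up. \<open>ambient_hessian\<close> is the
  ambient covariant derivative of such fields. They commute, so its symmetry, on which the
  skew-versus-symmetric comparison rests, is Schwarz's theorem plus the symmetry of the Christoffel
  symbols. Its tangential part follows from the Koszul formula for the induced metric, so
  differentiating the warped metric coefficients already yields the connection formulas of a warped
  product. The obstacle is that tangent vectors and \<open>second_ff\<close> are tied to an
  arbitrarily chosen chart \<open>chart_at\<close>, and the chosen chart at a point of the product
  need not be the product of the charts chosen on the factors. Hence h must be computable in every
  chart: a change of chart alters \<open>ambient_hessian\<close> only by a tangent vector, which the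
  normal part kills. In the bound, the constant 1 is the squared length of \<xi>, and the sum over r
  vanishes because those frame vectors are orthogonal to \<xi>.\<close>

lemma frechet_derivative_eqI:
  "(f has_derivative f') (at x) \<Longrightarrow> frechet_derivative f (at x) v = f' v"
  by (metis frechet_derivative_at)

lemma has_derivative_frechet:
  "f differentiable (at x) \<Longrightarrow> (f has_derivative (\<lambda>v. frechet_derivative f (at x) v)) (at x)"
  using frechet_derivative_works by force

lemma frechet_derivative_cong_open:
  assumes "open S" "x \<in> S" "\<And>y. y \<in> S \<Longrightarrow> f y = g y"
  shows "frechet_derivative f (at x) = frechet_derivative g (at x)"
proof -
  have "(f has_derivative f') (at x) \<longleftrightarrow> (g has_derivative f') (at x)" for f'
    using assms has_derivative_transform_within_open[of _ f' x UNIV S] by metis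
  then show ?thesis by (simp add: frechet_derivative_def)
qed

lemma frechet_derivative_chain:
  assumes "g differentiable (at x)" "f differentiable (at (g x))"
  shows "frechet_derivative (\<lambda>x. f (g x)) (at x) v
    = frechet_derivative f (at (g x)) (frechet_derivative g (at x) v)"
  using frechet_derivative_compose[OF assms] by (simp add: o_def)

lemma Ck_on_cong:
  assumes "open S" "\<And>x. x \<in> S \<Longrightarrow> f x = g x" "Ck_on k f S"
  shows "Ck_on k g S"
  using assms(2,3)
proof (induction k arbitrary: f g)
  case 0
  then show ?case by (simp cong: continuous_on_cong)
next
  case (Suc k)
  have "g differentiable (at x)" if "x \<in> S" for x
    using Suc.prems that assms(1) has_derivative_transform_within_open[of f _ x UNIV S g]
    unfolding differentiable_def Ck_on.simps by metis
  moreover have "Ck_on k (\<lambda>x. frechet_derivative g (at x) v) S" for v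
  proof (rule Suc.IH[of "\<lambda>x. frechet_derivative f (at x) v"])
    show "frechet_derivative f (at x) v = frechet_derivative g (at x) v" if "x \<in> S" for x
      by (rule fun_cong[OF frechet_derivative_cong_open[OF assms(1) that Suc.prems(1)]])
    show "Ck_on k (\<lambda>x. frechet_derivative f (at x) v) S" using Suc.prems(2) by simp
  qed
  ultimately show ?case by simp
qed

lemma Ck_on_subset: "Ck_on k f S \<Longrightarrow> T \<subseteq> S \<Longrightarrow> Ck_on k f T"
  by (induction k arbitrary: f) (auto intro: continuous_on_subset)

lemma Ck_on_imp_continuous: "Ck_on k f S \<Longrightarrow> continuous_on S f"
  by (cases k) (auto intro!: continuous_at_imp_continuous_on differentiable_imp_continuous_within)

lemma Ck_on_SucD: "Ck_on (Suc k) f S \<Longrightarrow> Ck_on k f S"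
  by (induction k arbitrary: f)
    (auto intro!: continuous_at_imp_continuous_on differentiable_imp_continuous_within)

lemma Ck_on_const: "Ck_on k (\<lambda>x. c) S"
  by (induction k arbitrary: c) auto

lemma Ck_on_linear:
  assumes "open S" "linear L" "Ck_on k f S"
  shows "Ck_on k (\<lambda>x. L (f x)) S"
  using assms(3)
proof (induction k arbitrary: f)
  case 0
  then show ?case
    using assms(2) by (auto intro: linear_continuous_on_compose)
next
  case (Suc k)
  have L: "bounded_linear L" using assms(2) by (simp add: linear_conv_bounded_linear)
  have D: "((\<lambda>x. L (f x)) has_derivative (\<lambda>v. L (frechet_derivative f (at x) v))) (at x)"
    if "x \<in> S" for x
    using Suc.prems that bounded_linear.has_derivative[OF L] has_derivative_frechet by force
  have "Ck_on k (\<lambda>x. frechet_derivative (\<lambda>x. L (f x)) (at x) v) S" for v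
    by (rule Ck_on_cong[OF assms(1) _ Suc.IH]) (use Suc.prems in \<open>auto simp: frechet_derivative_eqI[OF D]\<close>)
  then show ?case using D by (auto simp: differentiable_def)
qed

lemma Ck_on_add:
  assumes "open S" "Ck_on k f S" "Ck_on k g S"
  shows "Ck_on k (\<lambda>x. f x + g x) S"
  using assms(2,3)
proof (induction k arbitrary: f g)
  case 0
  then show ?case by (auto intro: continuous_on_add)
next
  case (Suc k)
  have D: "((\<lambda>x. f x + g x) has_derivative
      (\<lambda>v. frechet_derivative f (at x) v + frechet_derivative g (at x) v)) (at x)" if "x \<in> S" for x
    using Suc.prems that by (intro has_derivative_add has_derivative_frechet) auto
  have "Ck_on k (\<lambda>x. frechet_derivative (\<lambda>x. f x + g x) (at x) v) S" for v
    by (rule Ck_on_cong[OF assms(1) _ Suc.IH]) (use Suc.prems in \<open>auto simp: frechet_derivative_eqI[OF D]\<close>)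
  then show ?case using D by (auto simp: differentiable_def)
qed

lemma Ck_on_sum:
  assumes "open S" "finite I" "\<And>i. i \<in> I \<Longrightarrow> Ck_on k (f i) S"
  shows "Ck_on k (\<lambda>x. \<Sum>i\<in>I. f i x) S"
  using assms(2,3)
proof (induction I rule: finite_induct)
  case empty
  then show ?case by (simp add: Ck_on_const)
next
  case (insert i I)
  then show ?case by (simp add: Ck_on_add[OF assms(1)])
qed

lemma Ck_on_scaleR:
  fixes c :: "'d::euclidean_space \<Rightarrow> real" and f :: "'d \<Rightarrow> 'e::euclidean_space"
  assumes "open S" "Ck_on k c S" "Ck_on k f S"
  shows "Ck_on k (\<lambda>x. c x *\<^sub>R f x) S"
  using assms(2,3)
proof (induction k arbitrary: c f)
  case 0
  then show ?case by (auto intro: continuous_on_scaleR)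
next
  case (Suc k)
  have D: "((\<lambda>x. c x *\<^sub>R f x) has_derivative
      (\<lambda>v. c x *\<^sub>R frechet_derivative f (at x) v + frechet_derivative c (at x) v *\<^sub>R f x)) (at x)"
    if "x \<in> S" for x
    using Suc.prems that by (intro has_derivative_scaleR has_derivative_frechet) auto
  have "Ck_on k (\<lambda>x. frechet_derivative (\<lambda>x. c x *\<^sub>R f x) (at x) v) S" for v
    by (rule Ck_on_cong[OF assms(1) _ Ck_on_add[OF assms(1)
            Suc.IH[of c "\<lambda>x. frechet_derivative f (at x) v"]
            Suc.IH[of "\<lambda>x. frechet_derivative c (at x) v" f]]])
      (use Suc.prems Suc.prems[THEN Ck_on_SucD] in \<open>auto simp: frechet_derivative_eqI[OF D]\<close>)
  then show ?case using D by (auto simp: differentiable_def)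
qed

lemma linear_basis_expansion:
  fixes L :: "'d::euclidean_space \<Rightarrow> 'e::real_vector"
  assumes "linear L"
  shows "L u = (\<Sum>b\<in>Basis. (u \<bullet> b) *\<^sub>R L b)"
proof -
  have "L u = L (\<Sum>b\<in>Basis. (u \<bullet> b) *\<^sub>R b)" by (simp add: euclidean_representation)
  then show ?thesis by (simp add: linear_sum[OF assms] linear_cmul[OF assms])
qed

text \<open>By the chain rule the derivative of \<open>f\<close> is applied to a moving direction.
  Expanding that direction in \<open>Basis\<close> leaves a finite sum of products in which
  \<open>f\<close> is differentiated in fixed directions only, so the induction hypothesis
  applies.\<close>

lemma Ck_on_compose:
  fixes g :: "'c::euclidean_space \<Rightarrow> 'd::euclidean_space" and f :: "'d \<Rightarrow> 'e::euclidean_space"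
  assumes "open S" "open T" "\<And>x. x \<in> T \<Longrightarrow> g x \<in> S" "Ck_on k f S" "Ck_on k g T"
  shows "Ck_on k (\<lambda>x. f (g x)) T"
  using assms(4,5)
proof (induction k arbitrary: f)
  case 0
  then show ?case
    using assms(3) by (auto intro: continuous_on_compose2)
next
  case (Suc k)
  have df: "f differentiable (at (g x))" and dg: "g differentiable (at x)" if "x \<in> T" for x
    using Suc.prems that assms(3) by auto
  have "Ck_on k (\<lambda>x. frechet_derivative (\<lambda>x. f (g x)) (at x) v) T" for v
  proof (rule Ck_on_cong[OF assms(2)])
    fix x assume x: "x \<in> T"
    show "(\<Sum>b\<in>Basis. (frechet_derivative g (at x) v \<bullet> b) *\<^sub>R frechet_derivative f (at (g x)) b)
        = frechet_derivative (\<lambda>x. f (g x)) (at x) v"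
      unfolding frechet_derivative_chain[OF dg[OF x] df[OF x]]
      by (rule linear_basis_expansion[OF linear_frechet_derivative[OF df[OF x]], symmetric])
  next
    have "Ck_on k (\<lambda>x. frechet_derivative g (at x) v \<bullet> b) T" for b
      by (rule Ck_on_linear[OF assms(2), of "\<lambda>y. y \<bullet> b"])
        (use Suc.prems(2) in \<open>auto simp: bounded_linear.linear[OF bounded_linear_inner_left]\<close>)
    moreover have "Ck_on k (\<lambda>x. frechet_derivative f (at (g x)) b) T" for b
      using Suc.prems Ck_on_SucD by (intro Suc.IH) auto
    ultimately show "Ck_on k (\<lambda>x. \<Sum>b\<in>Basis. (frechet_derivative g (at x) v \<bullet> b) *\<^sub>R
        frechet_derivative f (at (g x)) b) T"
      by (intro Ck_on_sum Ck_on_scaleR assms finite_Basis)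
  qed
  moreover have "(\<lambda>x. f (g x)) differentiable (at x)" if "x \<in> T" for x
    using differentiable_chain_at[OF dg df] that by (simp add: o_def)
  ultimately show ?case by simp
qed

lemma smooth_on_cong: "open S \<Longrightarrow> (\<And>x. x \<in> S \<Longrightarrow> f x = g x) \<Longrightarrow> smooth_on S f \<Longrightarrow> smooth_on S g"
  unfolding smooth_on_def using Ck_on_cong by blast

lemma smooth_on_subset: "smooth_on S f \<Longrightarrow> T \<subseteq> S \<Longrightarrow> smooth_on T f"
  unfolding smooth_on_def using Ck_on_subset by blast

lemma smooth_on_const: "smooth_on S (\<lambda>x. c)"
  by (simp add: smooth_on_def Ck_on_const)

lemma smooth_on_ident: "smooth_on S (\<lambda>x. x)"
proof -
  have "Ck_on k (\<lambda>x. x) S" for k by (cases k) (auto simp: Ck_on_const)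
  then show ?thesis by (simp add: smooth_on_def)
qed

lemma smooth_on_linear: "open S \<Longrightarrow> linear L \<Longrightarrow> smooth_on S f \<Longrightarrow> smooth_on S (\<lambda>x. L (f x))"
  by (simp add: smooth_on_def Ck_on_linear)

lemma smooth_on_compose:
  "smooth_on S f \<Longrightarrow> smooth_on T g \<Longrightarrow> open S \<Longrightarrow> open T \<Longrightarrow> (\<And>x. x \<in> T \<Longrightarrow> g x \<in> S)
    \<Longrightarrow> smooth_on T (\<lambda>x. f (g x))"
  by (simp add: smooth_on_def Ck_on_compose)

lemma smooth_on_Pair:
  fixes f :: "'c::euclidean_space \<Rightarrow> 'd::euclidean_space" and g :: "'c \<Rightarrow> 'e::euclidean_space"
  assumes "open S" "smooth_on S f" "smooth_on S g"
  shows "smooth_on S (\<lambda>x. (f x, g x))"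
proof -
  have "linear (\<lambda>y::'d. (y, 0::'e))" "linear (\<lambda>y::'e. (0::'d, y))" by (auto intro!: linearI)
  then have "smooth_on S (\<lambda>x. (f x, 0::'e))" "smooth_on S (\<lambda>x. (0::'d, g x))"
    using smooth_on_linear assms by blast+
  then have "smooth_on S (\<lambda>x. (f x, 0) + (0, g x))"
    using Ck_on_add[OF assms(1)] by (fastforce simp: smooth_on_def)
  then show ?thesis by simp
qed

lemma smooth_on_frechet_derivative:
  "smooth_on S f \<Longrightarrow> smooth_on S (\<lambda>x. frechet_derivative f (at x) v)"
  unfolding smooth_on_def by (metis Ck_on.simps(2))

lemma smooth_on_imp_differentiable: "smooth_on S f \<Longrightarrow> x \<in> S \<Longrightarrow> f differentiable (at x)"
  unfolding smooth_on_def by (metis Ck_on.simps(2))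

lemma smooth_on_imp_continuous_on: "smooth_on S f \<Longrightarrow> continuous_on S f"
  unfolding smooth_on_def using Ck_on_imp_continuous by blast

text \<open>A product rule for a varying linear map applied to a varying vector. Differentiability
  of \<open>N\<close> is asked for each fixed vector separately, so no derivative of an
  operator-valued function is involved; a basis expansion reduces it to the rule for scalar
  multiples.\<close>

lemma has_derivative_linear_family:
  fixes N :: "'c::real_normed_vector \<Rightarrow> 'd::euclidean_space \<Rightarrow> 'e::real_normed_vector"
  assumes "open S" "x0 \<in> S" "\<And>x. x \<in> S \<Longrightarrow> linear (N x)"
    and "\<And>u. ((\<lambda>x. N x u) has_derivative (\<lambda>w. D w u)) (at x0)"
    and "(U has_derivative U') (at x0)"
  shows "((\<lambda>x. N x (U x)) has_derivative (\<lambda>w. D w (U x0) + N x0 (U' w))) (at x0)"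
proof -
  have expand: "N x u = (\<Sum>b\<in>Basis. (u \<bullet> b) *\<^sub>R N x b)" if "x \<in> S" for x u
    by (rule linear_basis_expansion[OF assms(3)[OF that]])
  \<comment> \<open>Linearity of \<open>D w\<close> is not assumed. It is inherited from
    \<open>N x\<close> through uniqueness of the derivative.\<close>
  have D: "D w u = (\<Sum>b\<in>Basis. (u \<bullet> b) *\<^sub>R D w b)" for w u
  proof -
    have "((\<lambda>x. \<Sum>b\<in>Basis. (u \<bullet> b) *\<^sub>R N x b) has_derivative
        (\<lambda>w. \<Sum>b\<in>Basis. (u \<bullet> b) *\<^sub>R D w b)) (at x0)"
      by (intro has_derivative_sum has_derivative_scaleR_right assms(4))
    then have "((\<lambda>x. N x u) has_derivative (\<lambda>w. \<Sum>b\<in>Basis. (u \<bullet> b) *\<^sub>R D w b)) (at x0)"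
      by (rule has_derivative_transform_within_open[OF _ assms(1,2)]) (simp add: expand[symmetric])
    from has_derivative_unique[OF assms(4) this] show ?thesis by metis
  qed
  have "((\<lambda>x. \<Sum>b\<in>Basis. (U x \<bullet> b) *\<^sub>R N x b) has_derivative
      (\<lambda>w. \<Sum>b\<in>Basis. (U x0 \<bullet> b) *\<^sub>R D w b + (U' w \<bullet> b) *\<^sub>R N x0 b)) (at x0)"
    by (intro has_derivative_sum has_derivative_scaleR has_derivative_inner_left assms(4,5))
  then have "((\<lambda>x. N x (U x)) has_derivative
      (\<lambda>w. \<Sum>b\<in>Basis. (U x0 \<bullet> b) *\<^sub>R D w b + (U' w \<bullet> b) *\<^sub>R N x0 b)) (at x0)"
    by (rule has_derivative_transform_within_open[OF _ assms(1,2)]) (simp add: expand[symmetric])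
  then show ?thesis
    unfolding sum.distrib by (simp only: D[symmetric] expand[OF assms(2), symmetric])
qed

section \<open>Second derivatives: symmetry and chain rule\<close>

definition second_derivative ::
    "('d::euclidean_space \<Rightarrow> 'e::euclidean_space) \<Rightarrow> 'd \<Rightarrow> 'd \<Rightarrow> 'd \<Rightarrow> 'e" where
  "second_derivative f x u v = frechet_derivative (\<lambda>y. frechet_derivative f (at y) v) (at x) u"

lemma has_derivative_second_derivative:
  assumes "smooth_on S f" "x \<in> S"
  shows "((\<lambda>y. frechet_derivative f (at y) v) has_derivative (\<lambda>u. second_derivative f x u v)) (at x)"
  unfolding second_derivative_def
  using assms smooth_on_frechet_derivative smooth_on_imp_differentiable has_derivative_frechet by blast

text \<open>The mean value theorem is applied twice: in direction \<open>u\<close> to the increment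
  of \<open>f\<close> under the shift by \<open>t *\<^sub>R v\<close>, then in direction
  \<open>v\<close> to the resulting first derivative. The left-hand side is symmetric in
  \<open>u\<close> and \<open>v\<close>, which is the point of the formula.\<close>

lemma second_difference_mean_value:
  fixes f :: "'d::euclidean_space \<Rightarrow> real"
  assumes "smooth_on S f" "0 < t"
    and sub: "\<And>a b. 0 \<le> a \<Longrightarrow> a \<le> t \<Longrightarrow> 0 \<le> b \<Longrightarrow> b \<le> t \<Longrightarrow> x + a *\<^sub>R u + b *\<^sub>R v \<in> S"
  shows "\<exists>a b. 0 \<le> a \<and> a \<le> t \<and> 0 \<le> b \<and> b \<le> t \<and>
    f (x + t *\<^sub>R u + t *\<^sub>R v) - f (x + t *\<^sub>R u) - f (x + t *\<^sub>R v) + f x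
      = t * (t * second_derivative f (x + a *\<^sub>R u + b *\<^sub>R v) v u)"
proof -
  let ?D = "\<lambda>y. frechet_derivative f (at y)"
  have der: "((\<lambda>s. f (y + s *\<^sub>R w)) has_real_derivative ?D (y + s *\<^sub>R w) w) (at s)"
    if "y + s *\<^sub>R w \<in> S" for y s w
  proof -
    have "f differentiable (at (y + s *\<^sub>R w))" using assms(1) that smooth_on_imp_differentiable by blast
    then have "(f has_derivative ?D (y + s *\<^sub>R w)) (at (y + s *\<^sub>R w))"
      by (rule has_derivative_frechet)
    moreover have "((\<lambda>s. y + s *\<^sub>R w) has_derivative (\<lambda>h. h *\<^sub>R w)) (at s)"
      by (auto intro!: derivative_eq_intros)
    ultimately have "((\<lambda>s. f (y + s *\<^sub>R w)) has_derivative (\<lambda>h. ?D (y + s *\<^sub>R w) (h *\<^sub>R w))) (at s)"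
      using has_derivative_compose by fastforce
    then show ?thesis
      by (simp add: has_field_derivative_def
          linear_cmul[OF linear_frechet_derivative[OF \<open>f differentiable _\<close>]] mult.commute[of _ "?D _ _"])
  qed
  let ?\<phi> = "\<lambda>s. f (x + t *\<^sub>R v + s *\<^sub>R u) - f (x + s *\<^sub>R u)"
  have "\<exists>a>0. a < t \<and> ?\<phi> t - ?\<phi> 0 = (t - 0) * (?D (x + t *\<^sub>R v + a *\<^sub>R u) u - ?D (x + a *\<^sub>R u) u)"
  proof (rule MVT2[OF assms(2)])
    fix s assume s: "0 \<le> s" "s \<le> t"
    have "x + t *\<^sub>R v + s *\<^sub>R u \<in> S" "x + s *\<^sub>R u \<in> S"
      using sub[of s t] sub[of s 0] s assms(2) by (auto simp: algebra_simps)
    then show "(?\<phi> has_real_derivative (?D (x + t *\<^sub>R v + s *\<^sub>R u) u - ?D (x + s *\<^sub>R u) u)) (at s)"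
      using DERIV_diff der by blast
  qed
  then obtain a where a: "0 < a" "a < t"
    "?\<phi> t - ?\<phi> 0 = t * (?D (x + t *\<^sub>R v + a *\<^sub>R u) u - ?D (x + a *\<^sub>R u) u)" by auto
  let ?\<psi> = "\<lambda>s. ?D (x + a *\<^sub>R u + s *\<^sub>R v) u"
  have "\<exists>b>0. b < t \<and> ?\<psi> t - ?\<psi> 0 = (t - 0) * second_derivative f (x + a *\<^sub>R u + b *\<^sub>R v) v u"
  proof (rule MVT2[OF assms(2)])
    fix s assume s: "0 \<le> s" "s \<le> t"
    let ?y = "x + a *\<^sub>R u + s *\<^sub>R v"
    have "?y \<in> S" using sub[of a s] s a by auto
    note d2 = has_derivative_second_derivative[OF assms(1) this, of u]
    have "((\<lambda>s. x + a *\<^sub>R u + s *\<^sub>R v) has_derivative (\<lambda>h. h *\<^sub>R v)) (at s)"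
      by (auto intro!: derivative_eq_intros)
    from has_derivative_compose[OF this d2]
    show "(?\<psi> has_real_derivative second_derivative f ?y v u) (at s)"
      by (simp add: has_field_derivative_def
          linear_cmul[OF has_derivative_linear[OF d2]] mult.commute[of _ "second_derivative _ _ _ _"])
  qed
  then obtain b where b: "0 < b" "b < t"
    "?\<psi> t - ?\<psi> 0 = t * second_derivative f (x + a *\<^sub>R u + b *\<^sub>R v) v u" by auto
  have "f (x + t *\<^sub>R u + t *\<^sub>R v) - f (x + t *\<^sub>R u) - f (x + t *\<^sub>R v) + f x = ?\<phi> t - ?\<phi> 0"
    by (simp add: algebra_simps)
  also have "\<dots> = t * (?\<psi> t - ?\<psi> 0)" using a(3) by (simp add: algebra_simps)
  finally show ?thesis using a b by (intro exI[of _ a] exI[of _ b]) auto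
qed

text \<open>Schwarz's theorem: expanding the same second difference in both orders makes the two
  mixed derivatives agree at two points arbitrarily close to \<open>x\<close>, and continuity
  carries this to \<open>x\<close>.\<close>

lemma second_derivative_symmetric_real:
  fixes f :: "'d::euclidean_space \<Rightarrow> real"
  assumes f: "smooth_on S f" and "open S" "x \<in> S"
  shows "second_derivative f x u v = second_derivative f x v u"
proof (rule ccontr)
  assume ne: "\<not> ?thesis"
  \<comment> \<open>Half the supposed gap: values within \<open>e\<close> of the two mixed
    derivatives at \<open>x\<close> cannot coincide.\<close>
  define e where "e = \<bar>second_derivative f x u v - second_derivative f x v u\<bar> / 2"
  have "e > 0" using ne by (simp add: e_def)
  have cont: "continuous (at x) (\<lambda>y. second_derivative f y w z)" for w z
    unfolding second_derivative_def
    using f assms(2,3) smooth_on_frechet_derivative smooth_on_imp_continuous_on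
    by (metis continuous_on_eq_continuous_at)
  obtain d1 where d1: "d1 > 0"
    "\<And>y. dist y x < d1 \<Longrightarrow> dist (second_derivative f y u v) (second_derivative f x u v) < e"
    using cont[unfolded continuous_at_eps_delta, rule_format, OF \<open>e > 0\<close>] by blast
  obtain d2 where d2: "d2 > 0"
    "\<And>y. dist y x < d2 \<Longrightarrow> dist (second_derivative f y v u) (second_derivative f x v u) < e"
    using cont[unfolded continuous_at_eps_delta, rule_format, OF \<open>e > 0\<close>] by blast
  obtain d3 where d3: "d3 > 0" "ball x d3 \<subseteq> S" using assms(2,3) open_contains_ball by blast
  define d where "d = min d1 (min d2 d3)"
  \<comment> \<open>Moving by at most \<open>t\<close> along each of \<open>u\<close> and
    \<open>v\<close> stays within \<open>d\<close> of \<open>x\<close>; the summand 1 keeps the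
    denominator positive even for zero vectors.\<close>
  define t where "t = d / (2 * (norm u + norm v + 1))"
  have d: "d > 0" using d1 d2 d3 by (simp add: d_def)
  have n: "norm u + norm v + 1 > 0" by (simp add: add_nonneg_pos)
  then have t: "t > 0" using d by (simp add: t_def)
  have near: "dist (x + a *\<^sub>R w + b *\<^sub>R z) x < d"
    if "0 \<le> a" "a \<le> t" "0 \<le> b" "b \<le> t" "norm w + norm z = norm u + norm v" for a b w z
  proof -
    have "dist (x + a *\<^sub>R w + b *\<^sub>R z) x \<le> a * norm w + b * norm z"
      using that norm_triangle_ineq[of "a *\<^sub>R w" "b *\<^sub>R z"] by (simp add: dist_norm)
    also have "\<dots> \<le> t * norm w + t * norm z"
      using that by (intro add_mono mult_right_mono) auto
    also have "\<dots> = t * (norm u + norm v)" using that(5) by (simp add: distrib_left[symmetric])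
    also have "\<dots> < t * (2 * (norm u + norm v + 1))"
      using t by (intro mult_strict_left_mono) (auto simp: add_nonneg_pos add_strict_increasing2)
    also have "\<dots> = d" using n unfolding t_def by simp
    finally show ?thesis .
  qed
  have S: "x + a *\<^sub>R w + b *\<^sub>R z \<in> S"
    if "0 \<le> a" "a \<le> t" "0 \<le> b" "b \<le> t" "norm w + norm z = norm u + norm v" for a b w z
    using near[OF that] d3 by (auto simp: d_def dist_commute)
  obtain a b where 1: "0 \<le> a" "a \<le> t" "0 \<le> b" "b \<le> t"
    "f (x + t *\<^sub>R u + t *\<^sub>R v) - f (x + t *\<^sub>R u) - f (x + t *\<^sub>R v) + f x
      = t * (t * second_derivative f (x + a *\<^sub>R u + b *\<^sub>R v) v u)"
    using second_difference_mean_value[OF f t S[of _ _ u v]] by auto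
  obtain a' b' where 2: "0 \<le> a'" "a' \<le> t" "0 \<le> b'" "b' \<le> t"
    "f (x + t *\<^sub>R v + t *\<^sub>R u) - f (x + t *\<^sub>R v) - f (x + t *\<^sub>R u) + f x
      = t * (t * second_derivative f (x + a' *\<^sub>R v + b' *\<^sub>R u) u v)"
    using second_difference_mean_value[OF f t S[of _ _ v u]] by (auto simp: add.commute)
  have "second_derivative f (x + a *\<^sub>R u + b *\<^sub>R v) v u = second_derivative f (x + a' *\<^sub>R v + b' *\<^sub>R u) u v"
    using 1(5) 2(5) t by (simp add: algebra_simps)
  moreover have "dist (second_derivative f (x + a *\<^sub>R u + b *\<^sub>R v) v u) (second_derivative f x v u) < e"
    using near[OF 1(1-4)] by (intro d2) (auto simp: d_def)
  moreover have "dist (second_derivative f (x + a' *\<^sub>R v + b' *\<^sub>R u) u v) (second_derivative f x u v) < e"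
    using near[OF 2(1-4), of v u] by (intro d1) (auto simp: d_def)
  ultimately show False unfolding e_def dist_real_def by (smt (verit) field_sum_of_halves)
qed

lemma second_derivative_symmetric:
  fixes f :: "'d::euclidean_space \<Rightarrow> 'e::euclidean_space"
  assumes f: "smooth_on S f" and S: "open S" "x \<in> S"
  shows "second_derivative f x u v = second_derivative f x v u"
proof (rule euclidean_eqI)
  fix b :: 'e assume "b \<in> Basis"
  have 1: "frechet_derivative (\<lambda>x. f x \<bullet> b) (at y) w = frechet_derivative f (at y) w \<bullet> b"
    if "y \<in> S" for y w
    using has_derivative_inner_left[OF has_derivative_frechet[OF smooth_on_imp_differentiable[OF f that]]]
    by (rule frechet_derivative_eqI)
  have 2: "second_derivative (\<lambda>x. f x \<bullet> b) x u v = second_derivative f x u v \<bullet> b" for u v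
  proof -
    have "second_derivative (\<lambda>x. f x \<bullet> b) x u v
        = frechet_derivative (\<lambda>y. frechet_derivative f (at y) v \<bullet> b) (at x) u"
      unfolding second_derivative_def by (rule fun_cong[OF frechet_derivative_cong_open[OF S 1]])
    then show ?thesis
      by (simp add: frechet_derivative_eqI
          [OF has_derivative_inner_left[OF has_derivative_second_derivative[OF f S(2)]]])
  qed
  have "smooth_on S (\<lambda>x. f x \<bullet> b)"
    by (rule smooth_on_linear[OF S(1) _ f])
      (rule bounded_linear.linear[OF bounded_linear_inner_left])
  from second_derivative_symmetric_real[OF this S]
  show "second_derivative f x u v \<bullet> b = second_derivative f x v u \<bullet> b" by (simp add: 2)
qed

lemma bilinear_second_derivative:
  assumes f: "smooth_on S f" and S: "open S" "x \<in> S"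
  shows "bilinear (second_derivative f x)"
  using has_derivative_linear[OF has_derivative_second_derivative[OF f S(2)]]
    second_derivative_symmetric[OF assms] unfolding bilinear_def by auto

text \<open>The second summand is the non-tensorial part. For a change of chart it becomes a tangent
  vector, and for an affine inner map it vanishes; both facts are used later.\<close>

lemma second_derivative_compose:
  assumes f: "smooth_on S f" and g: "smooth_on T g" and "open S" "open T" "x \<in> T"
    and gS: "\<And>x. x \<in> T \<Longrightarrow> g x \<in> S"
  shows "second_derivative (\<lambda>x. f (g x)) x u v
    = second_derivative f (g x) (frechet_derivative g (at x) u) (frechet_derivative g (at x) v)
      + frechet_derivative f (at (g x)) (second_derivative g x u v)"
proof -
  let ?N = "\<lambda>y. frechet_derivative f (at (g y))"
  have eq: "second_derivative (\<lambda>x. f (g x)) x u v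
      = frechet_derivative (\<lambda>y. ?N y (frechet_derivative g (at y) v)) (at x) u"
    unfolding second_derivative_def
    by (rule fun_cong[OF frechet_derivative_cong_open[OF assms(4,5)]], rule frechet_derivative_chain)
      (use f g gS smooth_on_imp_differentiable in blast)+
  have "((\<lambda>y. ?N y (frechet_derivative g (at y) v)) has_derivative
      (\<lambda>u. second_derivative f (g x) (frechet_derivative g (at x) u) (frechet_derivative g (at x) v)
        + ?N x (second_derivative g x u v))) (at x)"
  proof (rule has_derivative_linear_family[OF assms(4,5),
        where D = "\<lambda>u w. second_derivative f (g x) (frechet_derivative g (at x) u) w"])
    show "linear (?N y)" if "y \<in> T" for y
      using f gS that smooth_on_imp_differentiable linear_frechet_derivative by blast
    show "((\<lambda>y. ?N y w) has_derivative
        (\<lambda>u. second_derivative f (g x) (frechet_derivative g (at x) u) w)) (at x)" for w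
      using has_derivative_compose[OF has_derivative_frechet[OF smooth_on_imp_differentiable[OF g assms(5)]]
          has_derivative_second_derivative[OF f gS[OF assms(5)]]] .
    show "((\<lambda>y. frechet_derivative g (at y) v) has_derivative (\<lambda>u. second_derivative g x u v)) (at x)"
      by (rule has_derivative_second_derivative[OF g assms(5)])
  qed
  from frechet_derivative_eqI[OF this, of u] eq show ?thesis by simp
qed

section \<open>Inner products and charts\<close>

lemma inner_product_linear:
  assumes "inner_product G"
  shows "linear (G u)" "linear (\<lambda>u. G u v)"
  using assms by (auto simp: inner_product_def bilinear_def)

lemmas inner_product_simps =
  linear_add[OF inner_product_linear(1)] linear_add[OF inner_product_linear(2)]
  linear_diff[OF inner_product_linear(1)] linear_diff[OF inner_product_linear(2)]
  linear_cmul[OF inner_product_linear(1)] linear_cmul[OF inner_product_linear(2)]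
  linear_neg[OF inner_product_linear(1)] linear_neg[OF inner_product_linear(2)]
  linear_0[OF inner_product_linear(1)] linear_0[OF inner_product_linear(2)]

lemma inner_product_commute: "inner_product G \<Longrightarrow> G u v = G v u"
  by (simp add: inner_product_def)

lemma inner_product_pos: "inner_product G \<Longrightarrow> u \<noteq> 0 \<Longrightarrow> G u u > 0"
  by (simp add: inner_product_def)

lemma inner_product_eq_0: "inner_product G \<Longrightarrow> G u u = 0 \<longleftrightarrow> u = 0"
  using inner_product_pos[of G u] inner_product_simps(10)[of G u] by fastforce

lemma inner_product_nonneg: "inner_product G \<Longrightarrow> G u u \<ge> 0"
  using inner_product_pos[of G u] inner_product_eq_0[of G u] by (cases "u = 0") auto

lemma inner_product_eqI:
  assumes "inner_product G" "\<And>u. G s u = G t u"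
  shows "s = t"
proof -
  have "G (s - t) (s - t) = 0" by (simp add: inner_product_simps assms)
  then show ?thesis using inner_product_eq_0[OF assms(1)] by auto
qed

text \<open>The map sending \<open>s\<close> to the vector of its pairings with the basis is
  injective by definiteness, hence surjective by dimension.\<close>

lemma inner_product_riesz:
  assumes G: "inner_product G" and l: "linear l"
  obtains s where "\<And>u. G s u = l u"
proof -
  define T where "T s = (\<Sum>b\<in>Basis. G s b *\<^sub>R b)" for s
  have T: "T s \<bullet> b = G s b" if "b \<in> Basis" for s b
    using that by (simp add: T_def inner_sum_left inner_Basis if_distrib cong: if_cong)
  have "linear T"
    by (rule linearI; rule euclidean_eqI) (simp_all add: T inner_simps inner_product_simps[OF G])
  moreover have "inj T"
  proof (subst linear_injective_0[OF \<open>linear T\<close>], safe)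
    fix s assume "T s = 0"
    then have "G s b = 0" if "b \<in> Basis" for b using T[OF that, of s] by simp
    then have "G s u = 0" for u
      by (subst linear_basis_expansion[OF inner_product_linear(1)[OF G]]) simp
    then show "s = 0" using inner_product_eq_0[OF G] by blast
  qed
  ultimately obtain s where s: "T s = (\<Sum>b\<in>Basis. l b *\<^sub>R b)"
    using linear_injective_imp_surjective by (metis surjD)
  have "G s b = l b" if "b \<in> Basis" for b
  proof -
    have "G s b = (\<Sum>b\<in>Basis. l b *\<^sub>R b) \<bullet> b" by (metis T that s)
    then show ?thesis using that by (simp add: inner_sum_left inner_Basis if_distrib cong: if_cong)
  qed
  then have "G s u = l u" for u
    by (subst linear_basis_expansion[OF inner_product_linear(1)[OF G]], subst linear_basis_expansion[OF l]) simp
  then show ?thesis using that by blast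
qed

lemma inner_product_pullback:
  assumes "inner_product G" "linear T" "inj T"
  shows "inner_product (\<lambda>u v. G (T u) (T v))"
  unfolding inner_product_def bilinear_def
proof (intro conjI allI impI)
  show "linear (\<lambda>v. G (T u) (T v))" "linear (\<lambda>u. G (T u) (T v))" for u v
    using linear_compose[OF assms(2) inner_product_linear(1)[OF assms(1)]]
      linear_compose[OF assms(2) inner_product_linear(2)[OF assms(1)]] by (simp_all add: o_def)
  show "G (T u) (T v) = G (T v) (T u)" for u v by (rule inner_product_commute[OF assms(1)])
  show "G (T u) (T u) > 0" if "u \<noteq> 0" for u
    using that inner_product_pos[OF assms(1)] linear_injective_0[OF assms(2)] assms(3) by blast
qed

lemma gram_schmidt:
  assumes G: "inner_product G" and "finite S"
  shows "\<exists>E. finite E \<and> span E = span S \<and> (\<forall>u\<in>E. \<forall>v\<in>E. G u v = (if u = v then 1 else 0))"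
  using assms(2)
proof (induction S rule: finite_induct)
  case empty
  show ?case by (intro exI[of _ "{}"]) auto
next
  case (insert a S)
  then obtain E where E: "finite E" "span E = span S"
    "\<And>u v. u \<in> E \<Longrightarrow> v \<in> E \<Longrightarrow> G u v = (if u = v then 1 else 0)" by blast
  show ?case
  proof (cases "a \<in> span S")
    case True
    then show ?thesis using E span_redundant[OF True] by (intro exI[of _ E]) auto
  next
    case False
    define b where "b = a - (\<Sum>e\<in>E. G a e *\<^sub>R e)"
    define c where "c = (1 / sqrt (G b b)) *\<^sub>R b"
    have sumE: "(\<Sum>e\<in>E. G a e *\<^sub>R e) \<in> span E" by (intro span_sum span_scale span_base)
    then have "b \<noteq> 0" using False E(2) by (auto simp: b_def)
    then have bb: "G b b > 0" using inner_product_pos[OF G] by auto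
    have "G b v = 0" if "v \<in> E" for v
    proof -
      have "G (\<Sum>e\<in>E. G a e *\<^sub>R e) v = (\<Sum>e\<in>E. G a e * G e v)"
        by (simp add: linear_sum[OF inner_product_linear(2)[OF G]] inner_product_simps[OF G])
      also have "\<dots> = (\<Sum>e\<in>E. if e = v then G a e else 0)"
        by (rule sum.cong) (auto simp: E(3)[OF _ that])
      finally show ?thesis using that E(1) by (simp add: b_def inner_product_simps[OF G])
    qed
    then have "G c v = 0" "G v c = 0" if "v \<in> E" for v
      using that inner_product_commute[OF G, of v] by (auto simp: c_def inner_product_simps[OF G])
    moreover have "G c c = 1" using bb by (simp add: c_def inner_product_simps[OF G])
    ultimately have "\<forall>u\<in>insert c E. \<forall>v\<in>insert c E. G u v = (if u = v then 1 else 0)"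
      using E(3) by fastforce
    moreover have "span (insert c E) = span (insert a S)"
    proof -
      have "span (insert c E) = span (insert b E)"
      proof -
        have "b = sqrt (G b b) *\<^sub>R c" using bb by (simp add: c_def)
        then have "b \<in> span (insert c E)" by (metis insertI1 span_base span_scale)
        moreover have "c \<in> span (insert b E)" unfolding c_def by (intro span_scale span_base) simp
        ultimately show ?thesis unfolding span_eq by (auto intro: span_base)
      qed
      also have "\<dots> = span (insert a E)"
        using sumE eq_span_insert_eq[of a b E] by (auto simp: b_def)
      also have "\<dots> = span (insert a S)"
        using E(2) by (simp add: span_insert)
      finally show ?thesis .
    qed
    ultimately show ?thesis using E(1) by (intro exI[of _ "insert c E"]) auto
  qed
qed

text \<open>Guarantees that the basis picked by \<open>SOME\<close> in
  \<open>second_ff_norm_sq\<close> and \<open>mean_curvature\<close> really is one.\<close>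

lemma orthonormal_basis_exists:
  assumes "inner_product G"
  shows "\<exists>E. orthonormal_basis G E"
  using gram_schmidt[OF assms finite_Basis] by (simp add: orthonormal_basis_def)

text \<open>Pairing a vanishing combination with a basis vector isolates its coefficient, so the
  basis is independent. The count cancels the factor \<open>1 / real (DIM('d))\<close> in
  \<open>mean_curvature\<close>.\<close>

lemma orthonormal_basis_card:
  fixes G :: "'d::euclidean_space \<Rightarrow> 'd \<Rightarrow> real"
  assumes G: "inner_product G" and E: "orthonormal_basis G E"
  shows "card E = DIM('d)"
proof -
  have fin: "finite E" and span: "span E = UNIV"
    and on: "\<And>u v. u \<in> E \<Longrightarrow> v \<in> E \<Longrightarrow> G u v = (if u = v then 1 else 0)"
    using E by (auto simp: orthonormal_basis_def)
  have "independent E"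
  proof (rule independent_if_scalars_zero[OF fin])
    fix f v assume 0: "(\<Sum>x\<in>E. f x *\<^sub>R x) = 0" and v: "v \<in> E"
    have "0 = G (\<Sum>x\<in>E. f x *\<^sub>R x) v" using 0 by (simp add: inner_product_simps[OF G])
    also have "\<dots> = (\<Sum>x\<in>E. f x * G x v)"
      by (simp add: linear_sum[OF inner_product_linear(2)[OF G]] inner_product_simps[OF G])
    also have "\<dots> = (\<Sum>x\<in>E. if x = v then f x else 0)"
      by (rule sum.cong) (auto simp: on[OF _ v])
    finally show "f v = 0" using v fin by simp
  qed
  then show ?thesis using span dim_eq_card[of E UNIV] by simp
qed

text \<open>\<open>K u v w\<close> stands for the inner product of the derivative of
  \<open>v\<close> along \<open>u\<close> with \<open>w\<close>: the first assumption is absence of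
  torsion for commuting fields, the second is metric compatibility. It serves both the Christoffel
  symbols and the ambient Hessian.\<close>

lemma koszul_formula:
  fixes K :: "'v \<Rightarrow> 'v \<Rightarrow> 'v \<Rightarrow> real"
  assumes "\<And>u v w. K u v w = K v u w" "\<And>u v w. T u v w = K u v w + K u w v"
  shows "2 * K u v w = T u v w + T v u w - T w u v"
  using assms(1)[of u v w] assms(1)[of u w v] assms(1)[of v w u] by (simp add: assms(2))

text \<open>Makes the definite description in \<open>christoffel\<close> meaningful. The Koszul
  formula prescribes every inner product \<open>G (\<Gamma> u v) w\<close>: definiteness gives
  uniqueness, the Riesz representation existence.\<close>

lemma koszul_unique_existence:
  assumes G: "inner_product G"
    and T: "\<And>v w. linear (\<lambda>u. T u v w)" "\<And>u w. linear (\<lambda>v. T u v w)" "\<And>u v. linear (T u v)"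
    and sym: "\<And>u v w. T u v w = T u w v"
  shows "\<exists>!\<Gamma>. bilinear \<Gamma> \<and> (\<forall>u v. \<Gamma> u v = \<Gamma> v u) \<and> (\<forall>u v w. T u v w = G (\<Gamma> u v) w + G v (\<Gamma> u w))"
proof -
  let ?P = "\<lambda>\<Gamma>. bilinear \<Gamma> \<and> (\<forall>u v. \<Gamma> u v = \<Gamma> v u) \<and> (\<forall>u v w. T u v w = G (\<Gamma> u v) w + G v (\<Gamma> u w))"
  let ?l = "\<lambda>u v w. (T u v w + T v u w - T w u v) / 2"
  note lin = linear_add[OF T(1)] linear_add[OF T(2)] linear_add[OF T(3)]
    linear_cmul[OF T(1)] linear_cmul[OF T(2)] linear_cmul[OF T(3)]
  have "\<exists>s. \<forall>w. G s w = ?l u v w" for u v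
  proof -
    have "linear (?l u v)" by (rule linearI) (simp_all add: lin field_simps)
    from inner_product_riesz[OF G this] show ?thesis by metis
  qed
  then obtain \<Gamma> where \<Gamma>: "G (\<Gamma> u v) w = ?l u v w" for u v w by metis
  have "?P \<Gamma>"
  proof (intro conjI allI)
    show "bilinear \<Gamma>"
      unfolding bilinear_def
      by (intro conjI allI linearI inner_product_eqI[OF G])
        (simp_all add: inner_product_simps[OF G] \<Gamma> lin field_simps)
    show "\<Gamma> u v = \<Gamma> v u" for u v
      by (rule inner_product_eqI[OF G]) (simp add: \<Gamma> sym[of _ u v])
    show "T u v w = G (\<Gamma> u v) w + G v (\<Gamma> u w)" for u v w
      using inner_product_commute[OF G, of v "\<Gamma> u w"] sym[of u v w] sym[of v w u] sym[of w v u]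
      by (simp add: \<Gamma> field_simps)
  qed
  moreover have "\<Gamma>' = \<Gamma>" if "?P \<Gamma>'" for \<Gamma>'
  proof (intro ext inner_product_eqI[OF G])
    fix u v w
    have "2 * G (\<Gamma>' u v) w = T u v w + T v u w - T w u v"
      by (rule koszul_formula[where T = T]) (use that inner_product_commute[OF G] in metis)+
    then show "G (\<Gamma>' u v) w = G (\<Gamma> u v) w" by (simp add: \<Gamma>)
  qed
  ultimately show ?thesis by (rule ex1I)
qed

lemma linear_frechet_derivative_family:
  fixes N :: "'c::real_normed_vector \<Rightarrow> 'd::real_vector \<Rightarrow> 'e::real_normed_vector"
  assumes "open S" "x0 \<in> S" "\<And>x. x \<in> S \<Longrightarrow> linear (N x)"
    and "\<And>u. (\<lambda>x. N x u) differentiable (at x0)"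
  shows "linear (\<lambda>u. frechet_derivative (\<lambda>x. N x u) (at x0) w)"
proof (rule linearI)
  note D = has_derivative_frechet[OF assms(4)]
  fix u v r
  have "((\<lambda>x. N x (u + v)) has_derivative (\<lambda>w. frechet_derivative (\<lambda>x. N x u) (at x0) w
      + frechet_derivative (\<lambda>x. N x v) (at x0) w)) (at x0)"
    by (rule has_derivative_transform_within_open[OF has_derivative_add[OF D D] assms(1,2)])
      (simp add: linear_add[OF assms(3)])
  then show "frechet_derivative (\<lambda>x. N x (u + v)) (at x0) w
      = frechet_derivative (\<lambda>x. N x u) (at x0) w + frechet_derivative (\<lambda>x. N x v) (at x0) w"
    by (rule frechet_derivative_eqI)
  have "((\<lambda>x. N x (r *\<^sub>R u)) has_derivative (\<lambda>w. r *\<^sub>R frechet_derivative (\<lambda>x. N x u) (at x0) w)) (at x0)"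
    by (rule has_derivative_transform_within_open[OF has_derivative_scaleR_right[OF D] assms(1,2)])
      (simp add: linear_cmul[OF assms(3)])
  then show "frechet_derivative (\<lambda>x. N x (r *\<^sub>R u)) (at x0) w
      = r *\<^sub>R frechet_derivative (\<lambda>x. N x u) (at x0) w"
    by (rule frechet_derivative_eqI)
qed

section \<open>Charts, coordinate representations and tangent maps\<close>

lemma smooth_atlasD:
  assumes "smooth_atlas A" "c \<in> A"
  shows "open (fst c)" "open (snd c ` fst c)"
    and "q \<in> fst c \<Longrightarrow> chart_inv c (snd c q) = q"
    and "x \<in> snd c ` fst c \<Longrightarrow> chart_inv c x \<in> fst c"
    and "x \<in> snd c ` fst c \<Longrightarrow> snd c (chart_inv c x) = x"
    and "continuous_on (fst c) (snd c)" "continuous_on (snd c ` fst c) (chart_inv c)"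
  using assms by (auto simp: smooth_atlas_def homeomorphism_def)

lemma chart_at:
  assumes "smooth_atlas A"
  shows "chart_at A p \<in> A" "p \<in> fst (chart_at A p)"
proof -
  have "p \<in> (\<Union>c\<in>A. fst c)" using assms by (simp add: smooth_atlas_def)
  then have "\<exists>c. c \<in> A \<and> p \<in> fst c" by blast
  from someI_ex[OF this] show "chart_at A p \<in> A" "p \<in> fst (chart_at A p)"
    by (auto simp: chart_at_def)
qed

lemma open_chart_image:
  assumes "smooth_atlas A" "c \<in> A" "open W"
  shows "open (snd c ` (fst c \<inter> W))"
proof -
  have "snd c ` (fst c \<inter> W) = snd c ` fst c \<inter> chart_inv c -` W"
    using smooth_atlasD(3,4,5)[OF assms(1,2)] by force
  then show ?thesis
    using continuous_on_open_vimage smooth_atlasD(2,7)[OF assms(1,2)] assms(3)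
    by (metis continuous_open_preimage)
qed

text \<open>\<open>to_chart\<close>, \<open>from_chart\<close> and \<open>tangent_map\<close> are
  all derivatives of such representations (the first two with the identity map), so a single chain
  rule covers them.\<close>

definition local_rep :: "('a, 'd) chart \<Rightarrow> ('b, 'e) chart \<Rightarrow> ('a \<Rightarrow> 'b) \<Rightarrow> 'd \<Rightarrow> 'e" where
  "local_rep c d F = (\<lambda>x. snd d (F (chart_inv c x)))"

definition rep_domain :: "('a, 'd) chart \<Rightarrow> ('b, 'e) chart \<Rightarrow> ('a \<Rightarrow> 'b) \<Rightarrow> 'd set" where
  "rep_domain c d F = snd c ` (fst c \<inter> F -` fst d)"

lemma smooth_local_rep:
  assumes "smooth_map A B F" "c \<in> A" "d \<in> B"
  shows "smooth_on (rep_domain c d F) (local_rep c d F)"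
  using assms by (auto simp: smooth_map_def rep_domain_def local_rep_def o_def)

lemma open_vimage_chart:
  assumes "smooth_atlas B" "smooth_map A B F" "d \<in> B"
  shows "open (F -` fst d)"
  using assms smooth_atlasD(1) unfolding smooth_map_def
  by (metis continuous_on_open_vimage open_UNIV inf_top_right)

lemma open_rep_domain:
  assumes "smooth_atlas A" "smooth_atlas B" "smooth_map A B F" "c \<in> A" "d \<in> B"
  shows "open (rep_domain c d F)"
  unfolding rep_domain_def
  by (rule open_chart_image[OF assms(1,4) open_vimage_chart[OF assms(2,3,5)]])

lemma rep_domain_memI: "q \<in> fst c \<Longrightarrow> F q \<in> fst d \<Longrightarrow> snd c q \<in> rep_domain c d F"
  by (auto simp: rep_domain_def)

lemma local_rep_at:
  "smooth_atlas A \<Longrightarrow> c \<in> A \<Longrightarrow> q \<in> fst c \<Longrightarrow> local_rep c d F (snd c q) = snd d (F q)"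
  by (simp add: local_rep_def smooth_atlasD(3))

lemma smooth_map_ident:
  assumes "smooth_atlas A"
  shows "smooth_map A A (\<lambda>q. q)"
  using assms by (auto simp: smooth_atlas_def smooth_map_def o_def)

lemma differentiable_local_rep:
  assumes "smooth_map A B F" "c \<in> A" "d \<in> B" "q \<in> fst c" "F q \<in> fst d"
  shows "local_rep c d F differentiable (at (snd c q))"
  using smooth_on_imp_differentiable[OF smooth_local_rep[OF assms(1-3)] rep_domain_memI[of q c F d]]
    assms(4,5) by blast

lemma local_rep_comp:
  assumes "smooth_atlas A" "smooth_atlas B" "c \<in> A" "d \<in> B" "x \<in> rep_domain c d F"
  shows "local_rep c e (\<lambda>q. H (F q)) x = local_rep d e H (local_rep c d F x)"
  using assms(5) smooth_atlasD(3)[OF assms(1,3)] smooth_atlasD(3)[OF assms(2,4)]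
  by (auto simp: local_rep_def rep_domain_def)

lemma local_rep_chain:
  assumes A: "smooth_atlas A" and B: "smooth_atlas B" and F: "smooth_map A B F"
    and H: "smooth_map B C H" and c: "c \<in> A" "q \<in> fst c" and d: "d \<in> B" "F q \<in> fst d"
    and e: "e \<in> C" "H (F q) \<in> fst e"
  shows "frechet_derivative (local_rep c e (\<lambda>q. H (F q))) (at (snd c q)) v
    = frechet_derivative (local_rep d e H) (at (snd d (F q)))
        (frechet_derivative (local_rep c d F) (at (snd c q)) v)"
proof -
  have "frechet_derivative (local_rep c e (\<lambda>q. H (F q))) (at (snd c q))
    = frechet_derivative (\<lambda>x. local_rep d e H (local_rep c d F x)) (at (snd c q))"
    by (rule frechet_derivative_cong_open[OF open_rep_domain[OF A B F c(1) d(1)]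
          rep_domain_memI[of q c F d, OF c(2) d(2)] local_rep_comp[OF A B c(1) d(1)]])
  moreover have "local_rep d e H differentiable (at (local_rep c d F (snd c q)))"
    using differentiable_local_rep[OF H d(1) e(1) d(2) e(2)] local_rep_at[OF A c] by metis
  ultimately show ?thesis
    using frechet_derivative_chain[OF differentiable_local_rep[OF F c(1) d(1) c(2) d(2)]]
      local_rep_at[OF A c] by metis
qed

lemma to_chart_eq_local_rep:
  "to_chart A c q v = frechet_derivative (local_rep (chart_at A q) c (\<lambda>q. q)) (at (snd (chart_at A q) q)) v"
  by (simp add: to_chart_def local_rep_def o_def)

lemma from_chart_eq_local_rep:
  "from_chart A c q v = frechet_derivative (local_rep c (chart_at A q) (\<lambda>q. q)) (at (snd c q)) v"
  by (simp add: from_chart_def local_rep_def o_def)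

lemma tangent_map_eq_local_rep:
  "tangent_map A B F q v = frechet_derivative (local_rep (chart_at A q) (chart_at B (F q)) F)
     (at (snd (chart_at A q) q)) v"
  by (simp add: tangent_map_def local_rep_def o_def)

lemma frechet_derivative_local_rep_ident:
  assumes A: "smooth_atlas A" and c: "c \<in> A" "q \<in> fst c"
  shows "frechet_derivative (local_rep c c (\<lambda>q. q)) (at (snd c q)) v = v"
proof -
  have "frechet_derivative (local_rep c c (\<lambda>q. q)) (at (snd c q)) = frechet_derivative (\<lambda>x. x) (at (snd c q))"
    by (rule frechet_derivative_cong_open[OF smooth_atlasD(2)[OF A c(1)]])
      (use c in \<open>auto simp: local_rep_def smooth_atlasD(3)[OF A c(1)]\<close>)
  then show ?thesis by simp
qed

lemma to_chart_from_chart: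
  assumes A: "smooth_atlas A" and c: "c \<in> A" "q \<in> fst c" and d: "d \<in> A" "q \<in> fst d"
  shows "to_chart A d q (from_chart A c q v) = frechet_derivative (local_rep c d (\<lambda>q. q)) (at (snd c q)) v"
  unfolding to_chart_eq_local_rep from_chart_eq_local_rep
  using local_rep_chain[OF A A smooth_map_ident[OF A] smooth_map_ident[OF A] c chart_at[OF A, of q] d]
  by simp

lemma to_chart_from_chart_same:
  assumes "smooth_atlas A" "c \<in> A" "q \<in> fst c"
  shows "to_chart A c q (from_chart A c q v) = v"
  using to_chart_from_chart[OF assms assms(2,3)] frechet_derivative_local_rep_ident[OF assms] by simp

lemma from_chart_to_chart:
  assumes A: "smooth_atlas A" and c: "c \<in> A" "q \<in> fst c"
  shows "from_chart A c q (to_chart A c q v) = v"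
  unfolding to_chart_eq_local_rep from_chart_eq_local_rep
  using local_rep_chain[OF A A smooth_map_ident[OF A] smooth_map_ident[OF A] chart_at[OF A, of q] c chart_at[OF A, of q]]
    frechet_derivative_local_rep_ident[OF A chart_at[OF A, of q]]
  by simp

lemma from_chart_chart_at: "smooth_atlas A \<Longrightarrow> from_chart A (chart_at A p) p v = v"
  by (simp add: from_chart_eq_local_rep frechet_derivative_local_rep_ident chart_at)

lemma to_chart_chart_at: "smooth_atlas A \<Longrightarrow> to_chart A (chart_at A p) p v = v"
  by (simp add: to_chart_eq_local_rep frechet_derivative_local_rep_ident chart_at)

lemma linear_from_chart:
  assumes "smooth_atlas A" "c \<in> A" "q \<in> fst c"
  shows "linear (from_chart A c q)"
  unfolding from_chart_eq_local_rep[abs_def] using assms chart_at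
  by (intro linear_frechet_derivative differentiable_local_rep[OF smooth_map_ident]) auto

lemma inj_from_chart: "smooth_atlas A \<Longrightarrow> c \<in> A \<Longrightarrow> q \<in> fst c \<Longrightarrow> inj (from_chart A c q)"
  by (metis injI to_chart_from_chart_same)

lemma linear_to_chart:
  assumes "smooth_atlas A" "c \<in> A" "q \<in> fst c"
  shows "linear (to_chart A c q)"
  unfolding to_chart_eq_local_rep[abs_def] using assms chart_at[of A]
  by (intro linear_frechet_derivative differentiable_local_rep[OF smooth_map_ident]) auto

lemma linear_tangent_map:
  assumes "smooth_atlas A" "smooth_atlas B" "smooth_map A B F"
  shows "linear (tangent_map A B F q)"
  unfolding tangent_map_eq_local_rep[abs_def]
  using assms chart_at[OF assms(1)] chart_at[OF assms(2)] by (intro linear_frechet_derivative differentiable_local_rep) auto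

lemma tangent_map_from_chart:
  assumes A: "smooth_atlas A" and B: "smooth_atlas B" and F: "smooth_map A B F"
    and c: "c \<in> A" "q \<in> fst c" and d: "d \<in> B" "F q \<in> fst d"
  shows "tangent_map A B F q (from_chart A c q v)
    = from_chart B d (F q) (frechet_derivative (local_rep c d F) (at (snd c q)) v)"
  unfolding tangent_map_eq_local_rep from_chart_eq_local_rep
  using local_rep_chain[OF A A smooth_map_ident[OF A] F c chart_at[OF A] chart_at[OF B]]
    local_rep_chain[OF A B F smooth_map_ident[OF B] c d chart_at[OF B]] by simp

lemma tangent_map_comp:
  assumes A: "smooth_atlas A" and B: "smooth_atlas B" and C: "smooth_atlas C"
    and F: "smooth_map A B F" and H: "smooth_map B C H"
  shows "tangent_map A C (\<lambda>q. H (F q)) q v = tangent_map B C H (F q) (tangent_map A B F q v)"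
  unfolding tangent_map_eq_local_rep
  by (rule local_rep_chain[OF A B F H chart_at[OF A] chart_at[OF B] chart_at[OF C]])

lemma tangent_map_ident: "smooth_atlas A \<Longrightarrow> tangent_map A A (\<lambda>q. q) q v = v"
  by (simp add: tangent_map_eq_local_rep frechet_derivative_local_rep_ident chart_at)

text \<open>Smoothness of the metric and of \<open>\<phi>\<close> is formulated by what they do to
  smooth fields. Coordinate fields are the test fields that turn this into smoothness of
  components.\<close>

lemma smooth_field_on_from_chart:
  assumes A: "smooth_atlas A" and d: "d \<in> A"
  shows "smooth_field_on A (fst d) (\<lambda>q. from_chart A d q v)"
  unfolding smooth_field_on_def
proof
  fix c assume c: "c \<in> A"
  note id = smooth_map_ident[OF A]
  let ?S = "rep_domain c d (\<lambda>q. q)"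
  have S: "snd c ` (fst d \<inter> fst c) = ?S" by (auto simp: rep_domain_def)
  have "smooth_on ?S (\<lambda>x. frechet_derivative (local_rep d c (\<lambda>q. q)) (at (local_rep c d (\<lambda>q. q) x)) v)"
    by (rule smooth_on_compose[OF smooth_on_frechet_derivative[OF smooth_local_rep[OF id d c]]
          smooth_local_rep[OF id c d] open_rep_domain[OF A A id d c] open_rep_domain[OF A A id c d]])
      (auto simp: rep_domain_def local_rep_at[OF A c])
  then have "smooth_on ?S (\<lambda>x. to_chart A c (chart_inv c x) (from_chart A d (chart_inv c x) v))"
    by (rule smooth_on_cong[OF open_rep_domain[OF A A id c d], rotated])
      (auto simp: rep_domain_def local_rep_def smooth_atlasD(3)[OF A c] to_chart_from_chart[OF A d _ c])
  then show "smooth_on (snd c ` (fst d \<inter> fst c))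
      (\<lambda>x. to_chart A c (chart_inv c x) (from_chart A d (chart_inv c x) v))" by (simp add: S)
qed

section \<open>Metric coefficients and Christoffel symbols in a chart\<close>

lemma riemannian_metric_inner_product: "riemannian_metric B g \<Longrightarrow> inner_product (g p)"
  by (simp add: riemannian_metric_def)

lemma smooth_metric_in_chart:
  assumes B: "smooth_atlas B" and g: "riemannian_metric B g" and d: "d \<in> B"
  shows "smooth_on (snd d ` fst d) (\<lambda>y. metric_in_chart B g d y u v)"
proof -
  have "smooth_fun_on B (fst d) (\<lambda>q. g q (from_chart B d q u) (from_chart B d q v))"
    using g smooth_field_on_from_chart[OF B d] smooth_atlasD(1)[OF B d]
    unfolding riemannian_metric_def by blast
  then show ?thesis using d by (auto simp: smooth_fun_on_def metric_in_chart_def Let_def o_def)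
qed

lemma inner_product_metric_in_chart:
  assumes B: "smooth_atlas B" and g: "riemannian_metric B g" and d: "d \<in> B" and y: "y \<in> snd d ` fst d"
  shows "inner_product (metric_in_chart B g d y)"
  unfolding metric_in_chart_def[abs_def] Let_def
  using inner_product_pullback[OF riemannian_metric_inner_product[OF g]
      linear_from_chart[OF B d] inj_from_chart[OF B d]] smooth_atlasD(4)[OF B d y] by blast

lemma christoffel:
  fixes p :: "'m::{t2_space,second_countable_topology}"
    and B :: "('m, 'e::euclidean_space) chart set"
  assumes B: "smooth_atlas B" and g: "riemannian_metric B g"
  defines "d \<equiv> chart_at B p"
  shows "bilinear (christoffel B g p)" "christoffel B g p u v = christoffel B g p v u"
    and "((\<lambda>y. metric_in_chart B g d y v w) has_derivative
      (\<lambda>u. g p (christoffel B g p u v) w + g p v (christoffel B g p u w))) (at (snd d p))"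
proof -
  let ?m = "metric_in_chart B g d" and ?S = "snd d ` fst d"
  let ?T = "\<lambda>u v w. frechet_derivative (\<lambda>x. ?m x v w) (at (snd d p)) u"
  have d: "d \<in> B" "p \<in> fst d" using chart_at[OF B] by (auto simp: d_def)
  then have S: "open ?S" "snd d p \<in> ?S" using smooth_atlasD(2)[OF B] by auto
  have diff: "(\<lambda>x. ?m x v w) differentiable (at (snd d p))" for v w
    by (rule smooth_on_imp_differentiable[OF smooth_metric_in_chart[OF B g d(1)] S(2)])
  note ip = inner_product_metric_in_chart[OF B g d(1)]
  have "\<exists>!\<Gamma>. bilinear \<Gamma> \<and> (\<forall>u v. \<Gamma> u v = \<Gamma> v u) \<and> (\<forall>u v w. ?T u v w = g p (\<Gamma> u v) w + g p v (\<Gamma> u w))"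
  proof (rule koszul_unique_existence)
    show "inner_product (g p)" by (rule riemannian_metric_inner_product[OF g])
    show "linear (\<lambda>u. ?T u v w)" for v w by (rule linear_frechet_derivative[OF diff])
    show "linear (\<lambda>v. ?T u v w)" for u w
      by (rule linear_frechet_derivative_family[OF S inner_product_linear(2)[OF ip] diff])
    show "linear (?T u v)" for u v
      by (rule linear_frechet_derivative_family[OF S inner_product_linear(1)[OF ip] diff])
    show "?T u v w = ?T u w v" for u v w
      by (rule fun_cong[OF frechet_derivative_cong_open[OF S inner_product_commute[OF ip]]])
  qed
  from theI'[OF this] have P: "bilinear (christoffel B g p)" "\<And>u v. christoffel B g p u v = christoffel B g p v u"
    "\<And>u v w. ?T u v w = g p (christoffel B g p u v) w + g p v (christoffel B g p u w)"
    unfolding christoffel_def d_def by blast+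
  show "bilinear (christoffel B g p)" "christoffel B g p u v = christoffel B g p v u" using P by auto
  show "((\<lambda>y. ?m y v w) has_derivative
      (\<lambda>u. g p (christoffel B g p u v) w + g p v (christoffel B g p u w))) (at (snd d p))"
    using has_derivative_frechet[OF diff, of v w] by (simp add: P(3))
qed

lemma metric_in_chart_at:
  assumes "smooth_atlas B"
  shows "metric_in_chart B g (chart_at B p) (snd (chart_at B p) p) u v = g p u v"
  by (simp add: metric_in_chart_def smooth_atlasD(3)[OF assms chart_at[OF assms]] from_chart_chart_at[OF assms])

section \<open>The second fundamental form in a chart\<close>

text \<open>The rule for linear families, applied to one slot after the other.\<close>

lemma has_derivative_bilinear_family:
  fixes M :: "'c::real_normed_vector \<Rightarrow> 'd::euclidean_space \<Rightarrow> 'e::euclidean_space \<Rightarrow> 'f::real_normed_vector"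
  assumes S: "open S" "x0 \<in> S" and M: "\<And>x. x \<in> S \<Longrightarrow> bilinear (M x)"
    and D: "\<And>u v. ((\<lambda>x. M x u v) has_derivative (\<lambda>w. D w u v)) (at x0)"
    and U: "(U has_derivative U') (at x0)" and V: "(V has_derivative V') (at x0)"
  shows "((\<lambda>x. M x (U x) (V x)) has_derivative
    (\<lambda>w. D w (U x0) (V x0) + M x0 (U x0) (V' w) + M x0 (U' w) (V x0))) (at x0)"
proof (rule has_derivative_linear_family[OF S _ _ U,
      where D = "\<lambda>w u. D w u (V x0) + M x0 u (V' w)" and N = "\<lambda>x u. M x u (V x)"])
  show "linear (\<lambda>u. M x u (V x))" if "x \<in> S" for x using M[OF that] by (simp add: bilinear_def)
  show "((\<lambda>x. M x u (V x)) has_derivative (\<lambda>w. D w u (V x0) + M x0 u (V' w))) (at x0)" for u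
    by (rule has_derivative_linear_family[OF S _ D V]) (use M in \<open>simp add: bilinear_def\<close>)
qed

lemma second_derivative_cong_open:
  assumes "open S" "x \<in> S" "\<And>y. y \<in> S \<Longrightarrow> f y = g y"
  shows "second_derivative f x u v = second_derivative g x u v"
  unfolding second_derivative_def
  by (rule fun_cong[OF frechet_derivative_cong_open[OF assms(1,2)]],
      rule fun_cong[OF frechet_derivative_cong_open[OF assms(1) _ assms(3)]])

text \<open>The ambient covariant derivative of the coordinate fields of a chart \<open>c\<close> of the submanifold.\<close>

definition ambient_hessian ::
    "('a::topological_space, 'd::euclidean_space) chart set \<Rightarrow> ('m::topological_space, 'e::euclidean_space) chart set \<Rightarrow>
     ('m \<Rightarrow> 'e \<Rightarrow> 'e \<Rightarrow> real) \<Rightarrow> ('a \<Rightarrow> 'm) \<Rightarrow> ('a, 'd) chart \<Rightarrow> 'a \<Rightarrow> 'd \<Rightarrow> 'd \<Rightarrow> 'e" where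
  "ambient_hessian A B g F c p u v =
     second_derivative (local_rep c (chart_at B (F p)) F) (snd c p) u v
     + christoffel B g (F p) (tangent_map A B F p (from_chart A c p u)) (tangent_map A B F p (from_chart A c p v))"

locale immersed =
  fixes A :: "('a::{t2_space,second_countable_topology}, 'd::euclidean_space) chart set"
    and B :: "('m::{t2_space,second_countable_topology}, 'e::euclidean_space) chart set"
    and g :: "'m \<Rightarrow> 'e \<Rightarrow> 'e \<Rightarrow> real" and F :: "'a \<Rightarrow> 'm"
  assumes A: "smooth_atlas A" and B: "smooth_atlas B" and g: "riemannian_metric B g"
    and immersion: "immersion A B F"
begin

abbreviation "T \<equiv> tangent_map A B F"
abbreviation "G \<equiv> induced_metric A B g F"
abbreviation "hess \<equiv> ambient_hessian A B g F"

lemma smooth: "smooth_map A B F" and inj_T: "inj (T p)"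
  using immersion by (auto simp: immersion_def)

lemma linear_T: "linear (T p)" by (rule linear_tangent_map[OF A B smooth])

lemmas T_simps = linear_add[OF linear_T] linear_diff[OF linear_T] linear_cmul[OF linear_T]
  linear_0[OF linear_T] linear_neg[OF linear_T]

lemma ip: "inner_product (g x)" by (rule riemannian_metric_inner_product[OF g])

lemmas g_simps = inner_product_simps[OF ip]

lemma induced_metric_eq: "G p u v = g (F p) (T p u) (T p v)" by (simp add: induced_metric_def)

lemma ip_induced: "inner_product (G p)"
  unfolding induced_metric_def[abs_def] by (rule inner_product_pullback[OF ip linear_T inj_T])

text \<open>The tangential part is the Riesz representative, with respect to the induced metric, of
  pairing \<open>w\<close> with tangent vectors.\<close>

lemma tangential_part_ex1: "\<exists>!u. \<forall>v. g (F p) (w - T p u) (T p v) = 0"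
proof -
  have "linear (\<lambda>v. g (F p) w (T p v))"
    using linear_compose[OF linear_T inner_product_linear(1)[OF ip]] by (simp add: o_def)
  then obtain u where u: "\<And>v. G p u v = g (F p) w (T p v)"
    using inner_product_riesz[OF ip_induced] by blast
  show ?thesis
  proof (rule ex1I[of _ u])
    show "\<forall>v. g (F p) (w - T p u) (T p v) = 0" using u by (simp add: g_simps induced_metric_eq)
    fix u' assume "\<forall>v. g (F p) (w - T p u') (T p v) = 0"
    then show "u' = u"
      using u by (intro inner_product_eqI[OF ip_induced[of p]]) (simp add: g_simps induced_metric_eq)
  qed
qed

lemma tangential_part_orth: "g (F p) (w - T p (tangential_part A B g F p w)) (T p v) = 0"
  using theI'[OF tangential_part_ex1[of p w]] unfolding tangential_part_def by blast

lemma tangential_part_eqI: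
  assumes "\<And>v. g (F p) (w - T p u) (T p v) = 0"
  shows "tangential_part A B g F p w = u"
  using tangential_part_ex1[of p w] tangential_part_orth[of p w] assms by blast

lemma tangential_part_T: "tangential_part A B g F p (T p u) = u"
  by (rule tangential_part_eqI) (simp add: g_simps)

lemma normal_part_orth: "g (F p) (normal_part A B g F p w) (T p v) = 0"
  by (simp add: normal_part_def tangential_part_orth)

lemma normal_part_eqI:
  assumes "\<And>v. g (F p) n (T p v) = 0" "w = T p u + n"
  shows "normal_part A B g F p w = n"
proof -
  have "tangential_part A B g F p w = u"
    by (rule tangential_part_eqI) (simp add: assms)
  then show ?thesis by (simp add: normal_part_def assms(2))
qed

lemma normal_part_T: "normal_part A B g F p (T p u) = 0"
  by (simp add: normal_part_def tangential_part_T)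

lemma normal_part_decomp: "w = T p (tangential_part A B g F p w) + normal_part A B g F p w"
  by (simp add: normal_part_def)

lemma linear_normal_part: "linear (normal_part A B g F p)"
proof (rule linearI)
  fix w z r
  let ?t = "tangential_part A B g F p" and ?n = "normal_part A B g F p"
  show "?n (w + z) = ?n w + ?n z"
    by (rule normal_part_eqI[where u = "?t w + ?t z"])
      (simp add: g_simps normal_part_orth, simp add: T_simps normal_part_def)
  show "?n (r *\<^sub>R w) = r *\<^sub>R ?n w"
    by (rule normal_part_eqI[where u = "r *\<^sub>R ?t w"])
      (simp add: g_simps normal_part_orth, simp add: T_simps normal_part_def scaleR_diff_right)
qed

context
  fixes c :: "('a, 'd) chart" and p :: 'a
  assumes c: "c \<in> A" "p \<in> fst c"
begin

abbreviation (input) "\<Psi> \<equiv> local_rep c (chart_at B (F p)) F"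
abbreviation (input) "\<Omega> \<equiv> rep_domain c (chart_at B (F p)) F"
abbreviation (input) "e \<equiv> from_chart A c p"

lemma open_\<Omega>: "open \<Omega>" by (rule open_rep_domain[OF A B smooth c(1) chart_at(1)[OF B]])

lemma mem_\<Omega>: "snd c p \<in> \<Omega>" by (rule rep_domain_memI[of p c F, OF c(2) chart_at(2)[OF B]])

lemma \<Omega>_D:
  assumes "x \<in> \<Omega>"
  shows "chart_inv c x \<in> fst c" "F (chart_inv c x) \<in> fst (chart_at B (F p))" "snd c (chart_inv c x) = x"
    "x \<in> snd c ` fst c"
  using assms smooth_atlasD(3)[OF A c(1)] by (auto simp: rep_domain_def)

lemma smooth_\<Psi>: "smooth_on \<Omega> \<Psi>" by (rule smooth_local_rep[OF smooth c(1) chart_at(1)[OF B]])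

lemma T_from_chart:
  assumes "x \<in> \<Omega>"
  shows "T (chart_inv c x) (from_chart A c (chart_inv c x) u)
    = from_chart B (chart_at B (F p)) (F (chart_inv c x)) (frechet_derivative \<Psi> (at x) u)"
  using tangent_map_from_chart[OF A B smooth c(1) \<Omega>_D(1)[OF assms] chart_at(1)[OF B] \<Omega>_D(2)[OF assms]]
  by (simp add: \<Omega>_D(3)[OF assms])

lemma T_e: "frechet_derivative \<Psi> (at (snd c p)) u = T p (e u)"
  using T_from_chart[OF mem_\<Omega>] by (simp add: smooth_atlasD(3)[OF A c] from_chart_chart_at[OF B])

lemma has_derivative_\<Psi>: "(\<Psi> has_derivative (\<lambda>u. T p (e u))) (at (snd c p))"
  using has_derivative_frechet[OF smooth_on_imp_differentiable[OF smooth_\<Psi> mem_\<Omega>]] by (simp add: T_e)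

text \<open>Torsion-freeness for commuting coordinate fields: Schwarz's theorem for the first
  summand, symmetry of the Christoffel symbols for the second.\<close>

lemma hess_sym: "hess c p u v = hess c p v u"
  unfolding ambient_hessian_def
  using second_derivative_symmetric[OF smooth_\<Psi> open_\<Omega> mem_\<Omega>] christoffel(2)[OF B g] by metis

lemma linear_e: "linear e" by (rule linear_from_chart[OF A c])

lemma bilinear_hess: "bilinear (hess c p)"
proof -
  note D = bilinear_second_derivative[OF smooth_\<Psi> open_\<Omega> mem_\<Omega>] and C = christoffel(1)[OF B g, of "F p"]
  show ?thesis
    unfolding bilinear_def ambient_hessian_def
    by (intro conjI allI linearI)
      (simp_all add: linear_add[OF linear_e] linear_cmul[OF linear_e] T_simps algebra_simps
        bilinear_ladd[OF D] bilinear_radd[OF D] bilinear_lmul[OF D] bilinear_rmul[OF D]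
        bilinear_ladd[OF C] bilinear_radd[OF C] bilinear_lmul[OF C] bilinear_rmul[OF C])
qed

lemma induced_metric_in_chart:
  assumes "x \<in> \<Omega>"
  shows "metric_in_chart A G c x u v = metric_in_chart B g (chart_at B (F p)) (\<Psi> x)
    (frechet_derivative \<Psi> (at x) u) (frechet_derivative \<Psi> (at x) v)"
  using smooth_atlasD(3)[OF B chart_at(1)[OF B] \<Omega>_D(2)[OF assms]] T_from_chart[OF assms]
  by (simp add: metric_in_chart_def Let_def induced_metric_eq local_rep_def[of c _ F])

lemma has_derivative_ambient_metric_\<Psi>:
  "((\<lambda>x. metric_in_chart B g (chart_at B (F p)) (\<Psi> x) u v) has_derivative
    (\<lambda>w. g (F p) (christoffel B g (F p) (T p (e w)) u) v + g (F p) u (christoffel B g (F p) (T p (e w)) v)))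
    (at (snd c p))"
proof -
  have "snd (chart_at B (F p)) (F p) = \<Psi> (snd c p)" using local_rep_at[OF A c] by metis
  then show ?thesis
    by (intro has_derivative_compose[OF has_derivative_\<Psi>])
      (use christoffel(3)[OF B g, where p = "F p" and v = u and w = v] in simp)
qed

lemma bilinear_ambient_metric_\<Psi>:
  assumes "x \<in> \<Omega>"
  shows "bilinear (metric_in_chart B g (chart_at B (F p)) (\<Psi> x))"
proof -
  have "\<Psi> x \<in> snd (chart_at B (F p)) ` fst (chart_at B (F p))"
    using \<Omega>_D[OF assms] by (auto simp: local_rep_def)
  then show ?thesis
    using inner_product_metric_in_chart[OF B g chart_at(1)[OF B]] by (simp add: inner_product_def)
qed

lemma ambient_metric_at: "metric_in_chart B g (chart_at B (F p)) (\<Psi> (snd c p)) u v = g (F p) u v"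
  using metric_in_chart_at[OF B, of g "F p"] by (simp add: local_rep_at[OF A c])

text \<open>Metric compatibility of the ambient connection along the immersion: in each slot the
  second derivative of the representation and the Christoffel term add up to one Hessian.\<close>

lemma has_derivative_induced_metric:
  "((\<lambda>x. metric_in_chart A G c x u v) has_derivative
    (\<lambda>w. g (F p) (hess c p w u) (T p (e v)) + g (F p) (T p (e u)) (hess c p w v))) (at (snd c p))"
proof -
  have "((\<lambda>x. metric_in_chart B g (chart_at B (F p)) (\<Psi> x) (frechet_derivative \<Psi> (at x) u)
      (frechet_derivative \<Psi> (at x) v)) has_derivative
    (\<lambda>w. g (F p) (hess c p w u) (T p (e v)) + g (F p) (T p (e u)) (hess c p w v))) (at (snd c p))"
    by (rule has_derivative_eq_rhs[OF has_derivative_bilinear_family[OF open_\<Omega> mem_\<Omega> bilinear_ambient_metric_\<Psi>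
          has_derivative_ambient_metric_\<Psi> has_derivative_second_derivative[OF smooth_\<Psi> mem_\<Omega>]
          has_derivative_second_derivative[OF smooth_\<Psi> mem_\<Omega>]]])
      (auto simp: fun_eq_iff T_e ambient_metric_at ambient_hessian_def g_simps)
  then show ?thesis
    by (rule has_derivative_transform_within_open[OF _ open_\<Omega> mem_\<Omega>]) (simp add: induced_metric_in_chart)
qed

text \<open>The tangential part of the Hessian is thus read off from first derivatives
  \<open>D\<close> of the induced metric coefficients; no Levi-Civita connection of the submanifold
  is constructed.\<close>

lemma koszul:
  assumes "\<And>u v. ((\<lambda>x. metric_in_chart A G c x u v) has_derivative (\<lambda>w. D w u v)) (at (snd c p))"
  shows "2 * g (F p) (hess c p u v) (T p (e w)) = D u v w + D v u w - D w u v"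
proof (rule koszul_formula[where T = D])
  show "g (F p) (hess c p u v) (T p (e w)) = g (F p) (hess c p v u) (T p (e w))" for u v w
    by (simp add: hess_sym)
  show "D u v w = g (F p) (hess c p u v) (T p (e w)) + g (F p) (hess c p u w) (T p (e v))" for u v w
    using fun_cong[OF has_derivative_unique[OF assms[of v w] has_derivative_induced_metric], of u]
      inner_product_commute[OF ip, of _ "T p (e v)"] by simp
qed

text \<open>The transition map is not affine, and its second derivative enters only after the
  derivative of the immersion has been applied to it. The discrepancy is therefore tangent.\<close>

lemma hess_chart_change:
  assumes c': "c' \<in> A" "p \<in> fst c'"
  defines "\<sigma> \<equiv> frechet_derivative (local_rep c c' (\<lambda>q. q)) (at (snd c p))"
  shows "\<exists>s. hess c p u v = hess c' p (\<sigma> u) (\<sigma> v) + T p s"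
proof -
  let ?d = "chart_at B (F p)"
  \<comment> \<open>On this set the transition map and both representations of \<open>F\<close> are
    defined.\<close>
  let ?W = "snd c ` (fst c \<inter> (fst c' \<inter> F -` fst ?d))"
  note id = smooth_map_ident[OF A]
  have W: "open ?W"
    by (intro open_chart_image[OF A c(1)] open_Int smooth_atlasD(1)[OF A c'(1)]
        open_vimage_chart[OF B smooth chart_at(1)[OF B]])
  have pW: "snd c p \<in> ?W" using c c' chart_at(2)[OF B] by auto
  have sub: "?W \<subseteq> rep_domain c c' (\<lambda>q. q)" by (auto simp: rep_domain_def)
  have "second_derivative \<Psi> (snd c p) u v
      = second_derivative (\<lambda>x. local_rep c' ?d F (local_rep c c' (\<lambda>q. q) x)) (snd c p) u v"
    by (rule second_derivative_cong_open[OF W pW], rule local_rep_comp[OF A A c(1) c'(1)])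
      (use sub in auto)
  also have "\<dots> = second_derivative (local_rep c' ?d F) (local_rep c c' (\<lambda>q. q) (snd c p)) (\<sigma> u) (\<sigma> v)
      + frechet_derivative (local_rep c' ?d F) (at (local_rep c c' (\<lambda>q. q) (snd c p)))
          (second_derivative (local_rep c c' (\<lambda>q. q)) (snd c p) u v)"
    unfolding \<sigma>_def
    by (rule second_derivative_compose[OF smooth_local_rep[OF smooth c'(1) chart_at(1)[OF B]]
          smooth_on_subset[OF smooth_local_rep[OF id c(1) c'(1)] sub]
          open_rep_domain[OF A B smooth c'(1) chart_at(1)[OF B]] W pW])
      (use smooth_atlasD(3)[OF A c(1)] in \<open>auto simp: rep_domain_def local_rep_def\<close>)
  finally have 1: "second_derivative \<Psi> (snd c p) u v
      = second_derivative (local_rep c' ?d F) (snd c' p) (\<sigma> u) (\<sigma> v)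
        + T p (from_chart A c' p (second_derivative (local_rep c c' (\<lambda>q. q)) (snd c p) u v))"
    using tangent_map_from_chart[OF A B smooth c' chart_at[OF B]]
    by (simp add: local_rep_at[OF A c] from_chart_chart_at[OF B])
  have "from_chart A c' p (\<sigma> w) = e w" for w
    unfolding \<sigma>_def using to_chart_from_chart[OF A c c', of w] from_chart_to_chart[OF A c', of "e w"] by simp
  with 1 show ?thesis unfolding ambient_hessian_def by (intro exI) auto
qed

end

text \<open>The pushed-forward field with constant components \<open>v\<close> has, in the ambient
  chart, the derivative of the representation in direction \<open>v\<close> as its components;
  differentiating it once more gives the Hessian.\<close>

lemma second_ff_eq_chart_at: "second_ff A B g F p u v = normal_part A B g F p (hess (chart_at A p) p u v)"
proof -
  note c = chart_at[OF A, of p]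
  let ?c = "chart_at A p" and ?d = "chart_at B (F p)"
  have "frechet_derivative (\<lambda>x. let q = chart_inv ?c x in to_chart B ?d (F q) (T q (from_chart A ?c q v)))
      (at (snd ?c p)) = frechet_derivative (\<lambda>x. frechet_derivative (local_rep ?c ?d F) (at x) v) (at (snd ?c p))"
    by (rule frechet_derivative_cong_open[OF open_\<Omega>[OF c] mem_\<Omega>[OF c]])
      (simp add: Let_def T_from_chart[OF c] to_chart_from_chart_same[OF B chart_at(1)[OF B] \<Omega>_D(2)[OF c]])
  then show ?thesis
    by (simp add: second_ff_def cov_deriv_along_def ambient_hessian_def second_derivative_def from_chart_chart_at[OF A])
qed

text \<open>Frees h from the chart chosen by \<open>chart_at\<close>, so that it can be evaluated in
  product charts built from charts of the factors.\<close>

lemma second_ff_from_chart: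
  assumes c: "c \<in> A" "p \<in> fst c"
  shows "second_ff A B g F p (from_chart A c p u) (from_chart A c p v) = normal_part A B g F p (hess c p u v)"
proof -
  obtain s where s: "hess c p u v = hess (chart_at A p) p (from_chart A c p u) (from_chart A c p v) + T p s"
    using hess_chart_change[OF c chart_at[OF A]] unfolding from_chart_eq_local_rep by blast
  then show ?thesis
    by (simp add: second_ff_eq_chart_at linear_add[OF linear_normal_part] normal_part_T)
qed

lemma bilinear_second_ff: "bilinear (second_ff A B g F p)"
  using bilinear_hess[OF chart_at[OF A]] linear_normal_part[of p]
  unfolding bilinear_def second_ff_eq_chart_at[abs_def]
  by (auto intro: linear_compose[unfolded o_def])

lemma second_ff_norm_sq_nonneg: "second_ff_norm_sq A B g F p \<ge> 0"
  by (simp add: second_ff_norm_sq_def Let_def sum_nonneg inner_product_nonneg[OF ip])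

text \<open>All summands are nonnegative, so h vanishes on the chosen basis, and bilinearity extends
  this to all vectors.\<close>

lemma second_ff_norm_sq_eq_0:
  assumes "second_ff_norm_sq A B g F p = 0"
  shows "second_ff A B g F p u v = 0"
proof -
  define E where "E = (SOME E. orthonormal_basis (G p) E)"
  let ?h = "second_ff A B g F p"
  have "orthonormal_basis (G p) E"
    unfolding E_def by (rule someI_ex[OF orthonormal_basis_exists[OF ip_induced]])
  then have E: "finite E" "span E = UNIV" by (auto simp: orthonormal_basis_def)
  have nn: "g (F p) x x \<ge> 0" for x by (rule inner_product_nonneg[OF ip])
  have "(\<Sum>u\<in>E. \<Sum>v\<in>E. g (F p) (?h u v) (?h u v)) = 0"
    using assms by (simp add: second_ff_norm_sq_def Let_def E_def)
  then have h0: "?h u v = 0" if "u \<in> E" "v \<in> E" for u v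
    using that E(1) nn by (simp add: sum_nonneg_eq_0_iff sum_nonneg inner_product_eq_0[OF ip])
  show ?thesis
    by (rule bilinear_eq[OF bilinear_second_ff, where g = "\<lambda>u v. 0" and B = E and C = E and S = UNIV and T = UNIV])
      (simp_all add: E h0 bilinear_def linear_zero)
qed

end

section \<open>The Kenmotsu structure along an immersion\<close>

lemma kenmotsu_phi_derivative:
  fixes B :: "('m::{t2_space,second_countable_topology}, 'e::euclidean_space) chart set"
  assumes K: "kenmotsu_manifold B \<phi> \<xi> \<eta> g"
  defines "d \<equiv> \<lambda>y. chart_at B y"
  shows "((\<lambda>x. let q = chart_inv (d y) x in to_chart B (d y) q (\<phi> q (from_chart B (d y) q u))) has_derivative
    (\<lambda>w. \<phi> y (christoffel B g y w u) - christoffel B g y w (\<phi> y u)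
      + g y (\<phi> y w) u *\<^sub>R \<xi> y - \<eta> y u *\<^sub>R \<phi> y w)) (at (snd (d y) y))"
proof -
  let ?d = "chart_at B y" and ?\<Gamma> = "christoffel B g y"
  let ?Y = "\<lambda>q. from_chart B ?d q u"
  let ?f = "\<lambda>x. let q = chart_inv ?d x in to_chart B ?d q (\<phi> q (?Y q))"
  have B: "smooth_atlas B" using K by (simp add: kenmotsu_manifold_def)
  note dy = chart_at[OF B, of y]
  note Y = smooth_field_on_from_chart[OF B dy(1), of u] and open_d = smooth_atlasD(1)[OF B dy(1)]
  have K1: "\<forall>U X. open U \<and> smooth_field_on B U X \<longrightarrow> smooth_field_on B U (\<lambda>p. \<phi> p (X p))"
    and K2: "\<forall>U Y. open U \<and> smooth_field_on B U Y \<longrightarrow>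
        (\<forall>p\<in>U. \<forall>X. cov_deriv B g (\<lambda>q. \<phi> q (Y q)) p X - \<phi> p (cov_deriv B g Y p X)
                    = g p (\<phi> p X) (Y p) *\<^sub>R \<xi> p - \<eta> p (Y p) *\<^sub>R \<phi> p X)"
    using K by (simp_all add: kenmotsu_manifold_def)
  have "smooth_field_on B (fst ?d) (\<lambda>q. \<phi> q (?Y q))"
    using K1[rule_format, of "fst ?d" ?Y] Y open_d by simp
  from this[unfolded smooth_field_on_def, rule_format, OF dy(1)]
  have "smooth_on (snd ?d ` fst ?d) ?f" by (simp add: Let_def)
  then have diff: "?f differentiable (at (snd ?d y))"
    using dy(2) smooth_on_imp_differentiable by blast
  have c1: "cov_deriv B g (\<lambda>q. \<phi> q (?Y q)) y w = frechet_derivative ?f (at (snd ?d y)) w + ?\<Gamma> w (\<phi> y u)" for w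
    by (simp add: cov_deriv_def cov_deriv_along_def tangent_map_ident[OF B] from_chart_chart_at[OF B])
  \<comment> \<open>\<open>?Y\<close> has the constant components \<open>u\<close> in
    \<open>?d\<close>, so its coordinate derivative is zero and its covariant derivative is the
    Christoffel term alone.\<close>
  have "frechet_derivative (\<lambda>x. let q = chart_inv ?d x in to_chart B ?d q (?Y q)) (at (snd ?d y))
      = frechet_derivative (\<lambda>x. u) (at (snd ?d y))"
    by (rule frechet_derivative_cong_open[OF smooth_atlasD(2)[OF B dy(1)]])
      (use dy in \<open>auto simp: to_chart_from_chart_same[OF B dy(1)] smooth_atlasD(3)[OF B dy(1)]\<close>)
  then have c2: "cov_deriv B g ?Y y w = ?\<Gamma> w u" for w
    by (simp add: cov_deriv_def cov_deriv_along_def tangent_map_ident[OF B] from_chart_chart_at[OF B])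
  have "cov_deriv B g (\<lambda>q. \<phi> q (?Y q)) y w - \<phi> y (cov_deriv B g ?Y y w)
      = g y (\<phi> y w) (?Y y) *\<^sub>R \<xi> y - \<eta> y (?Y y) *\<^sub>R \<phi> y w" for w
    using K2[rule_format, of "fst ?d" ?Y y w] Y open_d dy(2) by simp
  \<comment> \<open>The structure equation for \<open>\<phi>\<close>, solved for the coordinate
    derivative of its components.\<close>
  then have "frechet_derivative ?f (at (snd ?d y)) w = \<phi> y (?\<Gamma> w u) - ?\<Gamma> w (\<phi> y u)
      + g y (\<phi> y w) u *\<^sub>R \<xi> y - \<eta> y u *\<^sub>R \<phi> y w" for w
    by (simp add: c1 c2 from_chart_chart_at[OF B] algebra_simps)
  then show ?thesis using has_derivative_frechet[OF diff] by (simp add: d_def)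
qed

locale immersed_kenmotsu = immersed A B g F
  for A :: "('a::{t2_space,second_countable_topology}, 'd::euclidean_space) chart set"
    and B :: "('m::{t2_space,second_countable_topology}, 'e::euclidean_space) chart set"
    and g F +
  fixes \<phi> :: "'m \<Rightarrow> 'e \<Rightarrow> 'e" and \<xi> :: "'m \<Rightarrow> 'e" and \<eta> :: "'m \<Rightarrow> 'e \<Rightarrow> real"
  assumes kenmotsu: "kenmotsu_manifold B \<phi> \<xi> \<eta> g"
begin

lemma linear_\<phi>: "linear (\<phi> x)" and \<eta>_eq: "\<eta> x u = g x u (\<xi> x)" and \<phi>_\<xi>: "\<phi> x (\<xi> x) = 0"
  and \<eta>_\<phi>: "\<eta> x (\<phi> x u) = 0" and \<eta>_\<xi>: "\<eta> x (\<xi> x) = 1"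
  and \<phi>_\<phi>: "\<phi> x (\<phi> x u) = - u + \<eta> x u *\<^sub>R \<xi> x"
  and g_\<phi>_\<phi>: "g x (\<phi> x u) (\<phi> x v) = g x u v - \<eta> x u * \<eta> x v"
proof -
  have "(\<forall>p. linear (\<phi> p)) \<and> (\<forall>p X. \<eta> p X = g p X (\<xi> p)) \<and> (\<forall>p. \<phi> p (\<xi> p) = 0) \<and> (\<forall>p X. \<eta> p (\<phi> p X) = 0)
    \<and> (\<forall>p. \<eta> p (\<xi> p) = 1) \<and> (\<forall>p X. \<phi> p (\<phi> p X) = - X + \<eta> p X *\<^sub>R \<xi> p)
    \<and> (\<forall>p X Y. g p (\<phi> p X) (\<phi> p Y) = g p X Y - \<eta> p X * \<eta> p Y)"
    using kenmotsu unfolding kenmotsu_manifold_def by (elim conjE) (intro conjI; assumption)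
  then show "linear (\<phi> x)" "\<eta> x u = g x u (\<xi> x)" "\<phi> x (\<xi> x) = 0" "\<eta> x (\<phi> x u) = 0" "\<eta> x (\<xi> x) = 1"
    "\<phi> x (\<phi> x u) = - u + \<eta> x u *\<^sub>R \<xi> x" "g x (\<phi> x u) (\<phi> x v) = g x u v - \<eta> x u * \<eta> x v"
    by blast+
qed

text \<open>Up to a multiple of \<xi>, \<open>v\<close> is minus the double image under
  \<open>\<phi>\<close>; that multiple pairs to zero with an image of \<open>\<phi>\<close>, and the
  compatibility of \<open>\<phi>\<close> with the metric then strips one \<open>\<phi>\<close> from
  both sides.\<close>

lemma g_\<phi>_skew: "g x (\<phi> x u) v = - g x (\<phi> x v) u"
proof -
  have "g x (\<phi> x u) v = - g x (\<phi> x u) (\<phi> x (\<phi> x v))"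
    by (simp add: \<phi>_\<phi> g_simps \<eta>_eq[symmetric] \<eta>_\<phi>)
  also have "\<dots> = - g x u (\<phi> x v)" by (simp add: g_\<phi>_\<phi> \<eta>_\<phi>)
  finally show ?thesis by (simp add: inner_product_commute[OF ip])
qed

text \<open>Leibniz rule for the form \<omega> on two coordinate fields. The first two terms
  differentiate the fields; the last two are the Kenmotsu formula for the derivative of
  \<open>\<phi>\<close>, paired with the second field.\<close>

lemma has_derivative_fundamental_form:
  assumes c: "c \<in> A" "p \<in> fst c"
  defines "b \<equiv> from_chart A c p"
  shows "((\<lambda>x. let q = chart_inv c x in
      g (F q) (\<phi> (F q) (T q (from_chart A c q u))) (T q (from_chart A c q v))) has_derivative
    (\<lambda>w. g (F p) (\<phi> (F p) (hess c p w u)) (T p (b v)) + g (F p) (\<phi> (F p) (T p (b u))) (hess c p w v)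
       + g (F p) (\<phi> (F p) (T p (b w))) (T p (b u)) * \<eta> (F p) (T p (b v))
       - \<eta> (F p) (T p (b u)) * g (F p) (\<phi> (F p) (T p (b w))) (T p (b v)))) (at (snd c p))"
proof -
  let ?d = "chart_at B (F p)" let ?\<Psi> = "local_rep c ?d F" and ?\<Gamma> = "christoffel B g (F p)"
  let ?\<Phi> = "\<lambda>x u. let q = chart_inv ?d x in to_chart B ?d q (\<phi> q (from_chart B ?d q u))"
  let ?m = "metric_in_chart B g ?d"
  have \<Psi>p: "?\<Psi> (snd c p) = snd ?d (F p)" by (rule local_rep_at[OF A c])
  have q: "chart_inv ?d (?\<Psi> x) = F (chart_inv c x)" if "x \<in> rep_domain c ?d F" for x
    using smooth_atlasD(3)[OF B chart_at(1)[OF B] \<Omega>_D(2)[OF c that]] by (simp add: local_rep_def)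
  have lin: "linear (?\<Phi> (?\<Psi> x))" if "x \<in> rep_domain c ?d F" for x
    unfolding Let_def q[OF that]
    using linear_compose[OF linear_compose[OF linear_from_chart linear_\<phi>] linear_to_chart, unfolded o_def]
      \<Omega>_D(2)[OF c that] B chart_at(1)[OF B] by blast
  note frd = has_derivative_second_derivative[OF smooth_\<Psi>[OF c] mem_\<Omega>[OF c]]
  have "((\<lambda>x. ?\<Phi> (?\<Psi> x) u) has_derivative (\<lambda>w. \<phi> (F p) (?\<Gamma> (T p (b w)) u) - ?\<Gamma> (T p (b w)) (\<phi> (F p) u)
      + g (F p) (\<phi> (F p) (T p (b w))) u *\<^sub>R \<xi> (F p) - \<eta> (F p) u *\<^sub>R \<phi> (F p) (T p (b w)))) (at (snd c p))" for u
    using has_derivative_compose[OF has_derivative_\<Psi>[OF c], of "\<lambda>y. ?\<Phi> y u"]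
      kenmotsu_phi_derivative[OF kenmotsu, of "F p" u] unfolding \<Psi>p b_def by blast
  note d\<Phi> = has_derivative_linear_family[OF open_\<Omega>[OF c] mem_\<Omega>[OF c] lin this frd]
  have \<Phi>p: "?\<Phi> (?\<Psi> (snd c p)) w = \<phi> (F p) w" for w
    using q[OF mem_\<Omega>[OF c]]
    by (simp add: Let_def smooth_atlasD(3)[OF A c] to_chart_chart_at[OF B] from_chart_chart_at[OF B])
  have "((\<lambda>x. ?m (?\<Psi> x) (?\<Phi> (?\<Psi> x) (frechet_derivative ?\<Psi> (at x) u)) (frechet_derivative ?\<Psi> (at x) v))
      has_derivative
    (\<lambda>w. g (F p) (\<phi> (F p) (hess c p w u)) (T p (b v)) + g (F p) (\<phi> (F p) (T p (b u))) (hess c p w v)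
       + g (F p) (\<phi> (F p) (T p (b w))) (T p (b u)) * \<eta> (F p) (T p (b v))
       - \<eta> (F p) (T p (b u)) * g (F p) (\<phi> (F p) (T p (b w))) (T p (b v)))) (at (snd c p))"
    \<comment> \<open>The Christoffel term at \<open>\<phi> u\<close> from the metric cancels the
      one from the components of \<open>\<phi>\<close>; the other two complete the second
      derivatives to Hessians.\<close>
    by (rule has_derivative_eq_rhs[OF has_derivative_bilinear_family[OF open_\<Omega>[OF c] mem_\<Omega>[OF c]
          bilinear_ambient_metric_\<Psi>[OF c] has_derivative_ambient_metric_\<Psi>[OF c] d\<Phi> frd]])
      (auto simp: fun_eq_iff \<Phi>p T_e[OF c] ambient_metric_at[OF c] ambient_hessian_def g_simps b_def
        linear_add[OF linear_\<phi>] \<eta>_eq inner_product_commute[OF ip, of _ "\<xi> _"])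
  then show ?thesis
  proof (rule has_derivative_transform_within_open[OF _ open_\<Omega>[OF c] mem_\<Omega>[OF c]])
    fix x assume x: "x \<in> rep_domain c ?d F"
    show "?m (?\<Psi> x) (?\<Phi> (?\<Psi> x) (frechet_derivative ?\<Psi> (at x) u)) (frechet_derivative ?\<Psi> (at x) v)
      = (let q = chart_inv c x in g (F q) (\<phi> (F q) (T q (from_chart A c q u))) (T q (from_chart A c q v)))"
      using from_chart_to_chart[OF B chart_at(1)[OF B] \<Omega>_D(2)[OF c x]]
      by (simp add: metric_in_chart_def Let_def q[OF x] T_from_chart[OF c x])
  qed
qed

end

section \<open>Product manifolds\<close>

definition prod_chart :: "('a, 'd) chart \<Rightarrow> ('b, 'e) chart \<Rightarrow> ('a \<times> 'b, 'd \<times> 'e) chart" where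
  "prod_chart c d = (fst c \<times> fst d, map_prod (snd c) (snd d))"

lemma prod_atlas_eq: "prod_atlas A B = {prod_chart c d | c d. c \<in> A \<and> d \<in> B}"
  by (simp add: prod_atlas_def prod_chart_def)

lemma prod_chart_in_atlas: "c \<in> A \<Longrightarrow> d \<in> B \<Longrightarrow> prod_chart c d \<in> prod_atlas A B"
  unfolding prod_atlas_eq by blast

lemma prod_chart_simps [simp]:
  "fst (prod_chart c d) = fst c \<times> fst d" "snd (prod_chart c d) x = (snd c (fst x), snd d (snd x))"
  by (simp_all add: prod_chart_def map_prod_def split_beta)

lemma prod_chart_image: "snd (prod_chart c d) ` (S \<times> T) = (snd c ` S) \<times> (snd d ` T)"
  by (auto simp: image_iff)

lemma chart_inv_prod_chart:
  assumes A: "smooth_atlas A" "c \<in> A" and B: "smooth_atlas B" "d \<in> B"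
    and x: "fst x \<in> snd c ` fst c" "snd x \<in> snd d ` fst d"
  shows "chart_inv (prod_chart c d) x = (chart_inv c (fst x), chart_inv d (snd x))"
  unfolding chart_inv_def[of "prod_chart c d"]
proof (rule inv_into_f_eq)
  show "inj_on (snd (prod_chart c d)) (fst (prod_chart c d))"
  proof (rule inj_onI)
    fix x y assume "x \<in> fst (prod_chart c d)" "y \<in> fst (prod_chart c d)"
      "snd (prod_chart c d) x = snd (prod_chart c d) y"
    then show "x = y" using smooth_atlasD(3)[OF A] smooth_atlasD(3)[OF B]
      by (metis mem_Times_iff prod_chart_simps prod_eqI prod.inject)
  qed
qed (use smooth_atlasD(4,5)[OF A x(1)] smooth_atlasD(4,5)[OF B x(2)] in auto)

lemma smooth_on_fst:
  fixes f :: "'d::euclidean_space \<Rightarrow> 'c::euclidean_space" and T :: "'e::euclidean_space set"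
  assumes "open S" "open T" "smooth_on S f"
  shows "smooth_on (S \<times> T) (\<lambda>x. f (fst x))"
proof (rule smooth_on_compose[OF assms(3) _ assms(1)])
  show "open (S \<times> T)" by (rule open_Times[OF assms(1,2)])
  then show "smooth_on (S \<times> T) fst"
    using smooth_on_linear[OF _ bounded_linear.linear[OF bounded_linear_fst] smooth_on_ident] by blast
qed auto

lemma smooth_on_snd:
  fixes f :: "'e::euclidean_space \<Rightarrow> 'c::euclidean_space" and S :: "'d::euclidean_space set"
  assumes "open S" "open T" "smooth_on T f"
  shows "smooth_on (S \<times> T) (\<lambda>x. f (snd x))"
proof (rule smooth_on_compose[OF assms(3) _ assms(2)])
  show "open (S \<times> T)" by (rule open_Times[OF assms(1,2)])
  then show "smooth_on (S \<times> T) snd"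
    using smooth_on_linear[OF _ bounded_linear.linear[OF bounded_linear_snd] smooth_on_ident] by blast
qed auto

context
  fixes A1 :: "('a::{t2_space,second_countable_topology}, 'd1::euclidean_space) chart set"
    and A2 :: "('b::{t2_space,second_countable_topology}, 'd2::euclidean_space) chart set"
  assumes A1: "smooth_atlas A1" and A2: "smooth_atlas A2"
begin

lemma smooth_atlas_prod: "smooth_atlas (prod_atlas A1 A2)"
  unfolding smooth_atlas_def
proof (intro conjI ballI)
  show "(\<Union>c\<in>prod_atlas A1 A2. fst c) = UNIV"
  proof (intro equalityI subset_UNIV subsetI)
    fix p :: "'a \<times> 'b"
    have "prod_chart (chart_at A1 (fst p)) (chart_at A2 (snd p)) \<in> prod_atlas A1 A2"
      by (rule prod_chart_in_atlas[OF chart_at(1)[OF A1] chart_at(1)[OF A2]])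
    moreover have "p \<in> fst (prod_chart (chart_at A1 (fst p)) (chart_at A2 (snd p)))"
      using chart_at(2)[OF A1] chart_at(2)[OF A2] by (simp add: mem_Times_iff)
    ultimately show "p \<in> (\<Union>c\<in>prod_atlas A1 A2. fst c)" by blast
  qed
next
  fix c assume "c \<in> prod_atlas A1 A2"
  then obtain c1 c2 where c: "c = prod_chart c1 c2" "c1 \<in> A1" "c2 \<in> A2" by (auto simp: prod_atlas_eq)
  note 1 = smooth_atlasD[OF A1 c(2)] and 2 = smooth_atlasD[OF A2 c(3)]
  have im: "snd c ` fst c = (snd c1 ` fst c1) \<times> (snd c2 ` fst c2)"
    unfolding c(1) prod_chart_simps(1) by (rule prod_chart_image)
  note inv = chart_inv_prod_chart[OF A1 c(2) A2 c(3)]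
  show "open (fst c)" using 1(1) 2(1) by (simp add: c(1) open_Times)
  show "open (snd c ` fst c)" unfolding im using 1(2) 2(2) by (simp add: open_Times)
  show "homeomorphism (fst c) (snd c ` fst c) (snd c) (chart_inv c)"
    unfolding homeomorphism_def
  proof (intro conjI ballI)
    show *: "chart_inv c (snd c x) = x" if "x \<in> fst c" for x
      using that inv[of "snd c x"] 1(3) 2(3) by (auto simp: c(1))
    show "chart_inv c ` snd c ` fst c = fst c" using * by force
    show "snd c (chart_inv c y) = y" if "y \<in> snd c ` fst c" for y using that * by auto
    show "snd c ` fst c = snd c ` fst c" ..
    have "continuous_on (fst c) (\<lambda>x. (snd c1 (fst x), snd c2 (snd x)))"
      by (intro continuous_on_Pair continuous_on_compose2[OF 1(6)] continuous_on_compose2[OF 2(6)]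
          continuous_on_fst continuous_on_snd continuous_on_id) (auto simp: c(1))
    then show "continuous_on (fst c) (snd c)" by (simp add: c(1) cong: continuous_on_cong)
    have "continuous_on (snd c ` fst c) (\<lambda>x. (chart_inv c1 (fst x), chart_inv c2 (snd x)))"
      unfolding im
      by (intro continuous_on_Pair continuous_on_compose2[OF 1(7)] continuous_on_compose2[OF 2(7)]
          continuous_on_fst continuous_on_snd continuous_on_id) auto
    moreover have "(chart_inv c1 (fst x), chart_inv c2 (snd x)) = chart_inv c x" if "x \<in> snd c ` fst c" for x
      using that inv[of x] by (auto simp: c(1))
    ultimately show "continuous_on (snd c ` fst c) (chart_inv c)" by (rule continuous_on_eq)
  qed
next
  fix c d assume "c \<in> prod_atlas A1 A2" "d \<in> prod_atlas A1 A2"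
  then obtain c1 c2 d1 d2 where c: "c = prod_chart c1 c2" "c1 \<in> A1" "c2 \<in> A2"
    and d: "d = prod_chart d1 d2" "d1 \<in> A1" "d2 \<in> A2" by (auto simp: prod_atlas_eq)
  let ?S = "rep_domain c1 d1 (\<lambda>q. q)" and ?T = "rep_domain c2 d2 (\<lambda>q. q)"
  have S: "open ?S" "open ?T"
    using open_rep_domain[OF A1 A1 smooth_map_ident[OF A1] c(2) d(2)]
      open_rep_domain[OF A2 A2 smooth_map_ident[OF A2] c(3) d(3)] .
  have im: "snd c ` (fst c \<inter> fst d) = ?S \<times> ?T"
    unfolding c(1) d(1) prod_chart_simps(1) Times_Int_Times prod_chart_image
    by (simp add: rep_domain_def Int_def vimage_def)
  have "smooth_on (?S \<times> ?T) (\<lambda>x. (local_rep c1 d1 (\<lambda>q. q) (fst x), local_rep c2 d2 (\<lambda>q. q) (snd x)))"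
    by (intro smooth_on_Pair smooth_on_fst smooth_on_snd S open_Times
        smooth_local_rep[OF smooth_map_ident[OF A1] c(2) d(2)]
        smooth_local_rep[OF smooth_map_ident[OF A2] c(3) d(3)])
  then show "smooth_on (snd c ` (fst c \<inter> fst d)) (snd d \<circ> chart_inv c)"
    unfolding im
  proof (rule smooth_on_cong[OF open_Times[OF S], rotated])
    fix x assume "x \<in> ?S \<times> ?T"
    then have "fst x \<in> snd c1 ` fst c1" "snd x \<in> snd c2 ` fst c2" by (auto simp: rep_domain_def)
    then show "(local_rep c1 d1 (\<lambda>q. q) (fst x), local_rep c2 d2 (\<lambda>q. q) (snd x)) = (snd d \<circ> chart_inv c) x"
      using chart_inv_prod_chart[OF A1 c(2) A2 c(3), of x] by (simp add: c(1) d(1) local_rep_def)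
  qed
qed

lemma smooth_map_fst: "smooth_map (prod_atlas A1 A2) A1 fst"
  unfolding smooth_map_def
proof (intro conjI ballI)
  show "continuous_on UNIV (fst :: 'a \<times> 'b \<Rightarrow> 'a)" by (intro continuous_on_fst continuous_on_id)
  fix c d assume "c \<in> prod_atlas A1 A2" and d: "d \<in> A1"
  then obtain c1 c2 where c: "c = prod_chart c1 c2" "c1 \<in> A1" "c2 \<in> A2" by (auto simp: prod_atlas_eq)
  let ?S = "rep_domain c1 d (\<lambda>q. q)" and ?T = "snd c2 ` fst c2"
  have S: "open ?S" "open ?T"
    using open_rep_domain[OF A1 A1 smooth_map_ident[OF A1] c(2) d] smooth_atlasD(2)[OF A2 c(3)] .
  have "fst c \<inter> fst -` fst d = (fst c1 \<inter> fst d) \<times> fst c2" by (auto simp: c(1))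
  then have im: "snd c ` (fst c \<inter> fst -` fst d) = ?S \<times> ?T"
    by (simp add: c(1) prod_chart_image rep_domain_def Int_def vimage_def del: prod_chart_simps(2))
  have "smooth_on (?S \<times> ?T) (\<lambda>x. local_rep c1 d (\<lambda>q. q) (fst x))"
    by (intro smooth_on_fst S smooth_local_rep[OF smooth_map_ident[OF A1] c(2) d])
  then show "smooth_on (snd c ` (fst c \<inter> fst -` fst d)) (snd d \<circ> fst \<circ> chart_inv c)"
    unfolding im
  proof (rule smooth_on_cong[OF open_Times[OF S], rotated])
    fix x assume "x \<in> ?S \<times> ?T"
    then have "fst x \<in> snd c1 ` fst c1" "snd x \<in> snd c2 ` fst c2" by (auto simp: rep_domain_def)
    then show "local_rep c1 d (\<lambda>q. q) (fst x) = (snd d \<circ> fst \<circ> chart_inv c) x"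
      using chart_inv_prod_chart[OF A1 c(2) A2 c(3), of x] by (simp add: c(1) local_rep_def)
  qed
qed

lemma smooth_map_snd: "smooth_map (prod_atlas A1 A2) A2 snd"
  unfolding smooth_map_def
proof (intro conjI ballI)
  show "continuous_on UNIV (snd :: 'a \<times> 'b \<Rightarrow> 'b)" by (intro continuous_on_snd continuous_on_id)
  fix c d assume "c \<in> prod_atlas A1 A2" and d: "d \<in> A2"
  then obtain c1 c2 where c: "c = prod_chart c1 c2" "c1 \<in> A1" "c2 \<in> A2" by (auto simp: prod_atlas_eq)
  let ?S = "snd c1 ` fst c1" and ?T = "rep_domain c2 d (\<lambda>q. q)"
  have S: "open ?S" "open ?T"
    using smooth_atlasD(2)[OF A1 c(2)] open_rep_domain[OF A2 A2 smooth_map_ident[OF A2] c(3) d] .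
  have "fst c \<inter> snd -` fst d = fst c1 \<times> (fst c2 \<inter> fst d)" by (auto simp: c(1))
  then have im: "snd c ` (fst c \<inter> snd -` fst d) = ?S \<times> ?T"
    by (simp add: c(1) prod_chart_image rep_domain_def Int_def vimage_def del: prod_chart_simps(2))
  have "smooth_on (?S \<times> ?T) (\<lambda>x. local_rep c2 d (\<lambda>q. q) (snd x))"
    by (intro smooth_on_snd S smooth_local_rep[OF smooth_map_ident[OF A2] c(3) d])
  then show "smooth_on (snd c ` (fst c \<inter> snd -` fst d)) (snd d \<circ> snd \<circ> chart_inv c)"
    unfolding im
  proof (rule smooth_on_cong[OF open_Times[OF S], rotated])
    fix x assume "x \<in> ?S \<times> ?T"
    then have "fst x \<in> snd c1 ` fst c1" "snd x \<in> snd c2 ` fst c2" by (auto simp: rep_domain_def)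
    then show "local_rep c2 d (\<lambda>q. q) (snd x) = (snd d \<circ> snd \<circ> chart_inv c) x"
      using chart_inv_prod_chart[OF A1 c(2) A2 c(3), of x] by (simp add: c(1) local_rep_def)
  qed
qed

lemma smooth_map_slice1: "smooth_map A1 (prod_atlas A1 A2) (\<lambda>a. (a, b))"
  unfolding smooth_map_def
proof (intro conjI ballI)
  show "continuous_on UNIV (\<lambda>a. (a, b))" by (intro continuous_on_Pair continuous_on_id continuous_on_const)
  fix c d assume c: "c \<in> A1" and "d \<in> prod_atlas A1 A2"
  then obtain d1 d2 where d: "d = prod_chart d1 d2" "d1 \<in> A1" "d2 \<in> A2" by (auto simp: prod_atlas_eq)
  let ?S = "rep_domain c d1 (\<lambda>q. q)"
  have S: "open ?S" by (rule open_rep_domain[OF A1 A1 smooth_map_ident[OF A1] c d(2)])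
  \<comment> \<open>The condition that \<open>b\<close> lies in the domain of \<open>d2\<close> is
    dropped in \<open>?S\<close>: the second component of the representation is constant in either
    case, so smoothness on the larger set can be restricted.\<close>
  have sub: "snd c ` (fst c \<inter> (\<lambda>a. (a, b)) -` fst d) \<subseteq> ?S" by (auto simp: d(1) rep_domain_def)
  have "smooth_on ?S (\<lambda>x. (local_rep c d1 (\<lambda>q. q) x, snd d2 b))"
    by (intro smooth_on_Pair smooth_on_const S smooth_local_rep[OF smooth_map_ident[OF A1] c d(2)])
  then have "smooth_on ?S (snd d \<circ> (\<lambda>a. (a, b)) \<circ> chart_inv c)"
    by (rule smooth_on_cong[OF S, rotated]) (simp add: d(1) local_rep_def)
  then show "smooth_on (snd c ` (fst c \<inter> (\<lambda>a. (a, b)) -` fst d)) (snd d \<circ> (\<lambda>a. (a, b)) \<circ> chart_inv c)"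
    using sub by (rule smooth_on_subset)
qed

lemma smooth_map_slice2: "smooth_map A2 (prod_atlas A1 A2) (Pair a)"
  unfolding smooth_map_def
proof (intro conjI ballI)
  show "continuous_on UNIV (Pair a :: 'b \<Rightarrow> _)" by (intro continuous_on_Pair continuous_on_id continuous_on_const)
  fix c d assume c: "c \<in> A2" and "d \<in> prod_atlas A1 A2"
  then obtain d1 d2 where d: "d = prod_chart d1 d2" "d1 \<in> A1" "d2 \<in> A2" by (auto simp: prod_atlas_eq)
  let ?S = "rep_domain c d2 (\<lambda>q. q)"
  have S: "open ?S" by (rule open_rep_domain[OF A2 A2 smooth_map_ident[OF A2] c d(3)])
  have sub: "snd c ` (fst c \<inter> Pair a -` fst d) \<subseteq> ?S" by (auto simp: d(1) rep_domain_def)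
  have "smooth_on ?S (\<lambda>x. (snd d1 a, local_rep c d2 (\<lambda>q. q) x))"
    by (intro smooth_on_Pair smooth_on_const S smooth_local_rep[OF smooth_map_ident[OF A2] c d(3)])
  then have "smooth_on ?S (snd d \<circ> Pair a \<circ> chart_inv c)"
    by (rule smooth_on_cong[OF S, rotated]) (simp add: d(1) local_rep_def)
  then show "smooth_on (snd c ` (fst c \<inter> Pair a -` fst d)) (snd d \<circ> Pair a \<circ> chart_inv c)"
    using sub by (rule smooth_on_subset)
qed

context
  fixes c1 c2 a b
  assumes c1: "c1 \<in> A1" "a \<in> fst c1" and c2: "c2 \<in> A2" "b \<in> fst c2"
begin

lemma prod_chart_mem: "prod_chart c1 c2 \<in> prod_atlas A1 A2" "(a, b) \<in> fst (prod_chart c1 c2)"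
  using c1 c2 by (auto intro: prod_chart_in_atlas)

lemma open_prod_chart_image: "open (snd (prod_chart c1 c2) ` fst (prod_chart c1 c2))"
  by (rule smooth_atlasD(2)[OF smooth_atlas_prod prod_chart_mem(1)])

lemma prod_chart_image_mem: "snd (prod_chart c1 c2) (a, b) \<in> snd (prod_chart c1 c2) ` fst (prod_chart c1 c2)"
  using prod_chart_mem(2) by (rule imageI)

lemma chart_inv_prod:
  "x \<in> snd (prod_chart c1 c2) ` fst (prod_chart c1 c2)
    \<Longrightarrow> chart_inv (prod_chart c1 c2) x = (chart_inv c1 (fst x), chart_inv c2 (snd x))"
  by (rule chart_inv_prod_chart[OF A1 c1(1) A2 c2(1)]) auto

lemma tangent_map_fst:
  "tangent_map (prod_atlas A1 A2) A1 fst (a, b) (from_chart (prod_atlas A1 A2) (prod_chart c1 c2) (a, b) v)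
    = from_chart A1 c1 a (fst v)"
proof -
  let ?c = "prod_chart c1 c2"
  have eq: "frechet_derivative (local_rep ?c c1 fst) (at (snd ?c (a, b))) = frechet_derivative fst (at (snd ?c (a, b)))" (is "_ = ?R")
    by (rule frechet_derivative_cong_open[OF open_prod_chart_image prod_chart_image_mem])
      (auto simp: local_rep_def chart_inv_prod smooth_atlasD(3)[OF A1 c1(1)])
  have "?R v = fst v" by (rule frechet_derivative_eqI) (intro derivative_intros)
  then show ?thesis
    using eq tangent_map_from_chart[OF smooth_atlas_prod A1 smooth_map_fst prod_chart_mem c1(1)] c1(2) by simp
qed

lemma tangent_map_snd:
  "tangent_map (prod_atlas A1 A2) A2 snd (a, b) (from_chart (prod_atlas A1 A2) (prod_chart c1 c2) (a, b) v)
    = from_chart A2 c2 b (snd v)"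
proof -
  let ?c = "prod_chart c1 c2"
  have eq: "frechet_derivative (local_rep ?c c2 snd) (at (snd ?c (a, b))) = frechet_derivative snd (at (snd ?c (a, b)))" (is "_ = ?R")
    by (rule frechet_derivative_cong_open[OF open_prod_chart_image prod_chart_image_mem])
      (auto simp: local_rep_def chart_inv_prod smooth_atlasD(3)[OF A2 c2(1)])
  have "?R v = snd v" by (rule frechet_derivative_eqI) (intro derivative_intros)
  then show ?thesis
    using eq tangent_map_from_chart[OF smooth_atlas_prod A2 smooth_map_snd prod_chart_mem c2(1)] c2(2) by simp
qed

lemma tangent_map_slice1:
  "tangent_map A1 (prod_atlas A1 A2) (\<lambda>a. (a, b)) a (from_chart A1 c1 a v)
    = from_chart (prod_atlas A1 A2) (prod_chart c1 c2) (a, b) (v, 0)"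
proof -
  have eq: "frechet_derivative (local_rep c1 (prod_chart c1 c2) (\<lambda>a. (a, b))) (at (snd c1 a))
      = frechet_derivative (\<lambda>x. (x, snd c2 b)) (at (snd c1 a))" (is "_ = ?R")
    by (rule frechet_derivative_cong_open[OF smooth_atlasD(2)[OF A1 c1(1)]])
      (use c1 in \<open>auto simp: local_rep_def smooth_atlasD(3)[OF A1 c1(1)]\<close>)
  have "?R v = (v, 0)" by (rule frechet_derivative_eqI) (intro derivative_intros)
  then show ?thesis
    using eq tangent_map_from_chart[OF A1 smooth_atlas_prod smooth_map_slice1 c1 prod_chart_mem] by simp
qed

lemma tangent_map_slice2:
  "tangent_map A2 (prod_atlas A1 A2) (Pair a) b (from_chart A2 c2 b v)
    = from_chart (prod_atlas A1 A2) (prod_chart c1 c2) (a, b) (0, v)"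
proof -
  have eq: "frechet_derivative (local_rep c2 (prod_chart c1 c2) (Pair a)) (at (snd c2 b))
      = frechet_derivative (\<lambda>x. (snd c1 a, x)) (at (snd c2 b))" (is "_ = ?R")
    by (rule frechet_derivative_cong_open[OF smooth_atlasD(2)[OF A2 c2(1)]])
      (use c2 in \<open>auto simp: local_rep_def smooth_atlasD(3)[OF A2 c2(1)]\<close>)
  have "?R v = (0, v)" by (rule frechet_derivative_eqI) (intro derivative_intros)
  then show ?thesis
    using eq tangent_map_from_chart[OF A2 smooth_atlas_prod smooth_map_slice2 c2 prod_chart_mem] by simp
qed

text \<open>Any pair of charts around the point may be used, since \<open>from_chart\<close> maps
  onto the tangent space of the factor. Coordinate fields of the first factor thus stay in the
  subbundle throughout a product chart.\<close>

lemma factor1_eq: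
  "factor1 A1 A2 (a, b) = range (\<lambda>v. from_chart (prod_atlas A1 A2) (prod_chart c1 c2) (a, b) (v, 0))"
  unfolding factor1_def tangent_map_slice1[symmetric] fst_conv snd_conv
  using from_chart_to_chart[OF A1 c1] by (auto simp: image_iff) metis

lemma factor2_eq:
  "factor2 A1 A2 (a, b) = range (\<lambda>v. from_chart (prod_atlas A1 A2) (prod_chart c1 c2) (a, b) (0, v))"
  unfolding factor2_def tangent_map_slice2[symmetric] fst_conv snd_conv
  using from_chart_to_chart[OF A2 c2] by (auto simp: image_iff) metis

end

lemma warped_metric_in_chart:
  assumes "c1 \<in> A1" "c2 \<in> A2" "x \<in> snd (prod_chart c1 c2) ` fst (prod_chart c1 c2)"
  shows "metric_in_chart (prod_atlas A1 A2) (warped_metric A1 A2 g1 g2 f) (prod_chart c1 c2) x u v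
    = metric_in_chart A1 g1 c1 (fst x) (fst u) (fst v)
      + (f (chart_inv c1 (fst x)))\<^sup>2 * metric_in_chart A2 g2 c2 (snd x) (snd u) (snd v)"
proof -
  have mem: "chart_inv c1 (fst x) \<in> fst c1" "chart_inv c2 (snd x) \<in> fst c2"
    using assms(3) by (auto simp: smooth_atlasD(3)[OF A1 assms(1)] smooth_atlasD(3)[OF A2 assms(2)])
  then show ?thesis
    using chart_inv_prod[OF assms(1) mem(1) assms(2) mem(2) assms(3)] assms(1,2)
    by (simp add: metric_in_chart_def Let_def warped_metric_def tangent_map_fst tangent_map_snd)
qed

end

section \<open>Restriction of an immersion to the slices of a product\<close>

lemma second_derivative_compose_affine:
  assumes f: "smooth_on S f" "open S" and T: "open T" "x \<in> T" "\<And>x. x \<in> T \<Longrightarrow> L x + k \<in> S"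
    and L: "linear L"
  shows "second_derivative (\<lambda>x. f (L x + k)) x u v = second_derivative f (L x + k) (L u) (L v)"
proof -
  have der: "((\<lambda>x. L x + k) has_derivative L) (at y)" for y
    using linear_imp_has_derivative[OF L] by (auto intro!: derivative_eq_intros)
  have "smooth_on T L" "smooth_on T (\<lambda>x. k)"
    by (rule smooth_on_linear[OF T(1) L smooth_on_ident] smooth_on_const)+
  then have "smooth_on T (\<lambda>x. L x + k)"
    unfolding smooth_on_def by (intro allI Ck_on_add[OF T(1)]) simp_all
  note c = second_derivative_compose[OF f(1) this f(2) T]
  have "second_derivative (\<lambda>x. L x + k) x u v = 0"
    by (simp add: second_derivative_def frechet_derivative_eqI[OF der])
  moreover have "linear (frechet_derivative f (at (L x + k)))"
    using f(1) T(2,3) smooth_on_imp_differentiable linear_frechet_derivative by blast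
  ultimately show ?thesis by (simp add: c frechet_derivative_eqI[OF der] linear_0)
qed

lemma Ck_on_locally:
  assumes "open S" "\<And>x. x \<in> S \<Longrightarrow> \<exists>U. open U \<and> x \<in> U \<and> Ck_on k f (U \<inter> S)"
  shows "Ck_on k f S"
  using assms(2)
proof (induction k arbitrary: f)
  case 0
  have "continuous (at x) f" if x: "x \<in> S" for x
  proof -
    obtain U where "open U" "x \<in> U" "continuous_on (U \<inter> S) f" using 0[OF x] by auto
    then show ?thesis
      using x assms(1) continuous_on_eq_continuous_at[of "U \<inter> S" f] by (simp add: open_Int)
  qed
  then show ?case by (simp add: continuous_at_imp_continuous_on)
next
  case (Suc k)
  have "f differentiable (at x)" if "x \<in> S" for x using Suc.prems[OF that] that by auto
  moreover have "Ck_on k (\<lambda>x. frechet_derivative f (at x) v) S" for v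
    by (rule Suc.IH) (use Suc.prems in fastforce)
  ultimately show ?case by simp
qed

lemma smooth_on_locally:
  assumes "open S" "\<And>x. x \<in> S \<Longrightarrow> \<exists>U. open U \<and> x \<in> U \<and> smooth_on (U \<inter> S) f"
  shows "smooth_on S f"
  unfolding smooth_on_def
proof
  fix k show "Ck_on k f S"
    by (rule Ck_on_locally[OF assms(1)]) (use assms(2) in \<open>force simp: smooth_on_def\<close>)
qed

text \<open>The intermediate chart depends on the point, so the composition is first smooth near
  each point only and the pieces are glued by \<open>smooth_on_locally\<close>.\<close>

lemma smooth_map_comp:
  assumes A: "smooth_atlas A" and B: "smooth_atlas B" and C: "smooth_atlas C"
    and F: "smooth_map A B F" and H: "smooth_map B C H"
  shows "smooth_map A C (\<lambda>q. H (F q))"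
  unfolding smooth_map_def
proof (intro conjI ballI)
  show cont: "continuous_on UNIV (\<lambda>q. H (F q))"
    using F H by (auto simp: smooth_map_def intro: continuous_on_compose2)
  fix c e assume c: "c \<in> A" and e: "e \<in> C"
  let ?S = "snd c ` (fst c \<inter> (\<lambda>q. H (F q)) -` fst e)"
  have "open ((\<lambda>q. H (F q)) -` fst e)"
    using cont smooth_atlasD(1)[OF C e] by (metis continuous_on_open_vimage open_UNIV inf_top_right)
  then have S: "open ?S" by (rule open_chart_image[OF A c])
  have "smooth_on ?S (local_rep c e (\<lambda>q. H (F q)))"
  proof (rule smooth_on_locally[OF S])
    fix x assume "x \<in> ?S"
    then obtain q where q: "q \<in> fst c" "H (F q) \<in> fst e" "x = snd c q" by auto
    let ?d = "chart_at B (F q)" let ?U = "rep_domain c ?d F"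
    note d = chart_at[OF B, of "F q"]
    have U: "open ?U" by (rule open_rep_domain[OF A B F c d(1)])
    have mem: "local_rep c ?d F y \<in> rep_domain ?d e H" if "y \<in> ?U \<inter> ?S" for y
    proof -
      have "y \<in> ?U" "y \<in> ?S" using that by auto
      from this(1) have "F (chart_inv c y) \<in> fst ?d" by (auto simp: rep_domain_def smooth_atlasD(3)[OF A c])
      moreover from \<open>y \<in> ?S\<close> have "H (F (chart_inv c y)) \<in> fst e" by (auto simp: smooth_atlasD(3)[OF A c])
      ultimately show ?thesis unfolding local_rep_def by (rule rep_domain_memI)
    qed
    have "smooth_on (?U \<inter> ?S) (\<lambda>x. local_rep ?d e H (local_rep c ?d F x))"
      by (rule smooth_on_compose[OF smooth_local_rep[OF H d(1) e]
            smooth_on_subset[OF smooth_local_rep[OF F c d(1)] Int_lower1]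
            open_rep_domain[OF B C H d(1) e] open_Int[OF U S] mem])
    then have "smooth_on (?U \<inter> ?S) (local_rep c e (\<lambda>q. H (F q)))"
      by (rule smooth_on_cong[OF open_Int[OF U S], rotated])
        (simp add: local_rep_comp[OF A B c d(1)])
    then show "\<exists>U. open U \<and> x \<in> U \<and> smooth_on (U \<inter> ?S) (local_rep c e (\<lambda>q. H (F q)))"
      using U rep_domain_memI[of q c F ?d, OF q(1) d(2)] q(3) by blast
  qed
  then show "smooth_on ?S (snd e \<circ> (\<lambda>q. H (F q)) \<circ> chart_inv c)" by (simp add: local_rep_def o_def)
qed

lemma immersion_comp:
  assumes A: "smooth_atlas A" and B: "smooth_atlas B" and C: "smooth_atlas C"
    and F: "immersion A B F" and H: "immersion B C H"
  shows "immersion A C (\<lambda>q. H (F q))"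
proof -
  have s: "smooth_map A B F" "smooth_map B C H" using F H by (simp_all add: immersion_def)
  have "inj (tangent_map A C (\<lambda>q. H (F q)) p)" for p
  proof (rule injI)
    fix x y assume "tangent_map A C (\<lambda>q. H (F q)) p x = tangent_map A C (\<lambda>q. H (F q)) p y"
    then show "x = y" using F H by (simp add: immersion_def inj_eq tangent_map_comp[OF A B C s])
  qed
  then show ?thesis using smooth_map_comp[OF A B C s] by (simp add: immersion_def)
qed

lemma immersion_slice1:
  assumes A1: "smooth_atlas A1" and A2: "smooth_atlas A2"
  shows "immersion A1 (prod_atlas A1 A2) (\<lambda>a. (a, b))"
proof -
  have "inj (tangent_map A1 (prod_atlas A1 A2) (\<lambda>a. (a, b)) a)" for a
  proof -
    note c = chart_at[OF A1, of a] chart_at[OF A2, of b]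
    note m = prod_chart_mem[OF A1 A2 c]
    have "tangent_map A1 (prod_atlas A1 A2) (\<lambda>a. (a, b)) a v
        = from_chart (prod_atlas A1 A2) (prod_chart (chart_at A1 a) (chart_at A2 b)) (a, b) (v, 0)" for v
      using tangent_map_slice1[OF A1 A2 c, of v] by (simp add: from_chart_chart_at[OF A1])
    then show ?thesis
      using inj_from_chart[OF smooth_atlas_prod[OF A1 A2] m] by (simp add: inj_def)
  qed
  then show ?thesis using smooth_map_slice1[OF A1 A2] by (simp add: immersion_def)
qed

lemma immersion_slice2:
  assumes A1: "smooth_atlas A1" and A2: "smooth_atlas A2"
  shows "immersion A2 (prod_atlas A1 A2) (Pair a)"
proof -
  have "inj (tangent_map A2 (prod_atlas A1 A2) (Pair a) b)" for b
  proof -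
    note c = chart_at[OF A1, of a] chart_at[OF A2, of b]
    note m = prod_chart_mem[OF A1 A2 c]
    have "tangent_map A2 (prod_atlas A1 A2) (Pair a) b v
        = from_chart (prod_atlas A1 A2) (prod_chart (chart_at A1 a) (chart_at A2 b)) (a, b) (0, v)" for v
      using tangent_map_slice2[OF A1 A2 c, of v] by (simp add: from_chart_chart_at[OF A2])
    then show ?thesis
      using inj_from_chart[OF smooth_atlas_prod[OF A1 A2] m] by (simp add: inj_def)
  qed
  then show ?thesis using smooth_map_slice2[OF A1 A2] by (simp add: immersion_def)
qed

context immersed
begin

text \<open>Meant for slice inclusions, which in product charts just append a constant. An affine
  map has no second derivative, so the Hessian of the slice is the restricted Hessian of the product
  without a tangential correction.\<close>

lemma ambient_hessian_affine_restriction: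
  assumes A': "smooth_atlas A'" and i: "smooth_map A' A i" and c': "c' \<in> A'" "a \<in> fst c'"
    and c: "c \<in> A"
    and affine: "\<And>x. x \<in> snd c' ` fst c' \<Longrightarrow> i (chart_inv c' x) \<in> fst c \<and> local_rep c' c i x = L x + k"
    and L: "linear L"
  shows "ambient_hessian A' B g (\<lambda>a. F (i a)) c' a u v = hess c (i a) (L u) (L v)"
proof -
  let ?d = "chart_at B (F (i a))"
  let ?W = "rep_domain c' ?d (\<lambda>a. F (i a))"
  note Fi = smooth_map_comp[OF A' A B i smooth] and d = chart_at[OF B, of "F (i a)"]
  have ia: "i a \<in> fst c" and La: "snd c (i a) = L (snd c' a) + k"
    using affine[OF imageI[OF c'(2)]] by (simp_all add: smooth_atlasD(3)[OF A' c'] local_rep_at[OF A' c'])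
  have W: "open ?W" "snd c' a \<in> ?W"
    by (rule open_rep_domain[OF A' B Fi c'(1) d(1)])
      (rule rep_domain_memI[of a c' "\<lambda>a. F (i a)", OF c'(2) d(2)])
  have sub: "x \<in> snd c' ` fst c'" "F (i (chart_inv c' x)) \<in> fst ?d" if "x \<in> ?W" for x
    using that smooth_atlasD(3)[OF A' c'(1)] by (auto simp: rep_domain_def)
  have Lx: "snd c (i (chart_inv c' x)) = L x + k" if "x \<in> ?W" for x
    using affine[OF sub(1)[OF that]] by (simp add: local_rep_def)
  have "second_derivative (local_rep c' ?d (\<lambda>a. F (i a))) (snd c' a) u v
      = second_derivative (\<lambda>x. local_rep c ?d F (L x + k)) (snd c' a) u v"
  proof (rule second_derivative_cong_open[OF W])
    fix x assume x: "x \<in> ?W"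
    then have "i (chart_inv c' x) \<in> fst c" using affine sub by blast
    then show "local_rep c' ?d (\<lambda>a. F (i a)) x = local_rep c ?d F (L x + k)"
      using smooth_atlasD(3)[OF A c] by (simp add: local_rep_def Lx[OF x, symmetric])
  qed
  also have "\<dots> = second_derivative (local_rep c ?d F) (L (snd c' a) + k) (L u) (L v)"
  proof (rule second_derivative_compose_affine[OF smooth_local_rep[OF smooth c d(1)]
        open_rep_domain[OF A B smooth c d(1)] W _ L])
    fix x assume x: "x \<in> ?W"
    then have "i (chart_inv c' x) \<in> fst c" using affine sub by blast
    then show "L x + k \<in> rep_domain c ?d F"
      unfolding Lx[OF x, symmetric] by (rule rep_domain_memI) (rule sub(2)[OF x])
  qed
  finally have 1: "second_derivative (local_rep c' ?d (\<lambda>a. F (i a))) (snd c' a) u v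
      = second_derivative (local_rep c ?d F) (snd c (i a)) (L u) (L v)" by (simp add: La)
  have "frechet_derivative (local_rep c' c i) (at (snd c' a)) w = L w" for w
  proof (rule frechet_derivative_eqI)
    have "((\<lambda>x. L x + k) has_derivative L) (at (snd c' a))"
      using linear_imp_has_derivative[OF L] by (auto intro!: derivative_eq_intros)
    then show "(local_rep c' c i has_derivative L) (at (snd c' a))"
      by (rule has_derivative_transform_within_open[OF _ smooth_atlasD(2)[OF A' c'(1)] imageI[OF c'(2)]])
        (simp add: affine)
  qed
  then have "tangent_map A' B (\<lambda>a. F (i a)) a (from_chart A' c' a w) = T (i a) (from_chart A c (i a) (L w))" for w
    by (simp add: tangent_map_comp[OF A' A B i smooth] tangent_map_from_chart[OF A' A i c' c ia])
  with 1 show ?thesis by (simp add: ambient_hessian_def)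
qed

end

section \<open>Warped product bi-slant submanifolds\<close>

locale warped_slant =
  fixes A1 :: "('a::{t2_space,second_countable_topology}, 'd1::euclidean_space) chart set"
    and A2 :: "('b::{t2_space,second_countable_topology}, 'd2::euclidean_space) chart set"
    and B :: "('m::{t2_space,second_countable_topology}, 'e::euclidean_space) chart set"
    and \<phi> :: "'m \<Rightarrow> 'e \<Rightarrow> 'e" and \<xi> :: "'m \<Rightarrow> 'e" and \<eta> :: "'m \<Rightarrow> 'e \<Rightarrow> real"
    and g :: "'m \<Rightarrow> 'e \<Rightarrow> 'e \<Rightarrow> real"
    and F :: "'a \<times> 'b \<Rightarrow> 'm"
    and g1 :: "'a \<Rightarrow> 'd1 \<Rightarrow> 'd1 \<Rightarrow> real" and g2 :: "'b \<Rightarrow> 'd2 \<Rightarrow> 'd2 \<Rightarrow> real"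
    and f :: "'a \<Rightarrow> real"
    and D1 D2 :: "'a \<times> 'b \<Rightarrow> ('d1 \<times> 'd2) set"
    and \<theta>1 \<theta>2 :: "'a \<times> 'b \<Rightarrow> real"
  assumes kenmotsu_B: "kenmotsu_manifold B \<phi> \<xi> \<eta> g"
    and warped: "warped_product_bi_slant A1 A2 B \<phi> \<xi> g F g1 g2 f D1 D2 \<theta>1 \<theta>2"
    and mixed: "mixed_totally_geodesic A1 A2 B g F"
    and proper: "\<theta>2 p \<noteq> pi / 2"
begin

abbreviation "P \<equiv> prod_atlas A1 A2"

lemma A1: "smooth_atlas A1" and A2: "smooth_atlas A2"
  and g1: "riemannian_metric A1 g1" and g2: "riemannian_metric A2 g2"
  and f_smooth: "smooth_fun_on A1 UNIV f" and f_pos: "f a > 0"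
  and bi_slant: "pointwise_bi_slant P B \<phi> \<xi> g F D1 D2 \<theta>1 \<theta>2"
  and metric_eq: "induced_metric P B g F = warped_metric A1 A2 g1 g2 f"
  and factor1_D1: "factor1 A1 A2 p = {X + t *\<^sub>R tan_xi P B \<xi> g F p | X t. X \<in> D1 p}"
  and factor2_D2: "factor2 A1 A2 p = D2 p"
proof -
  have "\<forall>p. factor1 A1 A2 p = {X + t *\<^sub>R tan_xi P B \<xi> g F p | X t. X \<in> D1 p}" "\<forall>p. factor2 A1 A2 p = D2 p"
    using warped unfolding warped_product_bi_slant_def by blast+
  then show "factor1 A1 A2 p = {X + t *\<^sub>R tan_xi P B \<xi> g F p | X t. X \<in> D1 p}" "factor2 A1 A2 p = D2 p"
    by blast+
qed (use warped in \<open>simp_all add: warped_product_bi_slant_def\<close>)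

lemma F_immersion: "immersion P B F" and \<xi>_tangent: "\<xi> (F p) \<in> range (tangent_map P B F p)"
  and slant2: "pointwise_slant P B \<phi> g F D2 \<theta>2"
  using bi_slant unfolding pointwise_bi_slant_def by blast+

lemma \<phi>_D1_D2:
  assumes "X \<in> D1 p" "Y \<in> D2 p"
  shows "g (F p) (\<phi> (F p) (tangent_map P B F p X)) (tangent_map P B F p Y) = 0"
proof -
  have "\<forall>p. \<forall>X\<in>D1 p. \<forall>Y\<in>D2 p. \<forall>t.
        g (F p) (\<phi> (F p) (tangent_map P B F p X))
                (tangent_map P B F p (Y + t *\<^sub>R tan_xi P B \<xi> g F p)) = 0"
    using bi_slant unfolding pointwise_bi_slant_def by (elim conjE) assumption
  from this[rule_format, OF assms, of 0] show ?thesis by simp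
qed

end

sublocale warped_slant \<subseteq> immersed_kenmotsu "prod_atlas A1 A2" B g F \<phi> \<xi> \<eta>
proof
  show "smooth_atlas (prod_atlas A1 A2)" by (rule smooth_atlas_prod[OF A1 A2])
  show "smooth_atlas B" "riemannian_metric B g" using kenmotsu_B by (simp_all add: kenmotsu_manifold_def)
qed (rule F_immersion kenmotsu_B)+

context warped_slant
begin

lemma T_tan_xi: "T p (tan_xi P B \<xi> g F p) = \<xi> (F p)"
  using \<xi>_tangent[of p] by (auto simp: tan_xi_def tangential_part_T)

text \<open>A vector of the first factor is one of \<open>D1 p\<close> plus a multiple of \<xi>, and
  \<open>\<phi>\<close> annihilates the latter.\<close>

lemma \<phi>_factor1_factor2:
  assumes "X \<in> factor1 A1 A2 p" "Y \<in> factor2 A1 A2 p"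
  shows "g (F p) (\<phi> (F p) (T p X)) (T p Y) = 0"
proof -
  obtain X' t where "X = X' + t *\<^sub>R tan_xi P B \<xi> g F p" "X' \<in> D1 p" using assms(1) factor1_D1 by auto
  then show ?thesis
    using \<phi>_D1_D2 assms(2) factor2_D2
    by (simp add: T_simps T_tan_xi linear_add[OF linear_\<phi>] linear_cmul[OF linear_\<phi>] \<phi>_\<xi>)
qed

lemma tan_xi_factor1: "tan_xi P B \<xi> g F p \<in> factor1 A1 A2 p"
proof -
  have "smooth_distribution P D1" using bi_slant by (simp add: pointwise_bi_slant_def)
  then obtain U X k where "p \<in> U" "\<forall>q\<in>U. D1 q = span ((\<lambda>i::nat. X i q) ` {..<k})"
    unfolding smooth_distribution_def by metis
  \<comment> \<open>The local frame shows that \<open>D1 p\<close> is a span, hence contains 0; so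
    \<xi> itself has the form required in \<open>factor1_D1\<close>.\<close>
  then have "0 \<in> D1 p" by (simp add: span_zero)
  then show ?thesis unfolding factor1_D1 by (intro CollectI exI[of _ 0] exI[of _ 1]) simp
qed

text \<open>Were \<omega> zero against all of \<open>D2 p\<close> for a nonzero \<open>Y\<close>,
  the projection of its image under \<open>\<phi>\<close> would vanish and the slant angle would be
  a right angle.\<close>

lemma exists_\<phi>_nonzero:
  obtains Y Z where "Y \<in> D2 p" "Z \<in> D2 p" "g (F p) (\<phi> (F p) (T p Y)) (T p Z) \<noteq> 0"
proof -
  let ?e = "from_chart P (prod_chart (chart_at A1 (fst p)) (chart_at A2 (snd p))) p"
  note c = chart_at[OF A1, of "fst p"] chart_at[OF A2, of "snd p"]
  have D2: "D2 p = range (\<lambda>v. ?e (0, v))"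
    using factor2_eq[OF A1 A2 c] by (simp add: factor2_D2[symmetric])
  have lin: "linear ?e" and inj: "inj ?e"
    using linear_from_chart[OF A prod_chart_mem[OF A1 A2 c]] inj_from_chart[OF A prod_chart_mem[OF A1 A2 c]]
    by simp_all
  \<comment> \<open>A Euclidean space type has a nonempty basis, so the second factor has a nonzero
    tangent vector.\<close>
  obtain b :: 'd2 where b: "b \<in> Basis" using nonempty_Basis by blast
  define Y where "Y = ?e (0, b)"
  have "Y \<noteq> 0" using linear_injective_0[OF lin, THEN iffD1, OF inj, rule_format, of "(0, b)"] nonzero_Basis[OF b]
    by (auto simp: Y_def zero_prod_def)
  have Y: "Y \<in> D2 p" by (simp add: D2 Y_def)
  have "\<exists>Z\<in>D2 p. g (F p) (\<phi> (F p) (T p Y)) (T p Z) \<noteq> 0"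
  proof (rule ccontr)
    assume "\<not> ?thesis"
    then have 0: "g (F p) (\<phi> (F p) (T p Y)) s = 0" if "s \<in> T p ` D2 p" for s using that by auto
    have "?e (0, 0) \<in> D2 p" by (simp add: D2)
    then have "0 \<in> D2 p" using linear_0[OF lin] by (simp add: zero_prod_def)
    then have "0 \<in> T p ` D2 p" by (force simp: T_simps image_iff)
    then have "orth_proj (g (F p)) (T p ` D2 p) (\<phi> (F p) (T p Y)) = 0"
      unfolding orth_proj_def
    proof (intro the_equality conjI)
      show "\<forall>t\<in>T p ` D2 p. g (F p) (\<phi> (F p) (T p Y) - 0) t = 0" using 0 by simp
      fix s assume s: "s \<in> T p ` D2 p \<and> (\<forall>t\<in>T p ` D2 p. g (F p) (\<phi> (F p) (T p Y) - s) t = 0)"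
      then have "g (F p) (\<phi> (F p) (T p Y) - s) s = 0" by blast
      then have "g (F p) s s = 0" using 0 s by (simp add: g_simps)
      then show "s = 0" using inner_product_eq_0[OF ip] by blast
    qed
    \<comment> \<open>The projection is 0, so the quotient in \<open>angle\<close> is a division by
      zero with value 0, and \<open>arccos 0\<close> is \<open>pi / 2\<close>.\<close>
    then have "angle_subspace (g (F p)) (\<phi> (F p) (T p Y)) (T p ` D2 p) = pi / 2"
      by (simp add: angle_subspace_def angle_def g_simps)
    then show False
      using slant2 Y \<open>Y \<noteq> 0\<close> proper[of p] unfolding pointwise_slant_def by auto
  qed
  then show ?thesis using that Y by blast
qed

section \<open>Ambient derivatives of coordinate fields in a product chart\<close>

context
  fixes c1 c2 a b
  assumes c1: "c1 \<in> A1" "a \<in> fst c1" and c2: "c2 \<in> A2" "b \<in> fst c2"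
begin

abbreviation (input) "ch \<equiv> prod_chart c1 c2"
abbreviation (input) "pt \<equiv> (a, b)"
abbreviation (input) "\<epsilon> \<equiv> from_chart P ch pt"
abbreviation (input) "m1 \<equiv> metric_in_chart A1 g1 c1"
abbreviation (input) "m2 \<equiv> metric_in_chart A2 g2 c2"
abbreviation (input) "x1 \<equiv> snd c1 a"
abbreviation (input) "x2 \<equiv> snd c2 b"
abbreviation (input) "dlnf \<equiv> frechet_derivative (\<lambda>x. ln (f (chart_inv c1 x))) (at x1)"

lemmas cp = prod_chart_mem[OF A1 A2 c1 c2]

lemma linear_\<epsilon>: "linear \<epsilon>" by (rule linear_from_chart[OF A cp])

lemma \<epsilon>_surj: obtains v where "w = \<epsilon> v"
  using from_chart_to_chart[OF A cp] by metis

lemma \<epsilon>_factor: "\<epsilon> (x, 0) \<in> factor1 A1 A2 pt" "\<epsilon> (0, z) \<in> factor2 A1 A2 pt"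
  using factor1_eq[OF A1 A2 c1 c2] factor2_eq[OF A1 A2 c1 c2] by auto

lemma x1_mem: "x1 \<in> snd c1 ` fst c1" and x2_mem: "x2 \<in> snd c2 ` fst c2" using c1 c2 by auto

lemma x12_mem: "(x1, x2) \<in> snd ch ` fst ch" using prod_chart_image_mem[OF A1 A2 c1 c2] by simp

lemma open_charts: "open (snd c1 ` fst c1)" "open (snd c2 ` fst c2)" "open (snd ch ` fst ch)"
  using smooth_atlasD(2)[OF A1 c1(1)] smooth_atlasD(2)[OF A2 c2(1)] open_prod_chart_image[OF A1 A2 c1 c2] .

lemma ip_m1: "inner_product (m1 x1)" and ip_m2: "inner_product (m2 x2)"
  using inner_product_metric_in_chart[OF A1 g1 c1(1) x1_mem] inner_product_metric_in_chart[OF A2 g2 c2(1) x2_mem] .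

lemma G_\<epsilon>: "G pt (\<epsilon> u) (\<epsilon> v) = m1 x1 (fst u) (fst v) + (f a)\<^sup>2 * m2 x2 (snd u) (snd v)"
proof -
  have "chart_inv ch (x1, x2) = (a, b)"
    using chart_inv_prod[OF A1 A2 c1 c2 x12_mem] c1 c2 by (simp add: smooth_atlasD(3)[OF A1] smooth_atlasD(3)[OF A2])
  then show ?thesis
    using warped_metric_in_chart[OF A1 A2 c1(1) c2(1) x12_mem, of g1 g2 f u v]
    by (simp add: metric_in_chart_def Let_def metric_eq smooth_atlasD(3)[OF A1 c1] smooth_atlasD(3)[OF A2 c2]
        del: prod_chart_simps)
qed

lemma diff_m1: "(\<lambda>x. m1 x u v) differentiable (at x1)" and diff_m2: "(\<lambda>x. m2 x z w) differentiable (at x2)"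
  using smooth_on_imp_differentiable[OF smooth_metric_in_chart[OF A1 g1 c1(1)] x1_mem]
    smooth_on_imp_differentiable[OF smooth_metric_in_chart[OF A2 g2 c2(1)] x2_mem] .

lemma diff_f: "(\<lambda>x. f (chart_inv c1 x)) differentiable (at x1)"
proof -
  have "smooth_on (snd c1 ` fst c1) (\<lambda>x. f (chart_inv c1 x))"
    using f_smooth c1(1) by (auto simp: smooth_fun_on_def o_def)
  then show ?thesis using x1_mem smooth_on_imp_differentiable by blast
qed

lemma has_derivative_lnf: "((\<lambda>x. ln (f (chart_inv c1 x))) has_derivative dlnf) (at x1)"
  and has_derivative_f: "((\<lambda>x. f (chart_inv c1 x)) has_derivative (\<lambda>w. f a * dlnf w)) (at x1)"
proof -
  note D = has_derivative_frechet[OF diff_f]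
  have inv: "chart_inv c1 x1 = a" by (rule smooth_atlasD(3)[OF A1 c1])
  have L: "((\<lambda>x. ln (f (chart_inv c1 x))) has_derivative
      (\<lambda>w. frechet_derivative (\<lambda>x. f (chart_inv c1 x)) (at x1) w * inverse (f a))) (at x1)"
    using has_derivative_ln[OF _ D] f_pos by (simp add: inv)
  then have "dlnf = (\<lambda>w. frechet_derivative (\<lambda>x. f (chart_inv c1 x)) (at x1) w * inverse (f a))"
    using frechet_derivative_at by metis
  then have "f a * dlnf w = frechet_derivative (\<lambda>x. f (chart_inv c1 x)) (at x1) w" for w
    using f_pos[of a] by (simp add: field_simps)
  then show "((\<lambda>x. ln (f (chart_inv c1 x))) has_derivative dlnf) (at x1)"
    "((\<lambda>x. f (chart_inv c1 x)) has_derivative (\<lambda>w. f a * dlnf w)) (at x1)"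
    using L D frechet_derivative_at[OF L] by simp_all
qed

lemma linear_dlnf: "linear dlnf" by (rule has_derivative_linear[OF has_derivative_lnf])

definition "dm1 w u v = frechet_derivative (\<lambda>x. m1 x u v) (at x1) w"
definition "dm2 w u v = frechet_derivative (\<lambda>x. m2 x u v) (at x2) w"

lemma linear_dm:
  "linear (\<lambda>w. dm1 w u v)" "linear (\<lambda>u. dm1 w u v)" "linear (dm1 w u)"
  "linear (\<lambda>w. dm2 w z y)" "linear (\<lambda>z. dm2 w' z y)" "linear (dm2 w' z)"
  unfolding dm1_def dm2_def
  using linear_frechet_derivative[OF diff_m1] linear_frechet_derivative[OF diff_m2]
    linear_frechet_derivative_family[OF open_charts(1) x1_mem
      inner_product_linear(2)[OF inner_product_metric_in_chart[OF A1 g1 c1(1)]] diff_m1]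
    linear_frechet_derivative_family[OF open_charts(1) x1_mem
      inner_product_linear(1)[OF inner_product_metric_in_chart[OF A1 g1 c1(1)]] diff_m1]
    linear_frechet_derivative_family[OF open_charts(2) x2_mem
      inner_product_linear(2)[OF inner_product_metric_in_chart[OF A2 g2 c2(1)]] diff_m2]
    linear_frechet_derivative_family[OF open_charts(2) x2_mem
      inner_product_linear(1)[OF inner_product_metric_in_chart[OF A2 g2 c2(1)]] diff_m2]
  by simp_all

lemmas dm_0 = linear_dm[THEN linear_0]

text \<open>The warping factor varies only along the first factor, and the derivative of its square
  is twice the square times \<open>dlnf\<close>; this is why the connection formulas below contain
  \<open>dlnf\<close> rather than the derivative of \<open>f\<close>.\<close>

lemma has_derivative_warped_metric:
  "((\<lambda>x. metric_in_chart P G ch x u v) has_derivative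
    (\<lambda>w. dm1 (fst w) (fst u) (fst v) + (2 * (f a)\<^sup>2 * dlnf (fst w)) * m2 x2 (snd u) (snd v)
       + (f a)\<^sup>2 * dm2 (snd w) (snd u) (snd v))) (at (snd ch pt))"
proof -
  have fst: "(fst has_derivative fst) (at (x1, x2))" and snd: "(snd has_derivative snd) (at (x1, x2))"
    by (intro derivative_intros)+
  have inv: "chart_inv c1 x1 = a" by (rule smooth_atlasD(3)[OF A1 c1])
  have 1: "((\<lambda>x. m1 (fst x) u v) has_derivative (\<lambda>w. dm1 (fst w) u v)) (at (x1, x2))" for u v
    using has_derivative_compose[OF fst, of "\<lambda>x. m1 x u v"] has_derivative_frechet[OF diff_m1]
    by (simp add: dm1_def)
  have 2: "((\<lambda>x. m2 (snd x) u v) has_derivative (\<lambda>w. dm2 (snd w) u v)) (at (x1, x2))" for u v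
    using has_derivative_compose[OF snd, of "\<lambda>x. m2 x u v"] has_derivative_frechet[OF diff_m2]
    by (simp add: dm2_def)
  have 3: "((\<lambda>x. f (chart_inv c1 (fst x))) has_derivative (\<lambda>w. f a * dlnf (fst w))) (at (x1, x2))"
    using has_derivative_compose[OF fst, of "\<lambda>x. f (chart_inv c1 x)"] has_derivative_f by simp
  have "((\<lambda>x. m1 (fst x) (fst u) (fst v) + (f (chart_inv c1 (fst x)))\<^sup>2 * m2 (snd x) (snd u) (snd v))
    has_derivative (\<lambda>w. dm1 (fst w) (fst u) (fst v) + (2 * (f a)\<^sup>2 * dlnf (fst w)) * m2 x2 (snd u) (snd v)
       + (f a)\<^sup>2 * dm2 (snd w) (snd u) (snd v))) (at (x1, x2))"
    unfolding power2_eq_square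
    by (rule has_derivative_eq_rhs[OF has_derivative_add[OF 1 has_derivative_mult[OF has_derivative_mult[OF 3 3] 2]]])
      (simp add: fun_eq_iff inv algebra_simps)
  then show ?thesis
    unfolding metric_eq prod_chart_simps fst_conv snd_conv
    by (rule has_derivative_transform_within_open[OF _ open_charts(3) x12_mem])
      (simp add: warped_metric_in_chart[OF A1 A2 c1(1) c2(1)] del: prod_chart_simps)
qed

lemmas hess_koszul = koszul[OF cp has_derivative_warped_metric]

text \<open>The classical rule that the derivative of Z along X is (X ln f) Z: in the Koszul formula
  only the derivative of the warping factor along \<open>x\<close> survives.\<close>

lemma hess_mixed_tangential: "g (F pt) (hess ch pt (x, 0) (0, z)) (T pt (\<epsilon> w)) = dlnf x * G pt (\<epsilon> (0, z)) (\<epsilon> w)"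
  using hess_koszul[of "(x, 0)" "(0, z)" w]
  by (simp add: dm_0 linear_0[OF linear_dlnf] inner_product_simps[OF ip_m1] inner_product_simps[OF ip_m2] G_\<epsilon>)

text \<open>The first factor is totally geodesic in the warped product: its metric does not vary
  along the second factor, and mixed metric coefficients are zero.\<close>

lemma hess_factor1: "g (F pt) (hess ch pt (x, 0) (y, 0)) (T pt (\<epsilon> (0, z))) = 0"
  using hess_koszul[of "(x, 0)" "(y, 0)" "(0, z)"]
  by (simp add: dm_0 linear_0[OF linear_dlnf] inner_product_simps[OF ip_m1] inner_product_simps[OF ip_m2] G_\<epsilon>)

text \<open>The second factor is umbilical in the warped product with mean curvature vector minus
  the gradient of ln f; the sign is that of the third Koszul term.\<close>

lemma hess_factor2: "g (F pt) (hess ch pt (0, z) (0, w)) (T pt (\<epsilon> (x, 0))) = - dlnf x * G pt (\<epsilon> (0, z)) (\<epsilon> (0, w))"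
  using hess_koszul[of "(0, z)" "(0, w)" "(x, 0)"]
  by (simp add: dm_0 linear_0[OF linear_dlnf] inner_product_simps[OF ip_m1] inner_product_simps[OF ip_m2] G_\<epsilon>)

lemma hess_tangential:
  assumes "second_ff P B g F pt (\<epsilon> u) (\<epsilon> v) = 0"
  obtains w where "hess ch pt u v = T pt (\<epsilon> w)"
proof -
  have "normal_part P B g F pt (hess ch pt u v) = 0" using assms second_ff_from_chart[OF cp] by simp
  then have "hess ch pt u v = T pt (tangential_part P B g F pt (hess ch pt u v))"
    using normal_part_decomp[where p = pt and w = "hess ch pt u v"] by simp
  then show ?thesis using that \<epsilon>_surj by metis
qed

text \<open>Mixed total geodesy removes the normal part, so the tangential formula determines the
  whole ambient derivative.\<close>

lemma hess_mixed: "hess ch pt (x, 0) (0, z) = dlnf x *\<^sub>R T pt (\<epsilon> (0, z))"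
proof -
  have "second_ff P B g F pt (\<epsilon> (x, 0)) (\<epsilon> (0, z)) = 0"
    using mixed \<epsilon>_factor unfolding mixed_totally_geodesic_def by blast
  then obtain w where w: "hess ch pt (x, 0) (0, z) = T pt (\<epsilon> w)" by (rule hess_tangential)
  have "\<epsilon> w = dlnf x *\<^sub>R \<epsilon> (0, z)"
  proof (rule inner_product_eqI[OF ip_induced[where p = pt]])
    fix s obtain v where v: "s = \<epsilon> v" by (rule \<epsilon>_surj)
    show "G pt (\<epsilon> w) s = G pt (dlnf x *\<^sub>R \<epsilon> (0, z)) s"
      using hess_mixed_tangential[of x z v] w
      by (simp add: inner_product_simps[OF ip_induced] v) (simp add: induced_metric_eq)
  qed
  then show ?thesis by (simp add: w T_simps)
qed

lemma dlnf_eq_\<eta>: "dlnf x = \<eta> (F pt) (T pt (\<epsilon> (x, 0)))"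
proof -
  let ?X = "T pt (\<epsilon> (x, 0))" and ?T = "\<lambda>z. T pt (\<epsilon> (0, z))" and ?\<omega> = "\<lambda>u v. g (F pt) (\<phi> (F pt) u) v"
  have \<omega>0: "?\<omega> ?X (?T z) = 0" for z by (rule \<phi>_factor1_factor2[OF \<epsilon>_factor])
  have key: "(dlnf x - \<eta> (F pt) ?X) * ?\<omega> (?T y) (?T z) = - ?\<omega> ?X (hess ch pt (0, y) (0, z))" for y z
  proof -
    \<comment> \<open>The two coordinate fields lie in the two subbundles at every point of the
      chart, so \<omega> of them is identically zero there.\<close>
    have "((\<lambda>t. let q = chart_inv ch t in
      g (F q) (\<phi> (F q) (T q (from_chart P ch q (x, 0)))) (T q (from_chart P ch q (0, z))))
        has_derivative (\<lambda>w. 0)) (at (snd ch pt))"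
    proof (rule has_derivative_transform_within_open[OF has_derivative_const[of 0]])
      show "open (snd ch ` fst ch)" "snd ch pt \<in> snd ch ` fst ch" using open_charts(3) x12_mem by simp_all
      fix t assume t: "t \<in> snd ch ` fst ch"
      then have t': "chart_inv c1 (fst t) \<in> fst c1" "chart_inv c2 (snd t) \<in> fst c2"
        by (auto simp: smooth_atlasD(3)[OF A1 c1(1)] smooth_atlasD(3)[OF A2 c2(1)])
      have "chart_inv ch t = (chart_inv c1 (fst t), chart_inv c2 (snd t))" by (rule chart_inv_prod[OF A1 A2 c1 c2 t])
      then show "0 = (let q = chart_inv ch t in
          g (F q) (\<phi> (F q) (T q (from_chart P ch q (x, 0)))) (T q (from_chart P ch q (0, z))))"
        using \<phi>_factor1_factor2 factor1_eq[OF A1 A2 c1(1) t'(1) c2(1) t'(2)]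
          factor2_eq[OF A1 A2 c1(1) t'(1) c2(1) t'(2)] by (simp add: Let_def)
    qed
    from fun_cong[OF has_derivative_unique[OF this has_derivative_fundamental_form[OF cp]], of "(0, y)"]
    have "0 = ?\<omega> (hess ch pt (0, y) (x, 0)) (?T z) + ?\<omega> ?X (hess ch pt (0, y) (0, z))
       + ?\<omega> (?T y) ?X * \<eta> (F pt) (?T z) - \<eta> (F pt) ?X * ?\<omega> (?T y) (?T z)" .
    moreover have "hess ch pt (0, y) (x, 0) = dlnf x *\<^sub>R ?T y"
      using hess_mixed hess_sym[OF cp] by metis
    \<comment> \<open>The term with \<eta> of the second field drops out: its factor is \<omega> of
      vectors from the two factors, up to sign.\<close>
    ultimately show ?thesis
      using g_\<phi>_skew[of "F pt" "?T y" ?X] \<omega>0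
      by (simp add: g_simps linear_cmul[OF linear_\<phi>] algebra_simps)
  qed
  obtain Y Z where YZ: "Y \<in> D2 pt" "Z \<in> D2 pt" "?\<omega> (T pt Y) (T pt Z) \<noteq> 0" by (rule exists_\<phi>_nonzero)
  then obtain y z where yz: "Y = \<epsilon> (0, y)" "Z = \<epsilon> (0, z)"
    using factor2_eq[OF A1 A2 c1 c2] factor2_D2 by auto
  \<comment> \<open>By \<open>key\<close> both sides equal an expression in the Hessian, which is
    symmetric in \<open>y\<close> and \<open>z\<close>; skewness of \<omega> then forces the common
    value to be zero.\<close>
  have "(dlnf x - \<eta> (F pt) ?X) * ?\<omega> (?T y) (?T z) = (dlnf x - \<eta> (F pt) ?X) * ?\<omega> (?T z) (?T y)"
    unfolding key using hess_sym[OF cp] by metis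
  then have "(dlnf x - \<eta> (F pt) ?X) * ?\<omega> (?T y) (?T z) = 0"
    using g_\<phi>_skew[of "F pt" "?T z" "?T y"] by simp
  then show ?thesis using YZ(3) yz by simp
qed

lemma dlnf_eq_tan_xi: "dlnf x = G pt (tan_xi P B \<xi> g F pt) (\<epsilon> (x, 0))"
  by (simp add: dlnf_eq_\<eta> \<eta>_eq induced_metric_eq T_tan_xi inner_product_commute[OF ip, of _ "\<xi> _"])

lemma tan_xi_\<epsilon>: obtains v where "tan_xi P B \<xi> g F pt = \<epsilon> (v, 0)"
  using tan_xi_factor1[where p = pt] factor1_eq[OF A1 A2 c1 c2] by auto

lemma G_orth: "G pt (\<epsilon> (x, 0)) (\<epsilon> (0, z)) = 0"
  by (simp add: G_\<epsilon> inner_product_simps[OF ip_m1] inner_product_simps[OF ip_m2])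

end

section \<open>Derivatives and gradient of ln f\<close>

lemma dir_deriv_lnf_factor1:
  assumes "v \<in> factor1 A1 A2 p"
  shows "dir_deriv P (\<lambda>y. ln (f (fst y))) p v = G p v (tan_xi P B \<xi> g F p)"
proof -
  \<comment> \<open>\<open>dir_deriv\<close> refers to the chart chosen at \<open>p\<close>. It
    belongs to the product atlas, so its own factors serve as \<open>c1\<close> and
    \<open>c2\<close>, and \<open>from_chart\<close> is the identity at \<open>p\<close>.\<close>
  obtain c1 c2 where c: "chart_at P p = prod_chart c1 c2" "c1 \<in> A1" "c2 \<in> A2"
    using chart_at(1)[OF A, of p] by (auto simp: prod_atlas_eq)
  obtain a b where p: "p = (a, b)" by (cases p)
  have mem: "a \<in> fst c1" "b \<in> fst c2" using chart_at(2)[OF A, of p] unfolding c(1) by (simp_all add: p)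
  note cc = c(2) mem(1) c(3) mem(2)
  have e: "from_chart P (prod_chart c1 c2) p v = v" for v
    using from_chart_chart_at[OF A, of p] by (simp add: c(1))
  then obtain x where x: "v = (x, 0)"
    using assms factor1_eq[OF A1 A2 cc] by (auto simp: p)
  have "(fst has_derivative fst) (at (snd c1 a, snd c2 b))" by (intro derivative_intros)
  from has_derivative_compose[OF this, of "\<lambda>x. ln (f (chart_inv c1 x))"]
  have "((\<lambda>x. ln (f (chart_inv c1 (fst x)))) has_derivative
      (\<lambda>w. frechet_derivative (\<lambda>x. ln (f (chart_inv c1 x))) (at (snd c1 a)) (fst w))) (at (snd c1 a, snd c2 b))"
    using has_derivative_lnf[OF cc] by simp
  then have "(((\<lambda>y. ln (f (fst y))) \<circ> chart_inv (prod_chart c1 c2)) has_derivative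
      (\<lambda>w. frechet_derivative (\<lambda>x. ln (f (chart_inv c1 x))) (at (snd c1 a)) (fst w))) (at (snd c1 a, snd c2 b))"
    by (rule has_derivative_transform_within_open[OF _ open_charts(3)[OF cc] x12_mem[OF cc]])
      (simp add: chart_inv_prod[OF A1 A2 cc] del: prod_chart_simps)
  then have "dir_deriv P (\<lambda>y. ln (f (fst y))) p v = frechet_derivative (\<lambda>x. ln (f (chart_inv c1 x))) (at (snd c1 a)) x"
    by (simp add: dir_deriv_def c(1) frechet_derivative_eqI x) (simp add: p frechet_derivative_eqI)
  also have "\<dots> = G p (tan_xi P B \<xi> g F p) v"
    using dlnf_eq_tan_xi[OF cc, of x] e[of "(x, 0)"] by (simp add: p x)
  finally show ?thesis using inner_product_commute[OF ip_induced] by metis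
qed

text \<open>The differential of ln f is dual to \<xi>, which is tangent to the first factor and of
  unit length; on that factor the induced metric is \<open>g1\<close>.\<close>

lemma gradient_lnf_norm:
  "g1 a (gradient A1 g1 (\<lambda>a. ln (f a)) a) (gradient A1 g1 (\<lambda>a. ln (f a)) a) = 1"
proof -
  \<comment> \<open>The gradient lives on the first factor, while \<xi> is known at points of the
    product; any \<open>b\<close> supplies such a point over \<open>a\<close>.\<close>
  fix b :: 'b
  let ?c1 = "chart_at A1 a" and ?c2 = "chart_at A2 b" let ?p = "(a, b)"
  note cc = chart_at[OF A1, of a] chart_at[OF A2, of b]
  let ?e = "from_chart P (prod_chart ?c1 ?c2) ?p"
  obtain v where v: "tan_xi P B \<xi> g F ?p = ?e (v, 0)" by (rule tan_xi_\<epsilon>[OF cc])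
  have G: "G ?p (?e (u, 0)) (?e (w, 0)) = g1 a u w" for u w
    using G_\<epsilon>[OF cc, of "(u, 0)" "(w, 0)"] by (simp add: metric_in_chart_at[OF A1] inner_product_simps[OF ip_m2[OF cc]])
  have "dir_deriv A1 (\<lambda>a. ln (f a)) a u = g1 a v u" for u
    using dlnf_eq_tan_xi[OF cc, of u] by (simp add: dir_deriv_def o_def v G)
  then have "gradient A1 g1 (\<lambda>a. ln (f a)) a = v"
    unfolding gradient_def
    by (intro the_equality inner_product_eqI[OF riemannian_metric_inner_product[OF g1, of a]]) simp_all
  moreover have "G ?p (?e (v, 0)) (?e (v, 0)) = 1"
    unfolding v[symmetric] induced_metric_eq T_tan_xi using \<eta>_\<xi> by (simp add: \<eta>_eq)
  ultimately show ?thesis by (simp add: G)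
qed

section \<open>Second fundamental forms of the leaves in the ambient manifold\<close>

lemma immersed_slice1: "immersed A1 B g (\<lambda>a. F (a, b))"
  by (intro immersed.intro A1 B g immersion_comp[OF A1 A B immersion_slice1[OF A1 A2] immersion])

lemma immersed_slice2: "immersed A2 B g (\<lambda>b. F (a, b))"
  by (intro immersed.intro A2 B g immersion_comp[OF A2 A B immersion_slice2[OF A1 A2] immersion])

text \<open>Vanishing of h makes the ambient derivative tangent to the product, and
  \<open>hess_factor1\<close> removes its component along the second factor. What remains is tangent
  to the leaf.\<close>

lemma second_ff_slice1:
  assumes h: "\<And>u v. second_ff P B g F (a, b) u v = 0"
  shows "second_ff A1 B g (\<lambda>a. F (a, b)) a u v = 0"
proof -
  interpret S: immersed A1 B g "\<lambda>a. F (a, b)" by (rule immersed_slice1)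
  let ?c1 = "chart_at A1 a" and ?c2 = "chart_at A2 b"
  let ?c = "prod_chart ?c1 ?c2" and ?p = "(a, b)"
  let ?e = "from_chart P ?c ?p"
  note cc = chart_at[OF A1, of a] chart_at[OF A2, of b]
  have "S.hess ?c1 a u v = hess ?c ?p (u, 0) (v, 0)"
  proof (rule ambient_hessian_affine_restriction[OF A1 smooth_map_slice1[OF A1 A2] cc(1,2) cp(1)[OF cc],
        where L = "\<lambda>x. (x, 0)" and k = "(0, snd ?c2 b)"])
    show "linear (\<lambda>x::'d1. (x, 0::'d2))" by (rule linearI) auto
  qed (use cc in \<open>auto simp: local_rep_def smooth_atlasD(3)[OF A1 cc(1)]\<close>)
  moreover obtain w where w: "hess ?c ?p (u, 0) (v, 0) = T ?p (?e w)"
    using hess_tangential[OF cc h] .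
  have "G ?p (?e w) (?e (0, snd w)) = 0"
    using hess_factor1[OF cc, of u v "snd w"] by (simp add: w induced_metric_eq)
  then have "snd w = 0"
    \<comment> \<open>The square of the component \<open>snd w\<close> occurs multiplied by the
      square of \<open>f a\<close>, which is positive.\<close>
    using f_pos[of a] inner_product_eq_0[OF ip_m2[OF cc]]
    by (simp add: G_\<epsilon>[OF cc] inner_product_simps[OF ip_m1[OF cc]])
  then have "T ?p (?e w) = S.T a (fst w)"
    using tangent_map_comp[OF A1 A B smooth_map_slice1[OF A1 A2] smooth, of b a "fst w"]
      tangent_map_slice1[OF A1 A2 cc, of "fst w"]
    by (cases w) (simp add: from_chart_chart_at[OF A1])
  ultimately show ?thesis by (simp add: S.second_ff_eq_chart_at w S.normal_part_T)
qed

text \<open>The ambient derivative is tangent to the product, and its component along the first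
  factor is fixed by \<open>hess_factor2\<close>. As \<open>dlnf\<close> is the pairing with \<xi>,
  that component is a multiple of \<xi>, which is normal to the leaf.\<close>

lemma second_ff_slice2:
  assumes h: "\<And>u v. second_ff P B g F (a, b) u v = 0"
  shows "second_ff A2 B g (\<lambda>b. F (a, b)) b z w = - induced_metric A2 B g (\<lambda>b. F (a, b)) b z w *\<^sub>R \<xi> (F (a, b))"
proof -
  interpret S: immersed A2 B g "\<lambda>b. F (a, b)" by (rule immersed_slice2)
  let ?c1 = "chart_at A1 a" and ?c2 = "chart_at A2 b"
  let ?c = "prod_chart ?c1 ?c2" and ?p = "(a, b)"
  let ?e = "from_chart P ?c ?p" and ?X = "tan_xi P B \<xi> g F (a, b)"
  note cc = chart_at[OF A1, of a] chart_at[OF A2, of b]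
  have T2: "S.T b y = T ?p (?e (0, y))" for y
    using tangent_map_comp[OF A2 A B smooth_map_slice2[OF A1 A2] smooth, of a b y]
      tangent_map_slice2[OF A1 A2 cc, of y] by (simp add: from_chart_chart_at[OF A2])
  have 1: "S.hess ?c2 b z w = hess ?c ?p (0, z) (0, w)"
  proof (rule ambient_hessian_affine_restriction[OF A2 smooth_map_slice2[OF A1 A2] cc(3,4) cp(1)[OF cc],
        where L = "\<lambda>x. (0, x)" and k = "(snd ?c1 a, 0)"])
    show "linear (\<lambda>x::'d2. (0::'d1, x))" by (rule linearI) auto
  qed (use cc in \<open>auto simp: local_rep_def smooth_atlasD(3)[OF A2 cc(3)]\<close>)
  obtain s where s: "hess ?c ?p (0, z) (0, w) = T ?p (?e s)"
    using hess_tangential[OF cc h] .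
  obtain v where v: "?X = ?e (v, 0)" by (rule tan_xi_\<epsilon>[OF cc])
  define K where "K = G ?p (?e (0, z)) (?e (0, w))"
  note lin = linear_\<epsilon>[OF cc]
  \<comment> \<open>The first-factor component of \<open>s\<close> is identified by its pairings
    with all vectors of that factor.\<close>
  have "G ?p (?e (fst s, 0)) (?e (x, 0)) = G ?p (?e (- K *\<^sub>R v, 0)) (?e (x, 0))" for x
  proof -
    have "G ?p (?e (fst s, 0)) (?e (x, 0)) = G ?p (?e s) (?e (x, 0))"
      by (simp add: G_\<epsilon>[OF cc] inner_product_simps[OF ip_m2[OF cc]])
    also have "\<dots> = - K * G ?p (?e (v, 0)) (?e (x, 0))"
      using hess_factor2[OF cc, of z w x] dlnf_eq_tan_xi[OF cc, of x] by (simp add: s K_def v induced_metric_eq)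
    also have "\<dots> = G ?p (?e (- K *\<^sub>R v, 0)) (?e (x, 0))"
      by (simp add: G_\<epsilon>[OF cc] inner_product_simps[OF ip_m1[OF cc]] inner_product_simps[OF ip_m2[OF cc]])
    finally show ?thesis .
  qed
  then have "fst s = - K *\<^sub>R v"
    by (intro inner_product_eqI[OF ip_m1[OF cc]])
      (simp add: G_\<epsilon>[OF cc] inner_product_simps[OF ip_m2[OF cc]])
  then have "s = (0, snd s) - K *\<^sub>R (v, 0)" by (cases s) simp
  then have "?e s = ?e (0, snd s) - K *\<^sub>R ?X"
    by (metis v linear_diff[OF lin] linear_cmul[OF lin])
  then have 2: "S.hess ?c2 b z w = S.T b (snd s) + (- K *\<^sub>R \<xi> (F ?p))"
    by (simp add: 1 s T2 T_simps T_tan_xi)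
  have "g (F ?p) (\<xi> (F ?p)) (S.T b y) = 0" for y
    using G_orth[OF cc, of v y] by (simp add: T2 induced_metric_eq v[symmetric] T_tan_xi)
  then have "normal_part A2 B g (\<lambda>b. F (a, b)) b (S.hess ?c2 b z w) = - K *\<^sub>R \<xi> (F ?p)"
    \<comment> \<open>The decomposition \<open>2\<close> splits the Hessian into a vector tangent to
      the leaf and a multiple of \<xi>, which is orthogonal to it.\<close>
    by (intro S.normal_part_eqI[OF _ 2]) (simp add: g_simps)
  moreover have "K = S.G b z w" by (simp add: K_def induced_metric_eq S.induced_metric_eq T2)
  ultimately show ?thesis by (simp add: S.second_ff_eq_chart_at)
qed

text \<open>Each unit vector of the basis contributes minus \<xi> to the trace. This identifies the
  factor in \<open>second_ff_slice2\<close> as the mean curvature vector, as umbilicity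
  demands.\<close>

lemma mean_curvature_slice2:
  assumes h: "\<And>u v. second_ff P B g F (a, b) u v = 0"
  shows "mean_curvature A2 B g (\<lambda>b. F (a, b)) b = - \<xi> (F (a, b))"
proof -
  interpret S: immersed A2 B g "\<lambda>b. F (a, b)" by (rule immersed_slice2)
  define E where "E = (SOME E. orthonormal_basis (S.G b) E)"
  have E: "orthonormal_basis (S.G b) E"
    unfolding E_def by (rule someI_ex[OF orthonormal_basis_exists[OF S.ip_induced]])
  have "(\<Sum>u\<in>E. second_ff A2 B g (\<lambda>b. F (a, b)) b u u) = (\<Sum>u\<in>E. - \<xi> (F (a, b)))"
    by (rule sum.cong) (use E in \<open>auto simp: second_ff_slice2[OF h] orthonormal_basis_def\<close>)
  also have "\<dots> = - real DIM('d2) *\<^sub>R \<xi> (F (a, b))"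
    using orthonormal_basis_card[OF S.ip_induced E] by (simp add: sum_constant_scaleR)
  finally show ?thesis by (simp add: mean_curvature_def Let_def E_def[symmetric])
qed

text \<open>The frame vectors in the sum are orthogonal to the last one, which is \<xi>, so ln f has
  zero derivative along them; the unit length of the gradient cancels the 1.\<close>

lemma adapted_frame_bracket_eq_0:
  assumes frame: "adapted_frame A1 A2 B \<phi> \<xi> g F D1 \<theta>1 k U es" and x: "x \<in> U"
  shows "g1 (fst x) (gradient A1 g1 (\<lambda>a. ln (f a)) (fst x)) (gradient A1 g1 (\<lambda>a. ln (f a)) (fst x)) - 1
    - (\<Sum>r=1..k. (dir_deriv P (\<lambda>y. ln (f (fst y))) x (es r x))\<^sup>2) = 0"
proof -
  have "dir_deriv P (\<lambda>y. ln (f (fst y))) x (es r x) = 0" if r: "r \<in> {1..k}" for r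
  proof -
    \<comment> \<open>The sum stops at \<open>k\<close>, short of the index \<open>2*k+1\<close> of
      \<xi>, where the derivative of ln f would be 1.\<close>
    have r': "r \<in> {1..2*k+1}" "2*k+1 \<in> {1..2*k+1}" "r \<noteq> 2*k+1" using r by auto
    have F: "span ((\<lambda>i. es i x) ` {1..2*k+1}) = factor1 A1 A2 x"
      "\<forall>i\<in>{1..2*k+1}. \<forall>j\<in>{1..2*k+1}. G x (es i x) (es j x) = (if i = j then 1 else 0)"
      "es (2*k+1) x = tan_xi P B \<xi> g F x"
      using frame x unfolding adapted_frame_def by blast+
    have "es r x \<in> span ((\<lambda>i. es i x) ` {1..2*k+1})" using r'(1) by (intro span_base imageI)
    then have "es r x \<in> factor1 A1 A2 x" unfolding F(1) .
    moreover have "G x (es r x) (tan_xi P B \<xi> g F x) = 0"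
      using F(2)[rule_format, OF r'(1,2)] r'(3) unfolding F(3) by simp
    ultimately show ?thesis by (simp add: dir_deriv_lnf_factor1)
  qed
  then show ?thesis by (simp add: gradient_lnf_norm)
qed

end

theorem theorem6p1:
  fixes A1 :: "('a::{t2_space,second_countable_topology}, 'd1::euclidean_space) chart set"
    and A2 :: "('b::{t2_space,second_countable_topology}, 'd2::euclidean_space) chart set"
    and B :: "('m::{t2_space,second_countable_topology}, 'e::euclidean_space) chart set"
    and \<phi> :: "'m \<Rightarrow> 'e \<Rightarrow> 'e" and \<xi> :: "'m \<Rightarrow> 'e" and \<eta> :: "'m \<Rightarrow> 'e \<Rightarrow> real"
    and g :: "'m \<Rightarrow> 'e \<Rightarrow> 'e \<Rightarrow> real"
    and F :: "'a \<times> 'b \<Rightarrow> 'm"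
    and g1 :: "'a \<Rightarrow> 'd1 \<Rightarrow> 'd1 \<Rightarrow> real" and g2 :: "'b \<Rightarrow> 'd2 \<Rightarrow> 'd2 \<Rightarrow> real"
    and f :: "'a \<Rightarrow> real"
    and D1 D2 :: "'a \<times> 'b \<Rightarrow> ('d1 \<times> 'd2) set"
    and \<theta>1 \<theta>2 :: "'a \<times> 'b \<Rightarrow> real"
    and p q :: nat
  assumes "kenmotsu_manifold B \<phi> \<xi> \<eta> g"
    and "warped_product_bi_slant A1 A2 B \<phi> \<xi> g F g1 g2 f D1 D2 \<theta>1 \<theta>2"
    and "proper_bi_slant \<theta>1 \<theta>2"
    and "mixed_totally_geodesic A1 A2 B g F"
    and "DIM('d1) = 2 * p + 1"
    and "DIM('d2) = 2 * q"
  shows "let h_norm_sq = second_ff_norm_sq (prod_atlas A1 A2) B g F;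
             grad_lnf = gradient A1 g1 (\<lambda>a. ln (f a));
             bound = (\<lambda>e x. 2 * real q * (1 / sin (\<theta>1 x))\<^sup>2 * ((cos (\<theta>1 x))\<^sup>2 + (cos (\<theta>2 x))\<^sup>2) *
                       (g1 (fst x) (grad_lnf (fst x)) (grad_lnf (fst x)) - 1
                        - (\<Sum>r=1..p. (dir_deriv (prod_atlas A1 A2) (\<lambda>y. ln (f (fst y))) x (e r x))\<^sup>2)))
         in (\<forall>U e. adapted_frame A1 A2 B \<phi> \<xi> g F D1 \<theta>1 p U e \<longrightarrow>
               (\<forall>x\<in>U. h_norm_sq x \<ge> bound e x)) \<and>
            (\<forall>W. (\<forall>x\<in>W. \<exists>U e. adapted_frame A1 A2 B \<phi> \<xi> g F D1 \<theta>1 p U e \<and> x \<in> U \<and>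
                              h_norm_sq x = bound e x) \<longrightarrow>
               (\<forall>b. totally_geodesic_on A1 B g (\<lambda>a. F (a, b)) {a. (a, b) \<in> W}) \<and>
               (\<forall>a. totally_umbilical_on A2 B g (\<lambda>b. F (a, b)) {b. (a, b) \<in> W}))"
proof -
  have proper2: "\<theta>2 x \<noteq> pi / 2" for x using assms(3) unfolding proper_bi_slant_def by blast
  interpret warped_slant A1 A2 B \<phi> \<xi> \<eta> g F g1 g2 f D1 D2 \<theta>1 \<theta>2
    by unfold_locales (fact assms(1) assms(2) assms(4) proper2)+
  \<comment> \<open>Both leaf statements are pointwise, so part (ii) reduces to the vanishing of the
    squared norm at each point of \<open>W\<close>.\<close>
  have totally: "(\<forall>b. totally_geodesic_on A1 B g (\<lambda>a. F (a, b)) {a. (a, b) \<in> W}) \<and>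
      (\<forall>a. totally_umbilical_on A2 B g (\<lambda>b. F (a, b)) {b. (a, b) \<in> W})"
    if "\<And>x. x \<in> W \<Longrightarrow> second_ff_norm_sq P B g F x = 0" for W
    unfolding totally_geodesic_on_def totally_umbilical_on_def
    using second_ff_norm_sq_eq_0[OF that] second_ff_slice1 second_ff_slice2 mean_curvature_slice2 by simp
  show ?thesis
    unfolding Let_def
  proof (intro conjI[OF _ allI[OF impI[OF totally]]] allI impI ballI, goal_cases)
    case (1 U e x)
    then show ?case
      \<comment> \<open>The bracket makes the bound 0, so the claim is nonnegativity of the squared
        norm.\<close>
      by (simp only: adapted_frame_bracket_eq_0[OF 1] mult_zero_right second_ff_norm_sq_nonneg)
  next
    case (2 W x)
    then obtain U e where frame: "adapted_frame A1 A2 B \<phi> \<xi> g F D1 \<theta>1 p U e" "x \<in> U"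
      and eq: "second_ff_norm_sq P B g F x = 2 * real q * (1 / sin (\<theta>1 x))\<^sup>2 * ((cos (\<theta>1 x))\<^sup>2 + (cos (\<theta>2 x))\<^sup>2) *
        (g1 (fst x) (gradient A1 g1 (\<lambda>a. ln (f a)) (fst x)) (gradient A1 g1 (\<lambda>a. ln (f a)) (fst x)) - 1
          - (\<Sum>r=1..p. (dir_deriv P (\<lambda>y. ln (f (fst y))) x (e r x))\<^sup>2))"
      by blast
    from eq show ?case by (simp only: adapted_frame_bracket_eq_0[OF frame] mult_zero_right)
  qed
qed

end
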